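(* The set of conjugacy classes of involutions in $\mathrm{Aut}(S(\mathbb{R}),\pi) \setminus \mathrm{Aut}(S(\mathbb{R})/\pi)$ surjects naturally to the set of conjugacy classes of involutions in $\mathrm{Bir}(S,\pi) \setminus \mathrm{Bir}(S/\pi)$.
   Context: $S\subset\mathbb{P}^3_{\mathbb{R}}$ is the real projective surface $w^2=x^2+y^2+z^2$, and $\pi\colon S\dashrightarrow\mathbb{P}^1$ is $(w:x:y:z)\mapsto(w:z)$. $\mathrm{Bir}(S)$ is the group of birational maps $S\dashrightarrow S$ defined over $\mathbb{R}$; $\mathrm{Bir}(S,\pi)$ is the subgroup of those $g$ for which there is $\alpha\in\mathrm{Aut}(\mathbb{P}^1)$ with $\alpha\pi=\pi g$, and $\mathrm{Bir}(S/\pi)$ the subgroup of those $g$ with $\pi g=\pi$. $\mathrm{Aut}(S(\mathbb{R}))\subset\mathrm{Bir}(S)$ is the subgroup of maps $f$ such that $f,f^{-1}$ are defined at every real point of $S$; $\mathrm{Aut}(S(\mathbb{R}),\pi)=\mathrm{Bir}(S,\pi)\cap\mathrm{Aut}(S(\mathbb{R}))$ and $\mathrm{Aut}(S(\mathbb{R})/\pi)=\mathrm{Bir}(S/\pi)\cap\mathrm{Aut}(S(\mathbb{R}))$. Conjugacy classes are taken in $\mathrm{Aut}(S(\mathbb{R}),\pi)$ and in $\mathrm{Bir}(S,\pi)$ respectively, and the natural map is induced by the inclusion $\mathrm{Aut}(S(\mathbb{R}),\pi)\subset\mathrm{Bir}(S,\pi)$. *)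

theory Defs
  imports "HOL-Analysis.Analysis" "HOL-Algebra.Group_Action"
begin

section \<open>Rational maps over the reals\<close>

text \<open>
  A projective variety over \<open>\<real>\<close> is given by the cone in \<open>complex ^ 'm\<close> over its set of complex
  points (the vertex 0 included); it is assumed integral over \<open>\<complex>\<close>.  Everything defined over
  \<open>\<real>\<close> is expressed by homogeneous polynomials with real coefficients, which are identified with
  the polynomial functions on \<open>complex ^ 'm\<close> that they induce.
\<close>

lemma finite_exponents: "finite {e :: 'm::finite \<Rightarrow> nat. (\<Sum>i\<in>UNIV. e i) = d}"
proof (rule finite_subset)
  show "{e :: 'm \<Rightarrow> nat. (\<Sum>i\<in>UNIV. e i) = d} \<subseteq> Pi\<^sub>E UNIV (\<lambda>_. {..d})"
    by (auto intro: member_le_sum)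
  show "finite (Pi\<^sub>E (UNIV :: 'm set) (\<lambda>_. {..d}))"
    by (rule finite_PiE) auto
qed

definition real_form :: "nat \<Rightarrow> (complex ^ 'm \<Rightarrow> complex) \<Rightarrow> bool" where
  "real_form d p \<longleftrightarrow>
     (\<exists>c :: ('m \<Rightarrow> nat) \<Rightarrow> real.
        \<forall>v. p v = (\<Sum>e | (\<Sum>i\<in>UNIV. e i) = d. of_real (c e) * (\<Prod>i\<in>UNIV. v $ i ^ e i)))"

text \<open>
  A rational map from \<open>X\<close> to \<open>Y\<close> is an equivalence class of tuples of real forms of one common
  degree that do not all vanish identically on \<open>X\<close>; two tuples are equivalent if they are
  proportional at every point of \<open>X\<close>.
\<close>

definition rat_rep ::
  "(complex ^ 'm) set \<Rightarrow> (complex ^ 'n) set \<Rightarrow> (complex ^ 'm \<Rightarrow> complex ^ 'n) \<Rightarrow> bool" where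
  "rat_rep X Y F \<longleftrightarrow>
     (\<exists>d. \<forall>i. real_form d (\<lambda>v. F v $ i)) \<and> (\<exists>v\<in>X. F v \<noteq> 0) \<and> (\<forall>v\<in>X. F v \<in> Y)"

definition rat_eq ::
  "(complex ^ 'm) set \<Rightarrow> (complex ^ 'm \<Rightarrow> complex ^ 'n) \<Rightarrow> (complex ^ 'm \<Rightarrow> complex ^ 'n) \<Rightarrow> bool" where
  "rat_eq X F G \<longleftrightarrow> (\<forall>v\<in>X. \<forall>i j. F v $ i * G v $ j = F v $ j * G v $ i)"

type_synonym ('m, 'n) ratmap = "(complex ^ 'm \<Rightarrow> complex ^ 'n) set"

definition rat_class ::
  "(complex ^ 'm) set \<Rightarrow> (complex ^ 'n) set \<Rightarrow> (complex ^ 'm \<Rightarrow> complex ^ 'n) \<Rightarrow> ('m, 'n) ratmap" where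
  "rat_class X Y F = {G. rat_rep X Y G \<and> rat_eq X F G}"

definition rat_maps :: "(complex ^ 'm) set \<Rightarrow> (complex ^ 'n) set \<Rightarrow> ('m, 'n) ratmap set" where
  "rat_maps X Y = {rat_class X Y F | F. rat_rep X Y F}"

text \<open>
  The composite of \<open>f\<close> from \<open>X\<close> to \<open>Y\<close> and \<open>g\<close> from \<open>Y\<close> to \<open>Z\<close>.  It is the empty set, hence
  no rational map, if no representatives have a composite that is nonzero somewhere on \<open>X\<close>; this
  cannot happen when \<open>f\<close> is dominant.
\<close>

definition rat_comp ::
  "(complex ^ 'm) set \<Rightarrow> (complex ^ 'k) set \<Rightarrow> ('n, 'k) ratmap \<Rightarrow> ('m, 'n) ratmap \<Rightarrow> ('m, 'k) ratmap"
  where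
  "rat_comp X Z g f =
     {H. rat_rep X Z H \<and> (\<exists>F\<in>f. \<exists>G\<in>g. rat_rep X Z (G \<circ> F) \<and> rat_eq X (G \<circ> F) H)}"

definition defined_at :: "('m, 'n::finite) ratmap \<Rightarrow> complex ^ 'm \<Rightarrow> bool" where
  "defined_at f v \<longleftrightarrow> (\<exists>F\<in>f. F v \<noteq> 0)"

definition Bir :: "(complex ^ 'm) set \<Rightarrow> ('m, 'm) ratmap monoid" where
  "Bir X =
     \<lparr>carrier = {f \<in> rat_maps X X. \<exists>g \<in> rat_maps X X.
                   rat_comp X X g f = rat_class X X id \<and> rat_comp X X f g = rat_class X X id},
      mult = rat_comp X X,
      one = rat_class X X id\<rparr>"

text \<open>
  The birational maps of \<open>X\<close> that, together with their inverse, are defined at the points of \<open>X\<close>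
  represented by the nonzero vectors in \<open>P\<close>.
\<close>

definition biregular_at :: "(complex ^ 'm) set \<Rightarrow> (complex ^ 'm) set \<Rightarrow> ('m, 'm) ratmap set" where
  "biregular_at X P =
     {f \<in> carrier (Bir X). \<forall>v\<in>P. v \<noteq> 0 \<longrightarrow> defined_at f v \<and> defined_at (inv\<^bsub>Bir X\<^esub> f) v}"

definition real_points :: "(complex ^ 'm) set \<Rightarrow> (complex ^ 'm) set" where
  "real_points X = {v \<in> X. \<forall>i. v $ i \<in> \<real>}"

section \<open>The surface and its fibration\<close>

text \<open>The homogeneous coordinates \<open>(w : x : y : z)\<close> have the indices 1, 2, 3, 4 in this order.\<close>

definition S :: "(complex ^ 4) set" where
  "S = {v. (v $ 1)\<^sup>2 = (v $ 2)\<^sup>2 + (v $ 3)\<^sup>2 + (v $ 4)\<^sup>2}"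

definition P1 :: "(complex ^ 2) set" where
  "P1 = UNIV"

definition proj :: "(4, 2) ratmap" where
  "proj = rat_class S P1 (\<lambda>v. vector [v $ 1, v $ 4])"

definition Aut_P1 :: "(2, 2) ratmap set" where
  "Aut_P1 = biregular_at P1 P1"

definition Bir_S_proj :: "(4, 4) ratmap monoid" where
  "Bir_S_proj = (Bir S)
     \<lparr>carrier := {g \<in> carrier (Bir S). \<exists>\<alpha> \<in> Aut_P1. rat_comp S P1 \<alpha> proj = rat_comp S P1 proj g}\<rparr>"

definition Bir_S_over_proj :: "(4, 4) ratmap monoid" where
  "Bir_S_over_proj = (Bir S)
     \<lparr>carrier := {g \<in> carrier (Bir S). rat_comp S P1 proj g = proj}\<rparr>"

definition Aut_SR :: "(4, 4) ratmap monoid" where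
  "Aut_SR = (Bir S)\<lparr>carrier := biregular_at S (real_points S)\<rparr>"

definition Aut_SR_proj :: "(4, 4) ratmap monoid" where
  "Aut_SR_proj = (Bir S)\<lparr>carrier := carrier Bir_S_proj \<inter> carrier Aut_SR\<rparr>"

definition Aut_SR_over_proj :: "(4, 4) ratmap monoid" where
  "Aut_SR_over_proj = (Bir S)\<lparr>carrier := carrier Bir_S_over_proj \<inter> carrier Aut_SR\<rparr>"

section \<open>Involutions and conjugacy classes\<close>

definition involutions :: "('a, 'b) monoid_scheme \<Rightarrow> 'a set" where
  "involutions G = {a \<in> carrier G. a \<noteq> \<one>\<^bsub>G\<^esub> \<and> a \<otimes>\<^bsub>G\<^esub> a = \<one>\<^bsub>G\<^esub>}"

definition conj_action :: "('a, 'b) monoid_scheme \<Rightarrow> 'a \<Rightarrow> 'a \<Rightarrow> 'a" where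
  "conj_action G = (\<lambda>g. \<lambda>a \<in> carrier G. g \<otimes>\<^bsub>G\<^esub> a \<otimes>\<^bsub>G\<^esub> inv\<^bsub>G\<^esub> g)"

definition conj_class :: "('a, 'b) monoid_scheme \<Rightarrow> 'a \<Rightarrow> 'a set" where
  "conj_class G a = orbit G (conj_action G) a"

definition conj_classes :: "('a, 'b) monoid_scheme \<Rightarrow> 'a set \<Rightarrow> 'a set set" where
  "conj_classes G A = orbits G A (conj_action G)"

text \<open>
  The map on conjugacy classes induced by the inclusion of a subgroup of \<open>G\<close>: a class \<open>C\<close> of the
  subgroup goes to the class of \<open>G\<close> of the elements of \<open>C\<close>.
\<close>

definition induced_class :: "('a, 'b) monoid_scheme \<Rightarrow> 'a set \<Rightarrow> 'a set" where
  "induced_class G C = (\<Union>a\<in>C. conj_class G a)"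

end

theory Submission
  imports Defs "HOL-Computational_Algebra.Field_as_Ring" "HOL-Computational_Algebra.Polynomial_Factorial"
    "HOL-Computational_Algebra.Fundamental_Theorem_Algebra"
begin

text \<open>
  Put \<open>X = x + i y\<close>, \<open>Y = x - i y\<close>, so that \<open>S\<close> is \<open>X Y = w\<^sup>2 - z\<^sup>2\<close>, and \<open>t = z / w\<close>, \<open>u = X / w\<close>.
  Over the complex numbers \<open>(t, u)\<close> are birational coordinates on \<open>S\<close>; the map to \<open>\<P>\<^sup>1\<close> is \<open>t\<close>, and the
  real points over a real \<open>t\<close> form the circle \<open>|u|\<^sup>2 = 1 - t\<^sup>2\<close>.  An element of \<open>Bir(S, \<pi>)\<close> has the form
  \<open>(t, u) \<mapsto> (\<alpha>(t), M\<^sub>t(u))\<close> with a real Moebius transformation \<open>\<alpha>\<close> and an invertible matrix \<open>M\<close> over the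
  field of rational functions in \<open>t\<close>, because an injective rational function of one variable is a
  Moebius transformation (\<open>moebius_if_injective\<close>).

  What has to be shown is that an involution \<open>\<sigma>\<close> with \<open>\<alpha> \<noteq> id\<close> is conjugate in \<open>Bir(S, \<pi>)\<close> to a map that
  is regular at all real points (\<open>involution_conjugate_regular\<close>).  As the real points of \<open>S\<close> lie over
  \<open>[-1, 1]\<close>, the involution \<open>\<alpha>\<close> preserves this interval, hence swaps its end points and has a fixed
  point inside; a Lorentz boost of \<open>(w, z)\<close> moves that point to \<open>0\<close>, and then \<open>\<alpha>(t) = -t\<close>
  (\<open>conj_to_flip\<close>).

  Now \<open>M(-t) M(t)\<close> is a scalar \<open>\<lambda>(t)\<close>, and \<open>\<lambda>\<close> is even, so it factors as \<open>\<nu>(t) \<nu>(-t)\<close> over the complex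
  numbers.  Hilbert's Theorem 90 for the matrix \<open>M / \<nu>\<close> yields a complex section \<open>p\<close> of the fibration
  that \<open>\<sigma>\<close> preserves (\<open>invariant_section\<close>).  If \<open>E\<close> is the linear form on the fibres that vanishes on
  \<open>p\<close> and \<open>E'\<close> its complex conjugate, then \<open>X \<mapsto> X E' / E\<close> is a real birational map over the base:
  it rotates each circle by a variable angle.  With \<open>E\<close> suitably scaled it is an involution \<open>\<phi>\<close>, and it
  takes \<open>p\<close> to the section \<open>u = \<infinity>\<close> (locale \<open>section_involution\<close>).  The conjugate \<open>\<phi> \<sigma> \<phi>\<close> fixes
  \<open>u = \<infinity>\<close> and maps the circles to circles, so it is \<open>(t, u) \<mapsto> (-t, \<rho>(t) u)\<close> with \<open>|\<rho>| = 1\<close> on the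
  reals (\<open>acts_real\<close>).  A rational function of modulus one on the reals has no real pole; therefore
  \<open>\<phi> \<sigma> \<phi>\<close>, which reverses \<open>z\<close> and turns each circle by the angle \<open>arg \<rho>(t)\<close>, is regular at all
  real points (\<open>rotation_regular\<close>).

  To argue with coordinates, identities between tuples of forms are checked at generic points only;
  this suffices since the varieties involved are integral.
\<close>

section \<open>Real forms\<close>

lemma real_form_zero: "real_form d (\<lambda>v. 0)"
  unfolding real_form_def by (rule exI[of _ "\<lambda>_. 0"]) simp

lemma real_form_add:
  assumes "real_form d p" "real_form d q"
  shows "real_form d (\<lambda>v. p v + q v)"
proof -
  obtain c c' where
    "\<forall>v. p v = (\<Sum>e | (\<Sum>i\<in>UNIV. e i) = d. of_real (c e) * (\<Prod>i\<in>UNIV. v $ i ^ e i))"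
    "\<forall>v. q v = (\<Sum>e | (\<Sum>i\<in>UNIV. e i) = d. of_real (c' e) * (\<Prod>i\<in>UNIV. v $ i ^ e i))"
    using assms unfolding real_form_def by blast
  then show ?thesis unfolding real_form_def
    by (intro exI[of _ "\<lambda>e. c e + c' e"]) (simp add: sum.distrib distrib_right)
qed

lemma real_form_scale:
  assumes "real_form d p"
  shows "real_form d (\<lambda>v. of_real r * p v)"
proof -
  obtain c where
    "\<forall>v. p v = (\<Sum>e | (\<Sum>i\<in>UNIV. e i) = d. of_real (c e) * (\<Prod>i\<in>UNIV. v $ i ^ e i))"
    using assms unfolding real_form_def by blast
  then show ?thesis unfolding real_form_def
    by (intro exI[of _ "\<lambda>e. r * c e"]) (simp add: sum_distrib_left mult_ac)
qed

lemma real_form_minus: "real_form d p \<Longrightarrow> real_form d (\<lambda>v. - p v)"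
  using real_form_scale[of d p "-1"] by simp

lemma real_form_diff: "real_form d p \<Longrightarrow> real_form d q \<Longrightarrow> real_form d (\<lambda>v. p v - q v)"
  using real_form_add[OF _ real_form_minus] by fastforce

lemma real_form_numeral: "real_form d p \<Longrightarrow> real_form d (\<lambda>v. numeral k * p v)"
  using real_form_scale[of d p "numeral k"] by simp

lemma real_form_sum:
  assumes "finite A" "\<And>a. a \<in> A \<Longrightarrow> real_form d (p a)"
  shows "real_form d (\<lambda>v. \<Sum>a\<in>A. p a v)"
  using assms by (induction A rule: finite_induct) (auto intro: real_form_zero real_form_add)

lemma real_form_const: "real_form 0 (\<lambda>v :: complex ^ 'm. of_real r)"
proof -
  have "{e :: 'm \<Rightarrow> nat. (\<Sum>i\<in>UNIV. e i) = 0} = {\<lambda>_. 0}"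
    by (auto simp: fun_eq_iff)
  then show ?thesis unfolding real_form_def
    by (intro exI[of _ "\<lambda>_. r"]) simp
qed

lemma real_form_one: "real_form 0 (\<lambda>v :: complex ^ 'm. 1)"
  using real_form_const[of 1] by simp

lemma real_form_coord: "real_form 1 (\<lambda>v :: complex ^ 'm. v $ i)"
proof -
  define e0 :: "'m \<Rightarrow> nat" where "e0 = (\<lambda>j. if j = i then 1 else 0)"
  have e0: "e0 \<in> {e. (\<Sum>i\<in>UNIV. e i) = 1}" by (simp add: e0_def)
  have "v $ i = (\<Sum>e | (\<Sum>i\<in>UNIV. e i) = 1.
          of_real (if e = e0 then 1 else 0) * (\<Prod>j\<in>UNIV. v $ j ^ e j))" for v :: "complex ^ 'm"
  proof -
    have "(\<Sum>e | (\<Sum>i\<in>UNIV. e i) = 1.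
          of_real (if e = e0 then 1 else 0) * (\<Prod>j\<in>UNIV. v $ j ^ e j))
       = (\<Sum>e | (\<Sum>i\<in>UNIV. e i) = 1. if e = e0 then (\<Prod>j\<in>UNIV. v $ j ^ e j) else 0)"
      by (intro sum.cong) auto
    also have "\<dots> = (\<Prod>j\<in>UNIV. v $ j ^ e0 j)"
      using e0 finite_exponents[where 'm='m, of 1] by simp
    also have "\<dots> = (\<Prod>j\<in>UNIV. if j = i then v $ j else 1)"
      by (intro prod.cong) (auto simp: e0_def)
    also have "\<dots> = v $ i" by simp
    finally show ?thesis by simp
  qed
  then show ?thesis unfolding real_form_def by (intro exI[of _ "\<lambda>e. if e = e0 then 1 else 0"] allI)
qed

lemma real_form_mult:
  assumes "real_form d p" "real_form d' q"
  shows "real_form (d + d') (\<lambda>v :: complex ^ 'm. p v * q v)"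
proof -
  let ?E = "\<lambda>d. {e :: 'm \<Rightarrow> nat. (\<Sum>i\<in>UNIV. e i) = d}"
  let ?m = "\<lambda>(v :: complex ^ 'm) e. \<Prod>i\<in>UNIV. v $ i ^ e i"
  obtain c c' where c: "\<And>v. p v = (\<Sum>e\<in>?E d. of_real (c e) * ?m v e)"
    "\<And>v. q v = (\<Sum>e\<in>?E d'. of_real (c' e) * ?m v e)"
    using assms unfolding real_form_def by blast
  define b where "b = (\<lambda>e. \<Sum>x | x \<in> ?E d \<times> ?E d' \<and> (\<lambda>i. fst x i + snd x i) = e. c (fst x) * c' (snd x))"
  have fin: "finite (?E k)" for k by (rule finite_exponents)
  have "p v * q v = (\<Sum>e\<in>?E (d + d'). of_real (b e) * ?m v e)" for v
  proof -
    have "p v * q v = (\<Sum>x\<in>?E d \<times> ?E d'. of_real (c (fst x) * c' (snd x)) * ?m v (\<lambda>i. fst x i + snd x i))"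
      unfolding c sum_product sum.cartesian_product
      by (intro sum.cong) (auto simp: power_add prod.distrib)
    also have "\<dots> = (\<Sum>e\<in>?E (d + d'). \<Sum>x | x \<in> ?E d \<times> ?E d' \<and> (\<lambda>i. fst x i + snd x i) = e.
        of_real (c (fst x) * c' (snd x)) * ?m v (\<lambda>i. fst x i + snd x i))"
      by (rule sum.group[symmetric]) (auto simp: fin sum.distrib intro: finite_cartesian_product)
    also have "\<dots> = (\<Sum>e\<in>?E (d + d'). of_real (b e) * ?m v e)"
      unfolding b_def of_real_sum sum_distrib_right by (intro sum.cong) auto
    finally show ?thesis .
  qed
  then show ?thesis unfolding real_form_def by blast
qed

lemma real_form_power:
  assumes "real_form d p"
  shows "real_form (k * d) (\<lambda>v. p v ^ k)"
  by (induction k) (auto intro: real_form_one real_form_mult assms)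

lemma real_form_prod:
  assumes "finite A" "\<And>a. a \<in> A \<Longrightarrow> real_form (d a) (p a)"
  shows "real_form (\<Sum>a\<in>A. d a) (\<lambda>v. \<Prod>a\<in>A. p a v)"
  using assms by (induction A rule: finite_induct) (auto intro: real_form_one real_form_mult)

lemma real_form_compose:
  assumes "real_form d p" "\<And>i. real_form e (\<lambda>v. F v $ i)"
  shows "real_form (d * e) (\<lambda>v. p (F v))"
proof -
  obtain c where c:
    "\<And>v. p v = (\<Sum>e | (\<Sum>i\<in>UNIV. e i) = d. of_real (c e) * (\<Prod>i\<in>UNIV. v $ i ^ e i))"
    using assms unfolding real_form_def by blast
  have "real_form (d * e) (\<lambda>v. of_real (c a) * (\<Prod>i\<in>UNIV. F v $ i ^ a i))"
    if "(\<Sum>i\<in>UNIV. a i) = d" for a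
  proof -
    have "real_form (\<Sum>i\<in>UNIV. a i * e) (\<lambda>v. \<Prod>i\<in>UNIV. F v $ i ^ a i)"
      by (intro real_form_prod real_form_power assms finite)
    then show ?thesis using that by (intro real_form_scale) (simp flip: sum_distrib_right)
  qed
  then show ?thesis unfolding c
    by (intro real_form_sum finite_exponents) auto
qed

lemma real_form_homogeneous:
  assumes "real_form d p"
  shows "p (a *s v) = a ^ d * p v"
proof -
  obtain c where c:
    "\<And>v. p v = (\<Sum>e | (\<Sum>i\<in>UNIV. e i) = d. of_real (c e) * (\<Prod>i\<in>UNIV. v $ i ^ e i))"
    using assms unfolding real_form_def by blast
  show ?thesis unfolding c sum_distrib_left
    by (intro sum.cong) (auto simp: power_mult_distrib prod.distrib simp flip: power_sum)
qed

lemma real_form_real: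
  assumes "real_form d p" "\<And>i. v $ i \<in> \<real>"
  shows "p v \<in> \<real>"
proof -
  obtain c where c:
    "\<And>v. p v = (\<Sum>e | (\<Sum>i\<in>UNIV. e i) = d. of_real (c e) * (\<Prod>i\<in>UNIV. v $ i ^ e i))"
    using assms unfolding real_form_def by blast
  show ?thesis unfolding c
    by (intro sum_in_Reals Reals_mult prod_in_Reals Reals_power assms Reals_of_real)
qed

text \<open>
  An induction principle for composites: a property of functions that is stable under the ring
  operations passes from the coordinates of \<open>c\<close> to any form evaluated along \<open>c\<close>.
\<close>

lemma real_form_closure:
  fixes c :: "'a \<Rightarrow> complex ^ 'm" and Q :: "('a \<Rightarrow> complex) \<Rightarrow> bool"
  assumes "real_form d p"
    and const: "\<And>r. Q (\<lambda>x. r)"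
    and add: "\<And>f g. Q f \<Longrightarrow> Q g \<Longrightarrow> Q (\<lambda>x. f x + g x)"
    and mult: "\<And>f g. Q f \<Longrightarrow> Q g \<Longrightarrow> Q (\<lambda>x. f x * g x)"
    and coord: "\<And>i. Q (\<lambda>x. c x $ i)"
  shows "Q (\<lambda>x. p (c x))"
proof -
  have sum: "Q (\<lambda>x. \<Sum>a\<in>A. f a x)" if "finite A" "\<And>a. Q (f a)"
    for A and f :: "('m \<Rightarrow> nat) \<Rightarrow> 'a \<Rightarrow> complex"
    using that by (induction A rule: finite_induct) (auto intro: const add)
  have prod: "Q (\<lambda>x. \<Prod>a\<in>A. f a x)" if "finite A" "\<And>a. Q (f a)"
    for A and f :: "'m \<Rightarrow> 'a \<Rightarrow> complex"
    using that by (induction A rule: finite_induct) (auto intro: const mult)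
  have pow: "Q (\<lambda>x. f x ^ k)" if "Q f" for f k
    using that by (induction k) (auto intro: const mult)
  obtain b where b:
    "\<And>v. p v = (\<Sum>e | (\<Sum>i\<in>UNIV. e i) = d. of_real (b e) * (\<Prod>i\<in>UNIV. v $ i ^ e i))"
    using assms unfolding real_form_def by blast
  show ?thesis unfolding b
    by (intro sum prod pow mult const coord finite_exponents finite)
qed

section \<open>Polynomial functions of one complex parameter\<close>

definition polyfun :: "(complex \<Rightarrow> complex) \<Rightarrow> bool" where
  "polyfun f \<longleftrightarrow> (\<exists>P. \<forall>z. f z = poly P z)"

lemma polyfun_poly [simp, intro]: "polyfun (poly P)"
  unfolding polyfun_def by blast

lemma polyfun_const [simp, intro]: "polyfun (\<lambda>z. c)"
  unfolding polyfun_def by (rule exI[of _ "[:c:]"]) simp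

lemma polyfun_ident [simp, intro]: "polyfun (\<lambda>z. z)"
  unfolding polyfun_def by (rule exI[of _ "[:0, 1:]"]) simp

lemma polyfun_add [intro]: "polyfun f \<Longrightarrow> polyfun g \<Longrightarrow> polyfun (\<lambda>z. f z + g z)"
  unfolding polyfun_def by (metis poly_add)

lemma polyfun_mult [intro]: "polyfun f \<Longrightarrow> polyfun g \<Longrightarrow> polyfun (\<lambda>z. f z * g z)"
  unfolding polyfun_def by (metis poly_mult)

lemma polyfun_minus [intro]: "polyfun f \<Longrightarrow> polyfun (\<lambda>z. - f z)"
  unfolding polyfun_def by (metis poly_minus)

lemma polyfun_diff [intro]: "polyfun f \<Longrightarrow> polyfun g \<Longrightarrow> polyfun (\<lambda>z. f z - g z)"
  unfolding polyfun_def by (metis poly_diff)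

lemma polyfun_power [intro]: "polyfun f \<Longrightarrow> polyfun (\<lambda>z. f z ^ k)"
  by (induction k) auto

lemma polyfun_divide_const [intro]: "polyfun f \<Longrightarrow> polyfun (\<lambda>z. f z / c)"
  unfolding divide_inverse by (intro polyfun_mult polyfun_const)

lemmas polyfun_intros = polyfun_poly polyfun_const polyfun_ident polyfun_add polyfun_mult
  polyfun_minus polyfun_diff polyfun_power polyfun_divide_const

lemma polyfun_compose: "polyfun f \<Longrightarrow> polyfun g \<Longrightarrow> polyfun (\<lambda>z. f (g z))"
  unfolding polyfun_def by (metis poly_pcompose)

lemma polyfun_nonzero:
  assumes "polyfun f" "f a \<noteq> 0"
  shows "\<forall>\<^sub>F z in cofinite. f z \<noteq> 0"
proof -
  obtain P where P: "\<And>z. f z = poly P z" using assms unfolding polyfun_def by blast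
  then have "P \<noteq> 0" using assms by auto
  then show ?thesis unfolding eventually_cofinite P by (simp add: poly_roots_finite)
qed

lemma polyfun_zero:
  assumes "polyfun f" "\<exists>\<^sub>F z in cofinite. f z = 0"
  shows "f a = 0"
  using polyfun_nonzero[OF assms(1)] assms(2) unfolding frequently_def by blast

lemma cofinite_complex_neq_bot [simp]: "(cofinite :: complex filter) \<noteq> bot"
  by (simp add: trivial_limit_def eventually_cofinite infinite_UNIV_char_0)

lemma cofinite_ex: "\<forall>\<^sub>F z :: complex in cofinite. P z \<Longrightarrow> \<exists>z. P z"
  using eventually_happens cofinite_complex_neq_bot by blast

text \<open>
  The genericity in two parameters that is used for \<open>(t, u)\<close>: the finite set of exceptional values of
  \<open>u\<close> may depend on \<open>t\<close>.
\<close>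

abbreviation generically :: "(complex \<Rightarrow> complex \<Rightarrow> bool) \<Rightarrow> bool" where
  "generically P \<equiv> \<forall>\<^sub>F t in cofinite. \<forall>\<^sub>F u in cofinite. P t u"

lemma generically_mono:
  assumes "generically P" "\<And>t u. P t u \<Longrightarrow> Q t u"
  shows "generically Q"
  using assms by (auto elim!: eventually_mono)

lemma generically_conj:
  assumes "generically P" "generically Q"
  shows "generically (\<lambda>t u. P t u \<and> Q t u)"
  using assms by eventually_elim (rule eventually_conj)

lemma generically_ex:
  assumes "generically P"
  shows "\<exists>t u. P t u"
  using cofinite_ex[OF assms] cofinite_ex by blast

lemma real_form_polyfun:
  "real_form d p \<Longrightarrow> (\<And>i. polyfun (\<lambda>z. c z $ i)) \<Longrightarrow> polyfun (\<lambda>z. p (c z))"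
  by (erule real_form_closure) auto

section \<open>Rational maps of integral varieties\<close>

definition parallel :: "complex ^ 'n \<Rightarrow> complex ^ 'n \<Rightarrow> bool" where
  "parallel a b \<longleftrightarrow> (\<forall>i j. a $ i * b $ j = a $ j * b $ i)"

lemma rat_eq_parallel: "rat_eq X F G \<longleftrightarrow> (\<forall>v\<in>X. parallel (F v) (G v))"
  unfolding rat_eq_def parallel_def ..

lemma parallel_refl [simp]: "parallel a a"
  unfolding parallel_def by (simp add: mult.commute)

lemma parallel_sym: "parallel a b \<Longrightarrow> parallel b a"
  unfolding parallel_def by (simp add: mult.commute)

lemma parallel_scale [simp]: "parallel (k *s a) a"
  unfolding parallel_def by (simp add: mult_ac)

lemma parallel_multiple:
  assumes "parallel a b" "b \<noteq> 0"
  obtains k where "a = k *s b"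
proof -
  obtain j where j: "b $ j \<noteq> 0" using assms(2) by (auto simp: vec_eq_iff)
  have "a = (a $ j / b $ j) *s b"
    using assms(1) j unfolding parallel_def vec_eq_iff by (auto simp: field_simps)
  then show ?thesis using that by blast
qed

lemma parallel_multiple_nonzero:
  assumes "parallel a b" "a \<noteq> 0" "b \<noteq> 0"
  obtains k where "k \<noteq> 0" "a = k *s b"
  using parallel_multiple[OF assms(1,3)] assms(2) by (metis vector_smult_lzero)

lemma parallel_scale_cong: "parallel a b \<Longrightarrow> parallel (k *s a) (l *s b)"
  unfolding parallel_def by (simp add: mult_ac)

lemma parallel_trans:
  assumes "parallel a b" "parallel b c" "b \<noteq> 0"
  shows "parallel a c"
proof -
  obtain k where "a = k *s b" using parallel_multiple assms by blast
  moreover obtain l where "c = l *s b" using parallel_multiple parallel_sym assms by blast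
  ultimately show ?thesis by (simp add: parallel_scale_cong)
qed

abbreviation form_map :: "nat \<Rightarrow> (complex ^ 'm \<Rightarrow> complex ^ 'n) \<Rightarrow> bool" where
  "form_map d F \<equiv> (\<forall>i. real_form d (\<lambda>v. F v $ i))"

lemma form_map_homogeneous: "form_map d F \<Longrightarrow> F (a *s v) = a ^ d *s F v"
  by (simp add: vec_eq_iff real_form_homogeneous[of d "\<lambda>v. F v $ _"])

lemma form_map_compose: "form_map d G \<Longrightarrow> form_map e F \<Longrightarrow> form_map (d * e) (\<lambda>v. G (F v))"
  using real_form_compose by blast

lemma form_map_comp: "form_map d G \<Longrightarrow> form_map e F \<Longrightarrow> form_map (d * e) (G \<circ> F)"
  using form_map_compose by (simp add: comp_def)

lemma form_map_id: "form_map 1 (\<lambda>v. v)" "form_map 1 id"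
  using real_form_coord by auto

lemma rat_repE:
  assumes "rat_rep X Y F"
  obtains d where "form_map d F"
  using assms unfolding rat_rep_def by blast

lemma rat_rep_in: "rat_rep X Y F \<Longrightarrow> v \<in> X \<Longrightarrow> F v \<in> Y"
  unfolding rat_rep_def by blast

lemma rat_rep_nonzero: "rat_rep X Y F \<Longrightarrow> \<exists>v\<in>X. F v \<noteq> 0"
  unfolding rat_rep_def by blast

lemma rat_repI: "form_map d F \<Longrightarrow> v \<in> X \<Longrightarrow> F v \<noteq> 0 \<Longrightarrow> (\<And>v. v \<in> X \<Longrightarrow> F v \<in> Y) \<Longrightarrow> rat_rep X Y F"
  unfolding rat_rep_def by blast

text \<open>
  The neighbourhoods of the generic point: sets that contain a nonempty set \<open>{q \<noteq> 0}\<close>, \<open>q\<close> a real form.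
\<close>

definition generic :: "(complex ^ 'm) set \<Rightarrow> (complex ^ 'm) filter" where
  "generic X = (INF q\<in>{q. (\<exists>d. real_form d q) \<and> (\<exists>v\<in>X. q v \<noteq> 0)}. principal {v\<in>X. q v \<noteq> 0})"

text \<open>
  The image lies in no hypersurface; this is what makes pullback of nonzero forms, and with it the
  composition of rational maps, possible.
\<close>

definition dominant :: "(complex ^ 'm) set \<Rightarrow> (complex ^ 'n) set \<Rightarrow> (complex ^ 'm \<Rightarrow> complex ^ 'n) \<Rightarrow> bool" where
  "dominant X Y F \<longleftrightarrow> rat_rep X Y F \<and>
     (\<forall>d p. real_form d p \<longrightarrow> (\<exists>v\<in>Y. p v \<noteq> 0) \<longrightarrow> (\<exists>v\<in>X. p (F v) \<noteq> 0))"

locale integral_variety =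
  fixes X :: "(complex ^ 'm) set"
  assumes nontrivial: "\<exists>v\<in>X. v \<noteq> 0"
    and integral: "real_form d p \<Longrightarrow> real_form e q \<Longrightarrow> \<exists>v\<in>X. p v \<noteq> 0 \<Longrightarrow> \<exists>v\<in>X. q v \<noteq> 0 \<Longrightarrow>
      \<exists>v\<in>X. p v \<noteq> 0 \<and> q v \<noteq> 0"
begin

lemma eventually_generic:
  "eventually P (generic X) \<longleftrightarrow>
     (\<exists>d q. real_form d q \<and> (\<exists>v\<in>X. q v \<noteq> 0) \<and> (\<forall>v\<in>X. q v \<noteq> 0 \<longrightarrow> P v))"
proof -
  let ?B = "{q. (\<exists>d. real_form d q) \<and> (\<exists>v\<in>X. q v \<noteq> 0)}"
  have "eventually P (generic X) \<longleftrightarrow> (\<exists>q\<in>?B. eventually P (principal {v\<in>X. q v \<noteq> 0}))"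
    unfolding generic_def
  proof (rule eventually_INF_base)
    have "(\<lambda>v. 1) \<in> ?B" using nontrivial real_form_one by auto
    then show "?B \<noteq> {}" by blast
  next
    fix p q assume pq: "p \<in> ?B" "q \<in> ?B"
    then have "(\<lambda>v. p v * q v) \<in> ?B"
      using integral[of _ p _ q] real_form_mult[of _ p _ q] by auto blast
    moreover have "principal {v\<in>X. p v * q v \<noteq> 0}
        \<le> inf (principal {v\<in>X. p v \<noteq> 0}) (principal {v\<in>X. q v \<noteq> 0})"
      by (auto simp: le_principal eventually_principal)
    ultimately show "\<exists>x\<in>?B. principal {v\<in>X. x v \<noteq> 0}
        \<le> inf (principal {v\<in>X. p v \<noteq> 0}) (principal {v\<in>X. q v \<noteq> 0})"
      by (intro bexI[of _ "\<lambda>v. p v * q v"])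
  qed
  then show ?thesis by (auto simp: eventually_principal)
qed

lemma generic_form: "real_form d q \<Longrightarrow> \<exists>v\<in>X. q v \<noteq> 0 \<Longrightarrow> \<forall>\<^sub>F v in generic X. q v \<noteq> 0"
  unfolding eventually_generic by blast

lemma generic_in: "\<forall>\<^sub>F v in generic X. v \<in> X"
  unfolding eventually_generic using nontrivial real_form_one by (metis one_neq_zero)

lemma generic_ex: "\<forall>\<^sub>F v in generic X. P v \<Longrightarrow> \<exists>v\<in>X. P v"
  unfolding eventually_generic by blast

lemma generic_zero:
  assumes "real_form d q" "\<forall>\<^sub>F v in generic X. q v = 0" "v \<in> X"
  shows "q v = 0"
proof (rule ccontr)
  assume "q v \<noteq> 0"
  then have "\<forall>\<^sub>F v in generic X. q v \<noteq> 0" using generic_form assms by blast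
  then have "\<forall>\<^sub>F v in generic X. False" using assms(2) by eventually_elim simp
  then show False using generic_ex by blast
qed

lemma generic_rep:
  assumes "rat_rep X Y F"
  shows "\<forall>\<^sub>F v in generic X. F v \<noteq> 0"
proof -
  obtain d where d: "form_map d F" using rat_repE assms by blast
  obtain v i where "v \<in> X" "F v $ i \<noteq> 0"
    using rat_rep_nonzero[OF assms] by (auto simp: vec_eq_iff)
  then have "\<forall>\<^sub>F v in generic X. F v $ i \<noteq> 0" using d by (intro generic_form[of d]) auto
  then show ?thesis by eventually_elim auto
qed

text \<open>
  The proportionality of two tuples is the vanishing of forms, which may be tested generically.
\<close>

lemma generic_rat_eq:
  assumes "form_map d F" "form_map e G" "\<forall>\<^sub>F v in generic X. parallel (F v) (G v)"
  shows "rat_eq X F G"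
proof -
  have "F v $ i * G v $ j - F v $ j * G v $ i = 0" if "v \<in> X" for v i j
  proof (rule generic_zero[OF _ _ that])
    show "real_form (d + e) (\<lambda>v. F v $ i * G v $ j - F v $ j * G v $ i)"
      using assms by (intro real_form_diff real_form_mult) auto
    show "\<forall>\<^sub>F v in generic X. F v $ i * G v $ j - F v $ j * G v $ i = 0"
      using assms(3) by eventually_elim (auto simp: parallel_def)
  qed
  then show ?thesis unfolding rat_eq_def by simp
qed

text \<open>
  Proportionality of vectors is transitive only through nonzero vectors; the tuple in the middle is
  nonzero generically.
\<close>

lemma rat_eq_trans:
  assumes "rat_eq X F G" "rat_eq X G H" "rat_rep X Y F" "rat_rep X Y G" "rat_rep X Y H"
  shows "rat_eq X F H"
proof -
  obtain d e where "form_map d F" "form_map e H" using rat_repE assms by metis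
  then show ?thesis
  proof (rule generic_rat_eq)
    show "\<forall>\<^sub>F v in generic X. parallel (F v) (H v)"
      using generic_in generic_rep[OF assms(4)]
      by eventually_elim (use assms(1,2) in \<open>unfold rat_eq_parallel, blast intro: parallel_trans\<close>)
  qed
qed

lemma rat_eq_refl [simp]: "rat_eq X F F"
  by (simp add: rat_eq_parallel)

lemma rat_eq_sym: "rat_eq X F G \<Longrightarrow> rat_eq X G F"
  by (simp add: rat_eq_parallel parallel_sym)

lemma rat_class_self: "rat_rep X Y F \<Longrightarrow> F \<in> rat_class X Y F"
  unfolding rat_class_def by simp

lemma rat_class_eq:
  assumes "rat_rep X Y F" "rat_rep X Y G"
  shows "rat_class X Y F = rat_class X Y G \<longleftrightarrow> rat_eq X F G"
proof
  assume "rat_class X Y F = rat_class X Y G"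
  then show "rat_eq X F G" using rat_class_self[OF assms(2)] unfolding rat_class_def by blast
next
  assume "rat_eq X F G"
  then show "rat_class X Y F = rat_class X Y G"
    unfolding rat_class_def using rat_eq_trans rat_eq_sym assms by blast
qed

lemma rat_eq_compose:
  assumes F: "rat_rep X Y F" "rat_rep X Y F'" "rat_eq X F F'"
    and G: "rat_rep Y Z G" "rat_rep Y Z G'" "rat_eq Y G G'"
  shows "rat_eq X (G \<circ> F) (G' \<circ> F')"
proof -
  obtain d d' e e' where d: "form_map d F" "form_map d' F'" "form_map e G" "form_map e' G'"
    using rat_repE assms by metis
  have "\<forall>\<^sub>F v in generic X. parallel (G (F v)) (G' (F' v))"
    using generic_rep[OF F(1)] generic_rep[OF F(2)] generic_in
  proof eventually_elim
    case (elim v)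
    then obtain k where k: "F' v = k *s F v"
      using F(3) parallel_multiple parallel_sym unfolding rat_eq_parallel by metis
    have "parallel (G (F v)) (G' (F v))" using G(3) F(1) elim unfolding rat_eq_parallel rat_rep_def by blast
    then have "parallel (1 *s G (F v)) (k ^ e' *s G' (F v))" by (rule parallel_scale_cong)
    then show ?case using d by (simp add: k form_map_homogeneous)
  qed
  then show ?thesis
    using d by (intro generic_rat_eq[of "e * d" _ "e' * d'"]) (auto intro: real_form_compose)
qed

text \<open>
  Composition does not depend on the representatives: by homogeneity a common factor of the inner
  tuple becomes a common factor of the composite.
\<close>

lemma rat_comp_class:
  assumes F: "rat_rep X Y F" and G: "rat_rep Y Z G" and GF: "rat_rep X Z (G \<circ> F)"
  shows "rat_comp X Z (rat_class Y Z G) (rat_class X Y F) = rat_class X Z (G \<circ> F)"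
proof
  show "rat_comp X Z (rat_class Y Z G) (rat_class X Y F) \<subseteq> rat_class X Z (G \<circ> F)"
  proof
    fix H assume "H \<in> rat_comp X Z (rat_class Y Z G) (rat_class X Y F)"
    then obtain F' G' where H: "rat_rep X Z H" "rat_rep X Y F'" "rat_eq X F F'"
      "rat_rep Y Z G'" "rat_eq Y G G'" "rat_rep X Z (G' \<circ> F')" "rat_eq X (G' \<circ> F') H"
      unfolding rat_comp_def rat_class_def by blast
    have "rat_eq X (G \<circ> F) (G' \<circ> F')" by (rule rat_eq_compose) (use F G H in auto)
    then have "rat_eq X (G \<circ> F) H" using rat_eq_trans GF H by blast
    then show "H \<in> rat_class X Z (G \<circ> F)" using H unfolding rat_class_def by blast
  qed
  have "G \<in> rat_class Y Z G" using G unfolding rat_class_def rat_eq_parallel by simp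
  then show "rat_class X Z (G \<circ> F) \<subseteq> rat_comp X Z (rat_class Y Z G) (rat_class X Y F)"
    using rat_class_self[OF F] GF unfolding rat_comp_def by (auto simp: rat_class_def)
qed

lemma rat_rep_id: "rat_rep X X id"
  using nontrivial form_map_id unfolding rat_rep_def by auto

lemma dominant_id: "dominant X X id"
  unfolding dominant_def using rat_rep_id by auto

end

lemma dominant_rep: "dominant X Y F \<Longrightarrow> rat_rep X Y F"
  unfolding dominant_def by blast

lemma dominantD: "dominant X Y F \<Longrightarrow> real_form d p \<Longrightarrow> \<exists>v\<in>Y. p v \<noteq> 0 \<Longrightarrow> \<exists>v\<in>X. p (F v) \<noteq> 0"
  unfolding dominant_def by blast

lemma dominant_rat_rep_compose:
  assumes "dominant X Y F" "rat_rep Y Z G"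
  shows "rat_rep X Z (G \<circ> F)"
proof -
  obtain d e where d: "form_map d F" "form_map e G" using assms rat_repE dominant_rep by metis
  obtain v i where "v \<in> Y" "G v $ i \<noteq> 0"
    using rat_rep_nonzero[OF assms(2)] by (auto simp: vec_eq_iff)
  then obtain v where v: "v \<in> X" "G (F v) $ i \<noteq> 0"
    using dominantD[OF assms(1), of e "\<lambda>v. G v $ i"] d by blast
  show ?thesis
  proof (rule rat_repI)
    show "form_map (e * d) (G \<circ> F)" using form_map_comp[OF d(2,1)] .
    show "v \<in> X" "(G \<circ> F) v \<noteq> 0" using v by auto
    show "(G \<circ> F) v \<in> Z" if "v \<in> X" for v using rat_rep_in[OF assms(2) rat_rep_in[OF dominant_rep[OF assms(1)] that]] by simp
  qed
qed

lemma dominant_compose: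
  assumes "dominant X Y F" "dominant Y Z G"
  shows "dominant X Z (G \<circ> F)"
  unfolding dominant_def
proof (intro conjI allI impI)
  show "rat_rep X Z (G \<circ> F)" using assms dominant_rat_rep_compose dominant_rep by blast
  fix d p assume p: "real_form d p" "\<exists>v\<in>Z. p v \<noteq> 0"
  obtain e where e: "form_map e G" using assms rat_repE dominant_rep by metis
  have "\<exists>v\<in>Y. p (G v) \<noteq> 0" using dominantD[OF assms(2) p] .
  moreover have "real_form (d * e) (\<lambda>v. p (G v))" using p e real_form_compose by blast
  ultimately show "\<exists>v\<in>X. p ((G \<circ> F) v) \<noteq> 0" using dominantD[OF assms(1)] by fastforce
qed

lemma generic_dominant:
  assumes "integral_variety X" "integral_variety Y" "dominant X Y F" "\<forall>\<^sub>F v in generic Y. P v"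
  shows "\<forall>\<^sub>F v in generic X. P (F v)"
proof -
  interpret X: integral_variety X by fact
  interpret Y: integral_variety Y by fact
  obtain d q where q: "real_form d q" "\<exists>v\<in>Y. q v \<noteq> 0" "\<forall>v\<in>Y. q v \<noteq> 0 \<longrightarrow> P v"
    using assms(4) unfolding Y.eventually_generic by blast
  obtain e where e: "form_map e F" using assms rat_repE dominant_rep by metis
  have "\<forall>\<^sub>F v in generic X. q (F v) \<noteq> 0"
    by (rule X.generic_form[OF real_form_compose[OF q(1)]]) (use e dominantD[OF assms(3) q(1,2)] in auto)
  then show ?thesis using X.generic_in
    by eventually_elim (use q assms(3) dominant_rep rat_rep_in in blast)
qed

section \<open>The group of birational maps\<close>

text \<open>
  \<open>Bir X\<close> is the group of units of this monoid, which gives the group axioms at no cost.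
\<close>

definition dominant_monoid :: "(complex ^ 'm) set \<Rightarrow> ('m, 'm) ratmap monoid" where
  "dominant_monoid X =
     \<lparr>carrier = {rat_class X X F | F. dominant X X F}, mult = rat_comp X X, one = rat_class X X id\<rparr>"

context integral_variety
begin

lemma comp_dominant:
  "dominant X X F \<Longrightarrow> dominant X X G \<Longrightarrow>
     rat_comp X X (rat_class X X G) (rat_class X X F) = rat_class X X (G \<circ> F)"
  using rat_comp_class dominant_rep dominant_compose by blast

lemma monoid_dominant: "monoid (dominant_monoid X)"
proof (rule monoidI)
  fix f g h assume "f \<in> carrier (dominant_monoid X)" "g \<in> carrier (dominant_monoid X)"
    "h \<in> carrier (dominant_monoid X)"
  then obtain F G H where
    "f = rat_class X X F" "g = rat_class X X G" "h = rat_class X X H"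
    "dominant X X F" "dominant X X G" "dominant X X H"
    unfolding dominant_monoid_def by auto
  then show "f \<otimes>\<^bsub>dominant_monoid X\<^esub> g \<otimes>\<^bsub>dominant_monoid X\<^esub> h
    = f \<otimes>\<^bsub>dominant_monoid X\<^esub> (g \<otimes>\<^bsub>dominant_monoid X\<^esub> h)"
    by (simp add: dominant_monoid_def comp_dominant dominant_compose comp_assoc)
qed (auto simp: dominant_monoid_def comp_dominant dominant_id intro: dominant_compose)

text \<open>
  A form that vanishes on the image of \<open>F\<close> also vanishes on the image of \<open>F' \<circ> G\<close>, which is generic
  up to scalars.  The representative \<open>F'\<close> in the right inverse may differ from \<open>F\<close>, as the definition
  of \<open>rat_comp\<close> only provides some pair of representatives.
\<close>

lemma dominant_if_right_inverse:
  assumes F: "rat_rep X X F" "rat_rep X X F'" "rat_eq X F F'"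
    and G: "rat_rep X X G" "rat_rep X X (F' \<circ> G)" "rat_eq X (F' \<circ> G) id"
  shows "dominant X X F"
  unfolding dominant_def
proof (intro conjI allI impI)
  fix d p assume p: "real_form d p" "\<exists>v\<in>X. p v \<noteq> 0"
  obtain e where e: "form_map e F" using F rat_repE by metis
  obtain e' where e': "form_map e' F'" using F rat_repE by metis
  show "\<exists>v\<in>X. p (F v) \<noteq> 0"
  proof (rule ccontr)
    assume "\<not> (\<exists>v\<in>X. p (F v) \<noteq> 0)"
    then have 0: "\<And>v. v \<in> X \<Longrightarrow> p (F v) = 0" by blast
    have "\<forall>\<^sub>F v in generic X. p (F' v) = 0"
      using generic_in generic_rep[OF F(1)]
    proof eventually_elim
      case (elim v)
      then obtain k where "F' v = k *s F v"
        using F(3) parallel_multiple parallel_sym unfolding rat_eq_parallel by metis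
      then show ?case using 0 elim real_form_homogeneous[OF p(1)] by simp
    qed
    then have 1: "p (F' v) = 0" if "v \<in> X" for v
      using that generic_zero[OF real_form_compose[OF p(1), of e' F']] e' by blast
    have "\<forall>\<^sub>F v in generic X. p v = 0"
      using generic_in generic_rep[OF rat_rep_id] generic_rep[OF G(2)]
    proof eventually_elim
      case (elim v)
      then obtain k where k: "k \<noteq> 0" "(F' \<circ> G) v = k *s id v"
        using G(3) parallel_multiple_nonzero unfolding rat_eq_parallel by metis
      have "k ^ d * p v = p (F' (G v))" using real_form_homogeneous[OF p(1), of k v] k by simp
      also have "\<dots> = 0" using 1 G(1) elim rat_rep_in by blast
      finally show ?case using k by simp
    qed
    then show False using generic_zero p by blast
  qed
qed (fact F)

lemma Units_dominant: "Units (dominant_monoid X) = carrier (Bir X)"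
proof
  show "Units (dominant_monoid X) \<subseteq> carrier (Bir X)"
  proof
    fix f assume "f \<in> Units (dominant_monoid X)"
    then obtain F G where "dominant X X F" "dominant X X G" "f = rat_class X X F"
      "rat_comp X X (rat_class X X G) f = rat_class X X id"
      "rat_comp X X f (rat_class X X G) = rat_class X X id"
      unfolding Units_def dominant_monoid_def by auto
    then show "f \<in> carrier (Bir X)"
      unfolding Bir_def rat_maps_def using dominant_rep[of X X F] dominant_rep[of X X G]
      by (auto intro!: exI[of _ "rat_class X X G"]; blast)
  qed
  show "carrier (Bir X) \<subseteq> Units (dominant_monoid X)"
  proof
    fix f assume "f \<in> carrier (Bir X)"
    then obtain g where f: "f \<in> rat_maps X X" and g: "g \<in> rat_maps X X"
      and gf: "rat_comp X X g f = rat_class X X id" and fg: "rat_comp X X f g = rat_class X X id"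
      unfolding Bir_def by auto
    have *: "\<exists>F. dominant X X F \<and> f = rat_class X X F"
      if f: "f \<in> rat_maps X X" and g: "g \<in> rat_maps X X"
        and fg: "rat_comp X X f g = rat_class X X id" for f g
    proof -
      obtain F where F: "f = rat_class X X F" "rat_rep X X F" using f unfolding rat_maps_def by blast
      obtain G0 where G0: "g = rat_class X X G0" using g unfolding rat_maps_def by blast
      have "id \<in> rat_comp X X f g" using fg rat_class_self rat_rep_id by simp
      then obtain F' G where FG: "F' \<in> f" "G \<in> g" "rat_rep X X (F' \<circ> G)" "rat_eq X (F' \<circ> G) id"
        unfolding rat_comp_def by blast
      have "dominant X X F"
        using F FG G0 dominant_if_right_inverse[of F F' G] unfolding rat_class_def by blast
      then show ?thesis using F by blast
    qed
    have "f \<in> carrier (dominant_monoid X)" "g \<in> carrier (dominant_monoid X)"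
      using *[OF f g fg] *[OF g f gf] unfolding dominant_monoid_def by auto
    then show "f \<in> Units (dominant_monoid X)"
      unfolding Units_def using fg gf unfolding dominant_monoid_def by auto
  qed
qed

lemma Bir_units: "Bir X = units_of (dominant_monoid X)"
  unfolding units_of_def Units_dominant by (simp add: Bir_def dominant_monoid_def)

lemma group_Bir: "group (Bir X)"
  unfolding Bir_units by (rule monoid.units_group[OF monoid_dominant])

lemma Bir_rep:
  assumes "f \<in> carrier (Bir X)" "F \<in> f"
  shows "dominant X X F" "f = rat_class X X F"
proof -
  have "f \<in> carrier (dominant_monoid X)"
    using assms Units_dominant unfolding Units_def by auto
  then obtain F0 where F0: "dominant X X F0" "f = rat_class X X F0"
    unfolding dominant_monoid_def by auto
  then have F: "rat_rep X X F" "rat_eq X F0 F" using assms unfolding rat_class_def by auto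
  then show "f = rat_class X X F" using F0 rat_class_eq dominant_rep by blast
  show "dominant X X F" unfolding dominant_def
  proof (intro conjI allI impI)
    fix d p assume p: "real_form d p" "\<exists>v\<in>X. p v \<noteq> 0"
    have "\<forall>\<^sub>F v in generic X. p v \<noteq> 0" by (rule generic_form[OF p])
    then have "\<forall>\<^sub>F v in generic X. p (F0 v) \<noteq> 0"
      by (rule generic_dominant[OF integral_variety_axioms integral_variety_axioms F0(1)])
    then have "\<forall>\<^sub>F v in generic X. p (F v) \<noteq> 0"
      using generic_in generic_rep[OF F(1)] generic_rep[OF dominant_rep[OF F0(1)]]
    proof eventually_elim
      case (elim v)
      then obtain k where "k \<noteq> 0" "F v = k *s F0 v"
        using F(2) parallel_multiple_nonzero parallel_sym unfolding rat_eq_parallel by metis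
      then show ?case using elim real_form_homogeneous[OF p(1)] by simp
    qed
    then show "\<exists>v\<in>X. p (F v) \<noteq> 0" by (rule generic_ex)
  qed (fact F)
qed

lemma Bir_obtain_rep:
  assumes "f \<in> carrier (Bir X)"
  obtains F where "F \<in> f" "dominant X X F" "f = rat_class X X F"
proof -
  have "f \<in> carrier (dominant_monoid X)"
    using assms Units_dominant unfolding Units_def by auto
  then obtain F where "dominant X X F" "f = rat_class X X F"
    unfolding dominant_monoid_def by auto
  then show ?thesis using that rat_class_self dominant_rep by blast
qed

lemma Bir_one: "\<one>\<^bsub>Bir X\<^esub> = rat_class X X id"
  by (simp add: Bir_def)

lemma Bir_mult:
  "dominant X X F \<Longrightarrow> dominant X X G \<Longrightarrow>
    rat_class X X G \<otimes>\<^bsub>Bir X\<^esub> rat_class X X F = rat_class X X (G \<circ> F)"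
  using comp_dominant by (simp add: Bir_def)

lemma Bir_mult_rep:
  assumes "f \<in> carrier (Bir X)" "g \<in> carrier (Bir X)" "F \<in> f" "G \<in> g"
  shows "F \<circ> G \<in> f \<otimes>\<^bsub>Bir X\<^esub> g"
proof -
  have "f \<otimes>\<^bsub>Bir X\<^esub> g = rat_class X X (F \<circ> G)"
    using Bir_mult Bir_rep assms by metis
  then show ?thesis using Bir_rep assms rat_class_self dominant_compose dominant_rep by metis
qed

lemma Bir_one_rep: "F \<in> \<one>\<^bsub>Bir X\<^esub> \<longleftrightarrow> rat_rep X X F \<and> rat_eq X F id"
  unfolding Bir_one rat_class_def using rat_eq_sym by blast

lemma BirI:
  assumes F: "rat_rep X X F" and G: "rat_rep X X G"
    and FG: "\<exists>v\<in>X. F (G v) \<noteq> 0" "rat_eq X (F \<circ> G) id"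
    and GF: "\<exists>v\<in>X. G (F v) \<noteq> 0" "rat_eq X (G \<circ> F) id"
  shows "rat_class X X F \<in> carrier (Bir X)" "inv\<^bsub>Bir X\<^esub> (rat_class X X F) = rat_class X X G"
proof -
  interpret B: group "Bir X" by (rule group_Bir)
  have *: "rat_rep X X (F \<circ> G)" if FG: "rat_rep X X F" "rat_rep X X G" "\<exists>v\<in>X. F (G v) \<noteq> 0" for F G
  proof -
    obtain d e where d: "form_map d F" "form_map e G" using FG rat_repE by metis
    obtain v where v: "v \<in> X" "F (G v) \<noteq> 0" using FG by blast
    show ?thesis
    proof (rule rat_repI)
      show "form_map (d * e) (F \<circ> G)" using form_map_comp[OF d] .
      show "v \<in> X" "(F \<circ> G) v \<noteq> 0" using v by auto
      show "(F \<circ> G) v \<in> X" if "v \<in> X" for v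
        using rat_rep_in[OF FG(1) rat_rep_in[OF FG(2) that]] by simp
    qed
  qed
  have "rat_comp X X (rat_class X X F) (rat_class X X G) = rat_class X X (F \<circ> G)"
       "rat_comp X X (rat_class X X G) (rat_class X X F) = rat_class X X (G \<circ> F)"
    using rat_comp_class F G FG GF * by blast+
  then have c: "rat_comp X X (rat_class X X F) (rat_class X X G) = rat_class X X id"
       "rat_comp X X (rat_class X X G) (rat_class X X F) = rat_class X X id"
    using rat_class_eq rat_rep_id F G FG GF * by metis+
  then show 1: "rat_class X X F \<in> carrier (Bir X)"
    unfolding Bir_def rat_maps_def using F G by auto
  have 2: "rat_class X X G \<in> carrier (Bir X)"
    unfolding Bir_def rat_maps_def using F G c by auto
  show "inv\<^bsub>Bir X\<^esub> (rat_class X X F) = rat_class X X G"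
    using c by (intro B.inv_equality 1 2) (simp add: Bir_def)
qed

text \<open>
  Being defined at the points of \<open>P\<close> composes because \<open>P\<close> is stable under all tuples of real forms.
\<close>

lemma subgroup_biregular_at:
  assumes "P \<subseteq> X"
    and P: "\<And>F v. rat_rep X X F \<Longrightarrow> v \<in> P \<Longrightarrow> F v \<in> P"
  shows "subgroup (biregular_at X P) (Bir X)"
proof -
  interpret B: group "Bir X" by (rule group_Bir)
  have mult: "defined_at (f \<otimes>\<^bsub>Bir X\<^esub> g) v"
    if fg: "f \<in> carrier (Bir X)" "g \<in> carrier (Bir X)"
      and v: "v \<in> P" "v \<noteq> 0"
      and f: "\<And>v. v \<in> P \<Longrightarrow> v \<noteq> 0 \<Longrightarrow> defined_at f v"
      and g: "\<And>v. v \<in> P \<Longrightarrow> v \<noteq> 0 \<Longrightarrow> defined_at g v" for f g v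
  proof -
    obtain G where G: "G \<in> g" "G v \<noteq> 0" using g v unfolding defined_at_def by blast
    then have "G v \<in> P" using P Bir_rep(1)[OF fg(2)] dominant_rep v by blast
    then obtain F where "F \<in> f" "F (G v) \<noteq> 0" using f G unfolding defined_at_def by blast
    then show ?thesis using Bir_mult_rep[OF fg _ G(1)] unfolding defined_at_def
      by (intro bexI[of _ "F \<circ> G"]) auto
  qed
  show ?thesis
  proof (rule B.subgroupI)
    show "biregular_at X P \<subseteq> carrier (Bir X)" unfolding biregular_at_def by blast
    have "defined_at \<one>\<^bsub>Bir X\<^esub> v" if "v \<noteq> 0" for v
      unfolding defined_at_def Bir_one using rat_class_self[OF rat_rep_id] that
      by (intro bexI[of _ id]) auto
    then have "\<one>\<^bsub>Bir X\<^esub> \<in> biregular_at X P"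
      unfolding biregular_at_def by simp
    then show "biregular_at X P \<noteq> {}" by blast
  next
    fix f assume "f \<in> biregular_at X P"
    then show "inv\<^bsub>Bir X\<^esub> f \<in> biregular_at X P" unfolding biregular_at_def by simp
  next
    fix f g assume "f \<in> biregular_at X P" "g \<in> biregular_at X P"
    then show "f \<otimes>\<^bsub>Bir X\<^esub> g \<in> biregular_at X P"
      unfolding biregular_at_def by (auto simp: B.inv_mult_group intro!: mult)
  qed
qed

end

text \<open>
  If any two points of \<open>X\<close> lie on a polynomially parametrised curve in \<open>X\<close>, then two forms that do not
  vanish identically restrict to two nonzero polynomials on a suitable curve.
\<close>

lemma integral_variety_curves:
  fixes X :: "(complex ^ 'm) set"
  assumes "\<exists>v\<in>X. v \<noteq> 0"
    and "\<And>a b. a \<in> X \<Longrightarrow> b \<in> X \<Longrightarrow>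
      \<exists>c. c 0 = a \<and> c 1 = b \<and> (\<forall>z. c z \<in> X) \<and> (\<forall>i. polyfun (\<lambda>z. c z $ i))"
  shows "integral_variety X"
proof
  fix d p e q assume pq: "real_form d p" "real_form e q" "\<exists>v\<in>X. p v \<noteq> 0" "\<exists>v\<in>X. q v \<noteq> 0"
  then obtain a b where ab: "a \<in> X" "p a \<noteq> 0" "b \<in> X" "q b \<noteq> 0" by blast
  then obtain c where c: "c 0 = a" "c 1 = b" "\<And>z. c z \<in> X" "\<And>i. polyfun (\<lambda>z. c z $ i)"
    using assms(2) by meson
  have "\<forall>\<^sub>F z in cofinite. p (c z) \<noteq> 0"
    by (rule polyfun_nonzero[OF real_form_polyfun[OF pq(1) c(4)], of 0]) (use c ab in simp)
  moreover have "\<forall>\<^sub>F z in cofinite. q (c z) \<noteq> 0"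
    by (rule polyfun_nonzero[OF real_form_polyfun[OF pq(2) c(4)], of 1]) (use c ab in simp)
  ultimately have "\<forall>\<^sub>F z in cofinite. p (c z) \<noteq> 0 \<and> q (c z) \<noteq> 0" by (rule eventually_conj)
  then obtain z where "p (c z) \<noteq> 0 \<and> q (c z) \<noteq> 0"
    using cofinite_ex by blast
  then show "\<exists>v\<in>X. p v \<noteq> 0 \<and> q v \<noteq> 0" using c by blast
qed (fact assms(1))

section \<open>Coordinates on the surface\<close>

lemma vector_4 [simp]:
  "(vector [a, b, c, d] :: 'a::zero ^ 4) $ 1 = a"
  "(vector [a, b, c, d] :: 'a::zero ^ 4) $ 2 = b"
  "(vector [a, b, c, d] :: 'a::zero ^ 4) $ 3 = c"
  "(vector [a, b, c, d] :: 'a::zero ^ 4) $ 4 = d"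
  unfolding vector_def by auto

lemma vec_eq_4: "(v :: 'a ^ 4) = v' \<longleftrightarrow> v $ 1 = v' $ 1 \<and> v $ 2 = v' $ 2 \<and> v $ 3 = v' $ 3 \<and> v $ 4 = v' $ 4"
  by (simp add: vec_eq_iff forall_4)

lemma vec_eq_2: "(v :: 'a ^ 2) = v' \<longleftrightarrow> v $ 1 = v' $ 1 \<and> v $ 2 = v' $ 2"
  by (simp add: vec_eq_iff forall_2)

text \<open>
  Over the complex numbers \<open>S\<close> becomes a split quadric in the coordinates \<open>w, X, Y, z\<close>.
\<close>

definition Xc :: "complex ^ 4 \<Rightarrow> complex" where "Xc v = v $ 2 + \<i> * v $ 3"
definition Yc :: "complex ^ 4 \<Rightarrow> complex" where "Yc v = v $ 2 - \<i> * v $ 3"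

definition wXYz :: "complex \<Rightarrow> complex \<Rightarrow> complex \<Rightarrow> complex \<Rightarrow> complex ^ 4" where
  "wXYz w X Y z = vector [w, (X + Y) / 2, (X - Y) / (2 * \<i>), z]"

lemma wXYz_simps [simp]:
  "wXYz w X Y z $ 1 = w" "wXYz w X Y z $ 4 = z" "Xc (wXYz w X Y z) = X" "Yc (wXYz w X Y z) = Y"
  unfolding wXYz_def Xc_def Yc_def by (auto simp: field_simps)

lemma Xc_scale [simp]: "Xc (k *s v) = k * Xc v"
  and Yc_scale [simp]: "Yc (k *s v) = k * Yc v"
  unfolding Xc_def Yc_def by (auto simp: algebra_simps)

lemma eq_wXYz: "v = wXYz (v $ 1) (Xc v) (Yc v) (v $ 4)"
  unfolding vec_eq_4 wXYz_def Xc_def Yc_def by (auto simp: field_simps)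

lemma vec_eq_XY: "v = v' \<longleftrightarrow> v $ 1 = v' $ 1 \<and> Xc v = Xc v' \<and> Yc v = Yc v' \<and> v $ 4 = v' $ 4"
  using eq_wXYz by metis

lemma XY_mult: "Xc v * Yc v = (v $ 2)\<^sup>2 + (v $ 3)\<^sup>2"
  unfolding Xc_def Yc_def by (simp add: algebra_simps power2_eq_square)

lemma S_iff: "v \<in> S \<longleftrightarrow> Xc v * Yc v = (v $ 1)\<^sup>2 - (v $ 4)\<^sup>2"
  unfolding S_def XY_mult by (auto simp: algebra_simps)

lemma real_form_XY: "real_form 2 (\<lambda>v. Xc v * Yc v)"
  unfolding XY_mult
  using real_form_add[OF real_form_power[OF real_form_coord, of 2 2]
      real_form_power[OF real_form_coord, of 2 3]] by simp

text \<open>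
  A singular \<open>2 \<times> 2\<close> matrix is the product of a column and a row.  This parametrises the cone over \<open>S\<close>,
  with matrix entries \<open>w - z\<close>, \<open>X\<close>, \<open>Y\<close>, \<open>w + z\<close>.
\<close>

lemma rank_one:
  fixes \<alpha> \<beta> \<gamma> \<delta> :: complex
  assumes "\<alpha> * \<delta> = \<beta> * \<gamma>"
  obtains p q r s where "\<alpha> = p * r" "\<beta> = p * s" "\<gamma> = q * r" "\<delta> = q * s"
proof (cases "\<alpha> = 0")
  case False
  show ?thesis by (rule that[of \<alpha> 1 "\<beta> / \<alpha>" \<gamma>]) (use False assms in \<open>auto simp: field_simps\<close>)
next
  case True
  show ?thesis
  proof (cases "\<beta> = 0")
    case True
    show ?thesis by (rule that[of 0 \<gamma> \<delta> 1]) (use True \<open>\<alpha> = 0\<close> in auto)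
  next
    case False
    show ?thesis by (rule that[of \<beta> 0 1 \<delta>]) (use False assms \<open>\<alpha> = 0\<close> in auto)
  qed
qed

lemma polyfun_wXYz:
  assumes "polyfun w" "polyfun X" "polyfun Y" "polyfun z"
  shows "polyfun (\<lambda>t. wXYz (w t) (X t) (Y t) (z t) $ i)"
proof -
  have "\<forall>i. polyfun (\<lambda>t. wXYz (w t) (X t) (Y t) (z t) $ i)"
    unfolding forall_4 wXYz_def vector_4
    by (intro conjI polyfun_intros assms)
  then show ?thesis ..
qed

lemma integral_S: "integral_variety S"
proof (rule integral_variety_curves)
  have "vector [1, 1, 0, 0] \<in> S" unfolding S_def by simp
  moreover have "(vector [1, 1, 0, 0] :: complex ^ 4) \<noteq> 0" by (simp add: vec_eq_4)
  ultimately show "\<exists>v\<in>S. v \<noteq> 0" by blast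
next
  fix a b assume "a \<in> S" "b \<in> S"
  define \<Phi> where "\<Phi> = (\<lambda>p q r s. wXYz ((p * r + q * s) / 2) (p * s) (q * r) ((q * s - p * r) / 2))"
  have \<Phi>: "\<Phi> p q r s \<in> S" for p q r s
    unfolding S_iff \<Phi>_def by (simp add: field_simps power2_eq_square)
  have surj: "\<exists>p q r s. v = \<Phi> p q r s" if "v \<in> S" for v
  proof -
    have "(v $ 1 - v $ 4) * (v $ 1 + v $ 4) = Xc v * Yc v"
      using that unfolding S_iff by (simp add: algebra_simps power2_eq_square)
    then obtain p q r s where
      "v $ 1 - v $ 4 = p * r" "Xc v = p * s" "Yc v = q * r" "v $ 1 + v $ 4 = q * s"
      by (rule rank_one)
    moreover from this have "v $ 1 = (p * r + q * s) / 2" "v $ 4 = (q * s - p * r) / 2"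
      by (simp_all add: field_simps flip: \<open>v $ 1 - v $ 4 = p * r\<close> \<open>v $ 1 + v $ 4 = q * s\<close>)
    ultimately have "v = \<Phi> p q r s" unfolding vec_eq_XY \<Phi>_def by simp
    then show ?thesis by blast
  qed
  \<comment> \<open>A line in the space of the parameters gives the curve through the two points.\<close>
  obtain p q r s p' q' r' s' where ab: "a = \<Phi> p q r s" "b = \<Phi> p' q' r' s'"
    using surj \<open>a \<in> S\<close> \<open>b \<in> S\<close> by metis
  let ?l = "\<lambda>(x::complex) y z. x + z * (y - x)"
  have l: "polyfun (?l x y)" for x y by (intro polyfun_intros)
  let ?c = "\<lambda>z. \<Phi> (?l p p' z) (?l q q' z) (?l r r' z) (?l s s' z)"
  have "?c 0 = a" "?c 1 = b" unfolding ab by auto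
  moreover have "polyfun (\<lambda>z. ?c z $ i)" for i
    unfolding \<Phi>_def by (intro polyfun_wXYz polyfun_divide_const polyfun_add polyfun_mult polyfun_diff l)
       auto
  ultimately show "\<exists>c. c 0 = a \<and> c 1 = b \<and> (\<forall>z. c z \<in> S) \<and> (\<forall>i. polyfun (\<lambda>z. c z $ i))"
    using \<Phi> by (intro exI[of _ ?c]) auto
qed

interpretation S: integral_variety S by (rule integral_S)

lemma integral_P1: "integral_variety P1"
proof (rule integral_variety_curves)
  show "\<exists>v\<in>P1. v \<noteq> 0" unfolding P1_def by (auto intro: exI[of _ "1"])
  fix a b :: "complex ^ 2"
  show "\<exists>c. c 0 = a \<and> c 1 = b \<and> (\<forall>z. c z \<in> P1) \<and> (\<forall>i. polyfun (\<lambda>z. c z $ i))"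
    by (rule exI[of _ "\<lambda>z. a + z *s (b - a)"])
      (auto simp: P1_def simp del: right_diff_distrib intro!: polyfun_intros)
qed

interpretation P1: integral_variety P1 by (rule integral_P1)

interpretation Bir_S: group "Bir S" by (rule S.group_Bir)
interpretation Bir_P1: group "Bir P1" by (rule P1.group_Bir)

text \<open>
  Short notation for the group in which everything takes place.
\<close>

abbreviation mult_S (infixl "\<cdot>" 70) where "f \<cdot> g \<equiv> f \<otimes>\<^bsub>Bir S\<^esub> g"
abbreviation inv_S ("inv\<^sub>S _" [81] 80) where "inv\<^sub>S f \<equiv> inv\<^bsub>Bir S\<^esub> f"
abbreviation one_S ("\<one>\<^sub>S") where "\<one>\<^sub>S \<equiv> \<one>\<^bsub>Bir S\<^esub>"

text \<open>
  The point with \<open>z / w = t\<close> and \<open>X / w = u\<close>, in homogeneous coordinates free of denominators.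
\<close>

definition Psi :: "complex \<Rightarrow> complex \<Rightarrow> complex ^ 4" where
  "Psi t u = wXYz u (u\<^sup>2) (1 - t\<^sup>2) (t * u)"

lemma Psi_simps [simp]:
  "Psi t u $ 1 = u" "Psi t u $ 4 = t * u" "Xc (Psi t u) = u\<^sup>2" "Yc (Psi t u) = 1 - t\<^sup>2"
  unfolding Psi_def by simp_all

lemma Psi_in_S [simp]: "Psi t u \<in> S"
  unfolding S_iff by (simp add: algebra_simps power2_eq_square)

lemma S_eq_Psi:
  assumes "v \<in> S" "v $ 1 \<noteq> 0" "Xc v \<noteq> 0"
  shows "v = ((v $ 1)\<^sup>2 / Xc v) *s Psi (v $ 4 / v $ 1) (Xc v / v $ 1)"
proof -
  have "Yc v = ((v $ 1)\<^sup>2 - (v $ 4)\<^sup>2) / Xc v"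
    using assms unfolding S_iff by (simp add: field_simps)
  then show ?thesis
    unfolding vec_eq_XY using assms(2,3) by (simp add: divide_simps) (simp add: algebra_simps power2_eq_square)
qed

lemma polyfun_Psi: "polyfun (\<lambda>u. Psi t u $ i)" "polyfun (\<lambda>t. Psi t u $ i)"
  unfolding Psi_def by (intro polyfun_wXYz polyfun_intros)+

text \<open>
  The image of \<open>Psi\<close> contains up to scalars all points with \<open>w X \<noteq> 0\<close>, in particular one at which a
  given nonzero form does not vanish.
\<close>

lemma generic_Psi:
  assumes "\<forall>\<^sub>F v in generic S. P v"
  shows "generically (\<lambda>t u. P (Psi t u))"
proof -
  obtain d q where q: "real_form d q" "\<exists>v\<in>S. q v \<noteq> 0" "\<forall>v\<in>S. q v \<noteq> 0 \<longrightarrow> P v"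
    using assms unfolding S.eventually_generic by blast
  have v0: "vector [1, 1, 0, 0] \<in> S" unfolding S_def by simp
  have "\<forall>\<^sub>F v in generic S. v $ 1 \<noteq> 0"
    by (rule S.generic_form[OF real_form_coord]) (use v0 in force)
  moreover have "\<forall>\<^sub>F v in generic S. Xc v * Yc v \<noteq> 0"
    by (rule S.generic_form[OF real_form_XY]) (rule bexI[OF _ v0], simp add: XY_mult)
  moreover have "\<forall>\<^sub>F v in generic S. q v \<noteq> 0"
    by (rule S.generic_form[OF q(1,2)])
  ultimately have "\<forall>\<^sub>F v in generic S. v $ 1 \<noteq> 0 \<and> Xc v \<noteq> 0 \<and> q v \<noteq> 0"
    by eventually_elim auto
  then obtain v where v: "v \<in> S" "v $ 1 \<noteq> 0" "Xc v \<noteq> 0" "q v \<noteq> 0"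
    using S.generic_ex by blast
  define t0 u0 where "t0 = v $ 4 / v $ 1" and "u0 = Xc v / v $ 1"
  have "q (Psi t0 u0) \<noteq> 0"
    using real_form_homogeneous[OF q(1)] S_eq_Psi[OF v(1-3)] v(4)
    unfolding t0_def u0_def by (metis mult_zero_right)
  then have "\<forall>\<^sub>F t in cofinite. q (Psi t u0) \<noteq> 0"
    by (rule polyfun_nonzero[OF real_form_polyfun[OF q(1) polyfun_Psi(2)]])
  then show ?thesis
  proof eventually_elim
    case (elim t)
    have "\<forall>\<^sub>F u in cofinite. q (Psi t u) \<noteq> 0"
      using elim by (rule polyfun_nonzero[OF real_form_polyfun[OF q(1) polyfun_Psi(1)]])
    then show ?case by eventually_elim (use q Psi_in_S in blast)
  qed
qed

text \<open>
  Polynomial in each variable separately, which is easy to check for composites and is all that the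
  identity theorem \<open>biv_zero\<close> uses.
\<close>

definition biv :: "(complex \<Rightarrow> complex \<Rightarrow> complex) \<Rightarrow> bool" where
  "biv f \<longleftrightarrow> (\<forall>t. polyfun (f t)) \<and> (\<forall>u. polyfun (\<lambda>t. f t u))"

lemma biv_intros [intro]:
  "biv f \<Longrightarrow> biv g \<Longrightarrow> biv (\<lambda>t u. f t u + g t u)"
  "biv f \<Longrightarrow> biv g \<Longrightarrow> biv (\<lambda>t u. f t u - g t u)"
  "biv f \<Longrightarrow> biv g \<Longrightarrow> biv (\<lambda>t u. f t u * g t u)"
  "polyfun p \<Longrightarrow> biv (\<lambda>t u. p t)" "polyfun p \<Longrightarrow> biv (\<lambda>t u. p u)"
  unfolding biv_def by auto

lemma biv_zero:
  assumes "biv f" "generically (\<lambda>t u. f t u = 0)"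
  shows "f t u = 0"
proof -
  have "\<forall>\<^sub>F t in cofinite. f t u = 0" for u
    using assms(2)
  proof eventually_elim
    case (elim t)
    then show ?case using assms(1) polyfun_zero unfolding biv_def
      by (metis eventually_frequently cofinite_complex_neq_bot)
  qed
  then show ?thesis using assms(1) polyfun_zero[of "\<lambda>t. f t u"] unfolding biv_def
    by (metis eventually_frequently cofinite_complex_neq_bot)
qed

lemma biv_form: "real_form d p \<Longrightarrow> biv (\<lambda>t u. p (Psi t u))"
  unfolding biv_def by (intro conjI allI; erule real_form_polyfun; rule polyfun_Psi)

lemma biv_form_map:
  assumes "form_map d F"
  shows "biv (\<lambda>t u. F (Psi t u) $ i)" "biv (\<lambda>t u. Xc (F (Psi t u)))" "biv (\<lambda>t u. Yc (F (Psi t u)))"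
  unfolding Xc_def Yc_def using assms biv_form[of d "\<lambda>v. F v $ _"] by (auto intro!: biv_intros)

lemma S_form_zero:
  assumes "real_form d p" "generically (\<lambda>t u. p (Psi t u) = 0)" "v \<in> S"
  shows "p v = 0"
proof (rule ccontr)
  assume "p v \<noteq> 0"
  then have "generically (\<lambda>t u. p (Psi t u) \<noteq> 0)"
    using generic_Psi S.generic_form assms by blast
  from generically_ex[OF generically_conj[OF this assms(2)]] show False by blast
qed

lemma S_rat_eqI:
  assumes "form_map d F" "form_map e G"
    "generically (\<lambda>t u. parallel (F (Psi t u)) (G (Psi t u)))"
  shows "rat_eq S F G"
proof -
  have "F v $ i * G v $ j - F v $ j * G v $ i = 0" if "v \<in> S" for v i j
  proof (rule S_form_zero[OF _ _ that])
    show "real_form (d + e) (\<lambda>v. F v $ i * G v $ j - F v $ j * G v $ i)"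
      using assms by (intro real_form_diff real_form_mult) auto
    show "generically (\<lambda>t u. F (Psi t u) $ i * G (Psi t u) $ j - F (Psi t u) $ j * G (Psi t u) $ i = 0)"
        using assms(3) by (rule generically_mono) (auto simp: parallel_def)
  qed
  then show ?thesis unfolding rat_eq_def by simp
qed

text \<open>
  A point of \<open>S\<close> outside \<open>w X = 0\<close> is determined by \<open>z / w\<close> and \<open>X / w\<close>.
\<close>

lemma S_parallelI:
  assumes "a \<in> S" "b \<in> S" "a $ 1 \<noteq> 0" "b $ 1 \<noteq> 0" "Xc b \<noteq> 0"
    and "a $ 4 * b $ 1 = b $ 4 * a $ 1" "Xc a * b $ 1 = Xc b * a $ 1"
  shows "parallel a b"
proof -
  have "Xc a \<noteq> 0" using assms by auto
  have "a $ 4 / a $ 1 = b $ 4 / b $ 1" "Xc a / a $ 1 = Xc b / b $ 1"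
    using assms by (auto simp: field_simps)
  then show ?thesis
    using S_eq_Psi[OF assms(1,3) \<open>Xc a \<noteq> 0\<close>] S_eq_Psi[OF assms(2,4,5)]
    by (metis parallel_scale_cong parallel_refl)
qed

lemma parallel_coords:
  assumes "parallel a b"
  shows "a $ 4 * b $ 1 = b $ 4 * a $ 1" "Xc a * b $ 1 = Xc b * a $ 1"
proof -
  show "a $ 4 * b $ 1 = b $ 4 * a $ 1" using assms unfolding parallel_def by (metis mult.commute)
  have "a $ 2 * b $ 1 = b $ 2 * a $ 1" "a $ 3 * b $ 1 = b $ 3 * a $ 1"
    using assms unfolding parallel_def by (metis mult.commute)+
  then show "Xc a * b $ 1 = Xc b * a $ 1" unfolding Xc_def by (simp add: algebra_simps)
qed

section \<open>Real points\<close>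

definition rpt :: "real \<Rightarrow> real \<Rightarrow> real \<Rightarrow> complex ^ 4" where
  "rpt a b t = vector [1, of_real a, of_real b, of_real t]"

lemma rpt_real: "rpt a b t $ i \<in> \<real>"
proof -
  have "\<forall>i. rpt a b t $ i \<in> \<real>" unfolding forall_4 rpt_def by simp
  then show ?thesis ..
qed

lemma rpt_simps [simp]: "rpt a b t $ 1 = 1" "rpt a b t $ 4 = of_real t" "Xc (rpt a b t) = Complex a b"
   "Yc (rpt a b t) = Complex a (- b)"
  by (auto simp: rpt_def Xc_def Yc_def complex_eq_iff)

lemma rpt_in_S: "rpt a b t \<in> S \<longleftrightarrow> a\<^sup>2 + b\<^sup>2 = 1 - t\<^sup>2"
proof -
  have "rpt a b t \<in> S \<longleftrightarrow> complex_of_real 1 = of_real (a\<^sup>2 + b\<^sup>2 + t\<^sup>2)"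
    unfolding S_def rpt_def by simp
  then show ?thesis unfolding of_real_eq_iff by auto
qed

lemma real_point_coords:
  assumes "v \<in> real_points S"
  obtains f where "\<And>i. v $ i = of_real (f i)" "(f 1)\<^sup>2 = (f 2)\<^sup>2 + (f 3)\<^sup>2 + (f 4)\<^sup>2"
proof -
  define f where "f i = Re (v $ i)" for i
  have f: "v $ i = of_real (f i)" for i
    using assms unfolding real_points_def f_def by (auto simp: of_real_Re)
  have "complex_of_real ((f 1)\<^sup>2) = of_real ((f 2)\<^sup>2 + (f 3)\<^sup>2 + (f 4)\<^sup>2)"
    using assms unfolding real_points_def S_def by (simp add: f)
  then show ?thesis using that f unfolding of_real_eq_iff by blast
qed

lemma rpt_real_point: "a\<^sup>2 + b\<^sup>2 = 1 - t\<^sup>2 \<Longrightarrow> rpt a b t \<in> real_points S"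
  unfolding real_points_def using rpt_in_S rpt_real by blast

text \<open>
  On the circle \<open>|u|\<^sup>2 = 1 - t\<^sup>2\<close> the parametrisation yields the real points of the fibre over \<open>t\<close>.
\<close>

lemma Psi_rpt:
  assumes "(cmod u)\<^sup>2 = 1 - t\<^sup>2"
  shows "Psi (of_real t) u = u *s rpt (Re u) (Im u) t"
proof -
  have "u * cnj u = of_real (1 - t\<^sup>2)" using assms by (simp add: complex_norm_square[symmetric])
  then have "u * Complex (Re u) (- Im u) = 1 - (of_real t)\<^sup>2" by (simp add: cnj.code)
  then show ?thesis unfolding vec_eq_XY by (simp add: power2_eq_square)
qed

lemma infinite_circle:
  assumes "0 < (r::real)"
  shows "infinite {u. (cmod u)\<^sup>2 = r}"
proof
  assume "finite {u. (cmod u)\<^sup>2 = r}"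
  then have "finite (Re ` {u. (cmod u)\<^sup>2 = r})" by simp
  moreover have "{0<..<sqrt r} \<subseteq> Re ` {u. (cmod u)\<^sup>2 = r}"
  proof
    fix x assume x: "x \<in> {0<..<sqrt r}"
    then have "x\<^sup>2 \<le> r" using assms power_strict_mono[of x "sqrt r" 2] by simp
    then have "(cmod (Complex x (sqrt (r - x\<^sup>2))))\<^sup>2 = r" by (simp add: cmod_power2)
    then show "x \<in> Re ` {u. (cmod u)\<^sup>2 = r}" by (intro image_eqI[of _ _ "Complex x (sqrt (r - x\<^sup>2))"]) auto
  qed
  ultimately have "finite {0<..<sqrt r}" using finite_subset by blast
  then show False using assms infinite_Ioo[of 0 "sqrt r"] by simp
qed

text \<open>
  For real \<open>t\<close> strictly between \<open>-1\<close> and \<open>1\<close> the circle is infinite, so it meets every cofinite set of \<open>u\<close>.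
\<close>

lemma generic_real_parameter:
  assumes "generically (\<lambda>t u. P t u)"
  shows "\<forall>\<^sub>F t :: real in cofinite. -1 < t \<longrightarrow> t < 1 \<longrightarrow>
    infinite {u. (cmod u)\<^sup>2 = 1 - t\<^sup>2 \<and> P (of_real t) u}"
proof -
  have "finite {t. \<not> (\<forall>\<^sub>F u in cofinite. P t u)}" using assms unfolding eventually_cofinite .
  then have "finite (of_real -` {t. \<not> (\<forall>\<^sub>F u in cofinite. P t u)} :: real set)"
    by (rule finite_vimageI) (simp add: inj_on_def)
  then have "\<forall>\<^sub>F t :: real in cofinite. \<forall>\<^sub>F u in cofinite. P (of_real t) u"
    unfolding eventually_cofinite by (simp add: vimage_def)
  then show ?thesis
  proof eventually_elim
    case (elim t)
    show ?case
    proof (intro impI notI)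
      assume t: "-1 < t" "t < 1" and "finite {u. (cmod u)\<^sup>2 = 1 - t\<^sup>2 \<and> P (of_real t) u}"
      then have "finite ({u. (cmod u)\<^sup>2 = 1 - t\<^sup>2 \<and> P (of_real t) u} \<union> {u. \<not> P (of_real t) u})"
        using elim unfolding eventually_cofinite by simp
      then have "finite {u. (cmod u)\<^sup>2 = 1 - t\<^sup>2}" by (rule finite_subset[rotated]) auto
      moreover have "0 < 1 - t\<^sup>2" using t by (simp add: abs_square_less_1)
      ultimately show False using infinite_circle by blast
    qed
  qed
qed

section \<open>Injective rational functions\<close>

lemma linear_poly: "degree P \<le> 1 \<Longrightarrow> \<exists>a b. P = [:b, a:]"
  by (intro exI[of _ "coeff P 1"] exI[of _ "coeff P 0"] poly_eqI)
    (auto simp: coeff_pCons coeff_eq_0 split: nat.split)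

text \<open>
  Write \<open>N / D\<close> in lowest terms, of degree \<open>n\<close>.  For almost every value \<open>c\<close> the polynomial \<open>N - c D\<close> has
  degree \<open>n\<close>, and by injectivity a single root.  If \<open>n \<ge> 2\<close> that root is multiple, so it is a zero of
  the Wronskian \<open>N' D - N D'\<close>.  As this happens for infinitely many \<open>c\<close>, the Wronskian vanishes and
  \<open>N / D\<close> is constant, a contradiction.
\<close>

lemma moebius_if_injective:
  fixes N D :: "complex poly"
  assumes B: "finite B" and D: "D \<noteq> 0"
    and inj: "inj_on (\<lambda>u. poly N u / poly D u) (- B)"
  obtains a b c d where "a * d \<noteq> b * c" "N * [:d, c:] = D * [:b, a:]"
proof -
  define g where "g = gcd N D"
  have "g \<noteq> 0" using D unfolding g_def by simp
  then obtain N' D' where N': "N = g * N'" and D': "D = g * D'" and cop: "coprime N' D'"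
    using gcd_coprime_exists[of N D] unfolding g_def by (metis mult.commute)
  have "D' \<noteq> 0" using D D' by auto
  have ncommon: "poly N' u \<noteq> 0 \<or> poly D' u \<noteq> 0" for u
  proof (rule ccontr)
    assume "\<not> ?thesis"
    then have "[:-u, 1:] dvd N'" "[:-u, 1:] dvd D'" by (auto simp: poly_eq_0_iff_dvd)
    then have "is_unit [:-u, 1:]" using cop by (meson coprime_common_divisor)
    then show False by (simp add: is_unit_poly_iff)
  qed
  define n where "n = max (degree N') (degree D')"
  \<comment> \<open>the values at the exceptional points, and the one at which the degree drops\<close>
  define Ex where "Ex = (\<lambda>u. poly N' u / poly D' u) ` (B \<union> {u. poly g u = 0})
    \<union> {coeff N' n / coeff D' n}"
  have "finite Ex" unfolding Ex_def using B \<open>g \<noteq> 0\<close> by (simp add: poly_roots_finite)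
  define R where "R = (\<lambda>c. N' - smult c D')"
  have deg: "degree (R c) = n" if "c \<notin> Ex" for c
  proof (rule antisym)
    show "degree (R c) \<le> n" unfolding R_def n_def
      by (intro degree_diff_le) (auto intro: le_trans[OF degree_smult_le])
    have "coeff (R c) n \<noteq> 0"
    proof (cases "coeff D' n = 0")
      case True
      have "coeff N' n \<noteq> 0"
      proof (cases "degree D' < degree N'")
        case True
        then have "n = degree N'" "N' \<noteq> 0" unfolding n_def by auto
        then show ?thesis by simp
      next
        case False
        then have "n = degree D'" unfolding n_def by auto
        then show ?thesis using True \<open>D' \<noteq> 0\<close> by simp
      qed
      then show ?thesis unfolding R_def using True by simp
    next
      case False
      then show ?thesis unfolding R_def using that unfolding Ex_def by (auto simp: field_simps)
    qed
    then show "n \<le> degree (R c)" by (rule le_degree)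
  qed
  have root: "u \<notin> B \<and> poly D' u \<noteq> 0 \<and> c = poly N u / poly D u \<and> c = poly N' u / poly D' u"
    if c: "c \<notin> Ex" "poly (R c) u = 0" for c u
  proof -
    have eq: "poly N' u = c * poly D' u" using c unfolding R_def by simp
    then have D'u: "poly D' u \<noteq> 0" using ncommon by auto
    then have c': "c = poly N' u / poly D' u" using eq by simp
    then have "u \<notin> B" "poly g u \<noteq> 0" using c(1) unfolding Ex_def by auto
    then show ?thesis using D'u c' unfolding N' D' by simp
  qed
  have uniq: "u = u'" if "c \<notin> Ex" "poly (R c) u = 0" "poly (R c) u' = 0" for c u u'
    using root[OF that(1,2)] root[OF that(1,3)] inj unfolding inj_on_def by auto
  have "n < 2"
  proof (rule ccontr)
    assume "\<not> n < 2"
    define W where "W = pderiv N' * D' - N' * pderiv D'"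
    have "\<exists>u. poly W u = 0 \<and> poly N' u / poly D' u = c" if c: "c \<notin> Ex" for c
    proof -
      have "degree (R c) \<ge> 2" using deg[OF c] \<open>\<not> n < 2\<close> by simp
      then have "\<not> constant (poly (R c))" by (simp add: constant_degree)
      then obtain u where u: "poly (R c) u = 0" using fundamental_theorem_of_algebra by blast
      then obtain Q where Q: "R c = [:-u, 1:] * Q" unfolding poly_eq_0_iff_dvd by (rule dvdE)
      have "R c \<noteq> 0" using \<open>degree (R c) \<ge> 2\<close> by auto
      then have "degree (R c) = 1 + degree Q"
        unfolding Q by (subst degree_mult_eq) auto
      then have "\<not> constant (poly Q)" using \<open>degree (R c) \<ge> 2\<close> by (simp add: constant_degree)
      then obtain u' where u': "poly Q u' = 0" using fundamental_theorem_of_algebra by blast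
      then have "poly (R c) u' = 0" unfolding Q by simp
      then have "u' = u" using uniq c u by blast
      then have "poly (pderiv (R c)) u = 0" unfolding Q pderiv_mult using u' by simp
      then have "poly (pderiv N') u = c * poly (pderiv D') u"
        unfolding R_def by (simp add: pderiv_diff pderiv_smult)
      moreover have "poly N' u = c * poly D' u" using u unfolding R_def by simp
      ultimately have "poly W u = 0" unfolding W_def by simp
      then show ?thesis using root[OF c u] by metis
    qed
    then have "- Ex \<subseteq> (\<lambda>u. poly N' u / poly D' u) ` {u. poly W u = 0}" by blast
    moreover have "infinite (- Ex)" using \<open>finite Ex\<close> infinite_UNIV_char_0 finite_compl by blast
    ultimately have "infinite {u. poly W u = 0}" using finite_subset by blast
    then have "W = 0" using poly_roots_finite by blast
    then have eq: "pderiv N' * D' = N' * pderiv D'" unfolding W_def by simp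
    then have "D' dvd N' * pderiv D'" by (metis dvd_triv_right)
    then have "D' dvd pderiv D'" using cop by (simp add: coprime_commute coprime_dvd_mult_right_iff)
    then have "pderiv D' = 0" using \<open>D' \<noteq> 0\<close>
      by (metis degree_pderiv diff_le_self dvd_imp_degree_le less_le_not_le not_dvd_pderiv pderiv_eq_0_iff)
    moreover from this have "pderiv N' = 0" using eq \<open>D' \<noteq> 0\<close> by simp
    ultimately show False using \<open>\<not> n < 2\<close> by (simp add: pderiv_eq_0_iff n_def)
  qed
  then have "degree N' \<le> 1" "degree D' \<le> 1" unfolding n_def by auto
  then obtain a b c d where lin: "N' = [:b, a:]" "D' = [:d, c:]"
    using linear_poly by blast
  show ?thesis
  proof
    show "N * [:d, c:] = D * [:b, a:]" unfolding N' D' lin by (simp only: mult_ac)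
    show "a * d \<noteq> b * c"
    proof
      assume ad: "a * d = b * c"
      have "infinite (- (B \<union> {u. poly D u = 0}))"
        using B D poly_roots_finite infinite_UNIV_char_0 finite_compl by (metis finite_Un)
      then obtain u u' where u: "u \<in> - (B \<union> {u. poly D u = 0})" "u' \<in> - (B \<union> {u. poly D u = 0})" "u \<noteq> u'"
        by (metis finite.emptyI finite.insertI finite_subset insertCI subsetI)
      then have q: "poly N u / poly D u = poly N' u / poly D' u" "poly N u' / poly D u' = poly N' u' / poly D' u'"
        and nz: "poly D' u \<noteq> 0" "poly D' u' \<noteq> 0"
        unfolding N' D' by auto
      have "poly N' u * poly D' u' - poly N' u' * poly D' u = (a * d - b * c) * (u - u')"
        unfolding lin by (simp add: algebra_simps)
      then have "poly N u / poly D u = poly N u' / poly D u'"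
        unfolding q using ad nz by (simp add: field_simps)
      then show False using inj u unfolding inj_on_def by auto
    qed
  qed
qed

section \<open>Birational maps that preserve the fibration\<close>

text \<open>
  \<open>F\<close> lies over the transformation \<open>(w : z) \<mapsto> (a w + b z : c w + d z)\<close> of the base.
\<close>

definition covers :: "real \<Rightarrow> real \<Rightarrow> real \<Rightarrow> real \<Rightarrow> (complex ^ 4 \<Rightarrow> complex ^ 4) \<Rightarrow> bool" where
  "covers a b c d F \<longleftrightarrow> (\<forall>v\<in>S. F v $ 1 * (of_real c * v $ 1 + of_real d * v $ 4)
     = F v $ 4 * (of_real a * v $ 1 + of_real b * v $ 4))"

lemma form_map_2:
  "real_form d p \<Longrightarrow> real_form d q \<Longrightarrow> form_map d (\<lambda>v. vector [p v, q v] :: complex ^ 2)"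
  by (simp add: forall_2)

lemma form_map_4:
  "real_form d p \<Longrightarrow> real_form d q \<Longrightarrow> real_form d r \<Longrightarrow> real_form d s \<Longrightarrow>
    form_map d (\<lambda>v. vector [p v, q v, r v, s v] :: complex ^ 4)"
  by (simp add: forall_4)

lemma real_form_lin2:
  "real_form d p \<Longrightarrow> real_form d q \<Longrightarrow> real_form d (\<lambda>v. of_real a * p v + of_real b * q v)"
  by (intro real_form_add real_form_scale)

lemma coversI_generic:
  assumes "form_map e F" "\<forall>\<^sub>F v in generic S.
    F v $ 1 * (of_real c * v $ 1 + of_real d * v $ 4) = F v $ 4 * (of_real a * v $ 1 + of_real b * v $ 4)"
  shows "covers a b c d F"
proof -
  let ?p = "\<lambda>v. F v $ 1 * (of_real c * v $ 1 + of_real d * v $ 4)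
     - F v $ 4 * (of_real a * v $ 1 + of_real b * v $ 4)"
  have "real_form (e + 1) ?p"
    using assms(1) by (intro real_form_diff real_form_mult real_form_lin2 real_form_coord) auto
  moreover have "\<forall>\<^sub>F v in generic S. ?p v = 0" using assms(2) by eventually_elim simp
  ultimately have "?p v = 0" if "v \<in> S" for v using that by (rule S.generic_zero)
  then show ?thesis unfolding covers_def by simp
qed

lemma covers_cong:
  assumes "rat_rep S S F" "rat_rep S S G" "rat_eq S F G" "covers a b c d F"
  shows "covers a b c d G"
proof -
  obtain e where e: "form_map e G" using assms rat_repE by metis
  show ?thesis
  proof (rule coversI_generic[OF e])
    show "\<forall>\<^sub>F v in generic S. G v $ 1 * (of_real c * v $ 1 + of_real d * v $ 4)
        = G v $ 4 * (of_real a * v $ 1 + of_real b * v $ 4)"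
      using S.generic_in S.generic_rep[OF assms(1)]
    proof eventually_elim
      case (elim v)
      then obtain k where "G v = k *s F v"
        using assms(3) parallel_multiple parallel_sym unfolding rat_eq_parallel by metis
      then show ?case using elim assms(4) unfolding covers_def by (simp add: mult.assoc)
    qed
  qed
qed

lemma generic_coord:
  assumes "dominant S S F"
  shows "\<forall>\<^sub>F v in generic S. F v $ 1 \<noteq> 0" "\<forall>\<^sub>F v in generic S. Xc (F v) \<noteq> 0"
    "\<forall>\<^sub>F v in generic S. Yc (F v) \<noteq> 0"
proof -
  have v0: "vector [1, 1, 0, 0] \<in> S" unfolding S_def by simp
  have "\<forall>\<^sub>F v in generic S. v $ 1 \<noteq> 0"
    by (rule S.generic_form[OF real_form_coord]) (rule bexI[OF _ v0], simp)
  then show "\<forall>\<^sub>F v in generic S. F v $ 1 \<noteq> 0"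
    by (rule generic_dominant[OF integral_S integral_S assms])
  have "\<forall>\<^sub>F v in generic S. Xc v * Yc v \<noteq> 0"
    by (rule S.generic_form[OF real_form_XY]) (rule bexI[OF _ v0], simp add: XY_mult)
  then have "\<forall>\<^sub>F v in generic S. Xc (F v) * Yc (F v) \<noteq> 0"
    by (rule generic_dominant[OF integral_S integral_S assms])
  then show "\<forall>\<^sub>F v in generic S. Xc (F v) \<noteq> 0" "\<forall>\<^sub>F v in generic S. Yc (F v) \<noteq> 0"
    by (auto elim: eventually_mono)
qed

lemma covers_compose:
  assumes "dominant S S F" "dominant S S G" "covers a b c d F" "covers a' b' c' d' G"
  shows "covers (a' * a + b' * c) (a' * b + b' * d) (c' * a + d' * c) (c' * b + d' * d) (G \<circ> F)"
proof -
  obtain e e' where "form_map e F" "form_map e' G" using assms rat_repE dominant_rep by metis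
  then have "form_map (e' * e) (G \<circ> F)" using form_map_comp by blast
  then show ?thesis
  proof (rule coversI_generic)
    show "\<forall>\<^sub>F v in generic S. (G \<circ> F) v $ 1 *
        (of_real (c' * a + d' * c) * v $ 1 + of_real (c' * b + d' * d) * v $ 4)
      = (G \<circ> F) v $ 4 * (of_real (a' * a + b' * c) * v $ 1 + of_real (a' * b + b' * d) * v $ 4)"
      using S.generic_in generic_coord(1)[OF assms(1)]
    proof eventually_elim
      case (elim v)
      define w z w1 z1 where wz: "w = v $ 1" "z = v $ 4" "w1 = F v $ 1" "z1 = F v $ 4"
      define w2 z2 where wz2: "w2 = G (F v) $ 1" "z2 = G (F v) $ 4"
      define A B C D where ABCD: "A = complex_of_real a" "B = complex_of_real b"
        "C = complex_of_real c" "D = complex_of_real d"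
      define A' B' C' D' where ABCD': "A' = complex_of_real a'" "B' = complex_of_real b'"
        "C' = complex_of_real c'" "D' = complex_of_real d'"
      have "F v \<in> S" using elim assms(1) dominant_rep rat_rep_in by blast
      then have 1: "w1 * (C * w + D * z) = z1 * (A * w + B * z)"
        "w2 * (C' * w1 + D' * z1) = z2 * (A' * w1 + B' * z1)"
        using elim assms unfolding covers_def wz wz2 ABCD ABCD' by auto
      have "w1 * (w2 * (C' * (A * w + B * z) + D' * (C * w + D * z)))
         = w2 * (C' * w1 * (A * w + B * z) + D' * (w1 * (C * w + D * z)))"
        by (simp add: algebra_simps)
      also have "\<dots> = w2 * (C' * w1 + D' * z1) * (A * w + B * z)"
        unfolding 1(1) by (simp add: algebra_simps)
      also have "\<dots> = z2 * (A' * w1 * (A * w + B * z) + B' * (z1 * (A * w + B * z)))"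
        unfolding 1(2) by (simp add: algebra_simps)
      also have "\<dots> = w1 * (z2 * (A' * (A * w + B * z) + B' * (C * w + D * z)))"
        unfolding 1(1)[symmetric] by (simp add: algebra_simps)
      finally have "w2 * (C' * (A * w + B * z) + D' * (C * w + D * z))
          = z2 * (A' * (A * w + B * z) + B' * (C * w + D * z))"
        using elim unfolding wz by simp
      then show ?case unfolding wz wz2 ABCD ABCD' by (simp add: algebra_simps)
    qed
  qed
qed

lemma covers_inverse:
  assumes "dominant S S F" "dominant S S G" "rat_eq S (F \<circ> G) id" "covers a b c d F"
  shows "covers d (- b) (- c) a G"
proof -
  obtain e where e: "form_map e G" using assms rat_repE dominant_rep by metis
  show ?thesis
  proof (rule coversI_generic[OF e])
    show "\<forall>\<^sub>F v in generic S. G v $ 1 * (of_real (- c) * v $ 1 + of_real a * v $ 4)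
        = G v $ 4 * (of_real d * v $ 1 + of_real (- b) * v $ 4)"
      using S.generic_in S.generic_rep[OF dominant_rep[OF dominant_compose[OF assms(2,1)]]]
        S.generic_rep[OF S.rat_rep_id]
    proof eventually_elim
      case (elim v)
      then obtain k where k: "k \<noteq> 0" "F (G v) = k *s v"
        using assms(3) parallel_multiple_nonzero unfolding rat_eq_parallel by (metis comp_apply id_apply)
      have "G v \<in> S" using elim assms(2) dominant_rep rat_rep_in by blast
      then have "k * (v $ 1 * (of_real c * G v $ 1 + of_real d * G v $ 4))
          = k * (v $ 4 * (of_real a * G v $ 1 + of_real b * G v $ 4))"
        using assms(4) unfolding covers_def by (auto simp: k mult.assoc)
      then have "v $ 1 * (of_real c * G v $ 1 + of_real d * G v $ 4)
          = v $ 4 * (of_real a * G v $ 1 + of_real b * G v $ 4)"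
        using k(1) by (metis mult_left_cancel)
      then show ?case by (simp add: algebra_simps)
    qed
  qed
qed

definition \<pi> :: "complex ^ 4 \<Rightarrow> complex ^ 2" where "\<pi> v = vector [v $ 1, v $ 4]"

lemma dominant_\<pi>: "dominant S P1 \<pi>"
  unfolding dominant_def
proof (intro conjI allI impI)
  have v0: "vector [1, 1, 0, 0] \<in> S" unfolding S_def by simp
  show "rat_rep S P1 \<pi>"
  proof (rule rat_repI[OF _ v0])
    show "form_map 1 \<pi>" unfolding \<pi>_def using form_map_2 real_form_coord by blast
    show "\<pi> (vector [1, 1, 0, 0]) \<noteq> 0" unfolding \<pi>_def by (simp add: vec_eq_2)
  qed (simp add: P1_def)
  fix d :: nat and p assume "real_form d p" "\<exists>v\<in>P1. p v \<noteq> 0"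
  then obtain v where v: "p v \<noteq> 0" by blast
  let ?v = "vector [v $ 1, csqrt ((v $ 1)\<^sup>2 - (v $ 2)\<^sup>2), 0, v $ 2] :: complex ^ 4"
  have "?v \<in> S" unfolding S_def by simp
  moreover have "\<pi> ?v = v" unfolding \<pi>_def by (simp add: vec_eq_2)
  ultimately show "\<exists>v\<in>S. p (\<pi> v) \<noteq> 0" using v by metis
qed

lemma proj_\<pi>: "proj = rat_class S P1 \<pi>"
  unfolding proj_def \<pi>_def ..

lemma comp_proj_left:
  assumes "dominant S S F" "g = rat_class S S F"
  shows "rat_comp S P1 proj g = rat_class S P1 (\<pi> \<circ> F)" "rat_rep S P1 (\<pi> \<circ> F)"
  unfolding proj_\<pi> assms(2)
  using S.rat_comp_class[OF dominant_rep[OF assms(1)] dominant_rep[OF dominant_\<pi>]]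
    dominant_rep[OF dominant_compose[OF assms(1) dominant_\<pi>]] by blast+

lemma comp_proj_right:
  assumes "dominant P1 P1 A" "\<alpha> = rat_class P1 P1 A"
  shows "rat_comp S P1 \<alpha> proj = rat_class S P1 (A \<circ> \<pi>)" "rat_rep S P1 (A \<circ> \<pi>)"
  unfolding proj_\<pi> assms(2)
  using S.rat_comp_class[OF dominant_rep[OF dominant_\<pi>] dominant_rep[OF assms(1)]]
    dominant_rep[OF dominant_compose[OF dominant_\<pi> assms(1)]] by blast+

lemma rat_eq_2: "rat_eq X F (G :: _ \<Rightarrow> complex ^ 2) \<longleftrightarrow> (\<forall>v\<in>X. F v $ 1 * G v $ 2 = F v $ 2 * G v $ 1)"
  unfolding rat_eq_def by (auto simp: forall_2 mult.commute)

lemma over_proj_iff: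
  assumes "g \<in> carrier (Bir S)" "F \<in> g"
  shows "g \<in> carrier Bir_S_over_proj \<longleftrightarrow> covers 1 0 0 1 F"
proof -
  have F: "dominant S S F" "g = rat_class S S F" using S.Bir_rep[OF assms] .
  have "g \<in> carrier Bir_S_over_proj \<longleftrightarrow> rat_class S P1 (\<pi> \<circ> F) = rat_class S P1 \<pi>"
    unfolding Bir_S_over_proj_def using assms(1) comp_proj_left[OF F] proj_\<pi> by simp
  also have "\<dots> \<longleftrightarrow> rat_eq S (\<pi> \<circ> F) \<pi>"
    using S.rat_class_eq comp_proj_left[OF F] dominant_rep[OF dominant_\<pi>] by blast
  also have "\<dots> \<longleftrightarrow> covers 1 0 0 1 F"
    unfolding rat_eq_2 covers_def \<pi>_def by simp
  finally show ?thesis .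
qed

definition lin2 :: "real \<Rightarrow> real \<Rightarrow> real \<Rightarrow> real \<Rightarrow> complex ^ 2 \<Rightarrow> complex ^ 2" where
  "lin2 a b c d v = vector [of_real a * v $ 1 + of_real b * v $ 2, of_real c * v $ 1 + of_real d * v $ 2]"

lemma lin2_inverse: "lin2 d (- b) (- c) a (lin2 a b c d v) = of_real (a * d - b * c) *s v"
  by (simp add: lin2_def vec_eq_2 algebra_simps)

lemma rat_rep_lin2:
  assumes "a * d \<noteq> b * c"
  shows "rat_rep P1 P1 (lin2 a b c d)" "v \<noteq> 0 \<Longrightarrow> lin2 a b c d v \<noteq> 0"
proof -
  have nz: "lin2 a b c d v \<noteq> 0" if "v \<noteq> 0" for v
  proof
    assume 0: "lin2 a b c d v = 0"
    have "of_real (a * d - b * c) *s v = lin2 d (- b) (- c) a 0"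
      using lin2_inverse[of d b c a v] 0 by simp
    also have "\<dots> = 0" by (simp add: lin2_def vec_eq_2)
    finally show False using that assms by (simp add: vec_eq_2 del: of_real_diff of_real_mult)
  qed
  then show "v \<noteq> 0 \<Longrightarrow> lin2 a b c d v \<noteq> 0" .
  have "form_map 1 (lin2 a b c d)"
    unfolding lin2_def using form_map_2 real_form_lin2 real_form_coord by blast
  moreover have "(1 :: complex ^ 2) \<noteq> 0" by simp
  ultimately show "rat_rep P1 P1 (lin2 a b c d)"
    using nz by (intro rat_repI[of 1 _ 1]) (auto simp: P1_def)
qed

lemma lin2_Aut_P1:
  assumes "a * d \<noteq> b * c"
  shows "rat_class P1 P1 (lin2 a b c d) \<in> Aut_P1"
proof -
  have det: "d * a \<noteq> (- b) * (- c)" using assms by (simp add: mult.commute)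
  note rep = rat_rep_lin2(1)[OF assms] rat_rep_lin2(1)[OF det]
  have 1: "rat_eq P1 (lin2 d (- b) (- c) a \<circ> lin2 a b c d) id"
    unfolding rat_eq_parallel by (simp add: lin2_inverse del: of_real_diff of_real_mult)
  have 2: "rat_eq P1 (lin2 a b c d \<circ> lin2 d (- b) (- c) a) id"
    unfolding rat_eq_parallel using lin2_inverse[of a "-b" "-c" d]
    by (simp del: of_real_diff of_real_mult)
  have ex: "\<exists>v\<in>P1. lin2 a b c d (lin2 d (- b) (- c) a v) \<noteq> 0"
    "\<exists>v\<in>P1. lin2 d (- b) (- c) a (lin2 a b c d v) \<noteq> 0"
    by (rule bexI[of _ 1]; use rat_rep_lin2(2)[OF assms] rat_rep_lin2(2)[OF det] in \<open>simp add: P1_def\<close>)+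
  note B = P1.BirI[OF rep ex(1) 2 ex(2) 1]
  have "defined_at (rat_class P1 P1 (lin2 a b c d)) v"
    "defined_at (rat_class P1 P1 (lin2 d (- b) (- c) a)) v" if "v \<noteq> 0" for v
    unfolding defined_at_def
    by (rule bexI[OF _ P1.rat_class_self[OF rep(1)]], rule rat_rep_lin2(2)[OF assms that],
        rule bexI[OF _ P1.rat_class_self[OF rep(2)]], rule rat_rep_lin2(2)[OF det that])
  then show ?thesis unfolding Aut_P1_def biregular_at_def using B by simp
qed

text \<open>
  On \<open>\<P>\<^sup>1\<close> the affine coordinate \<open>t\<close> of \<open>(1 : t)\<close> is a generic parameter.
\<close>

lemma generic_P1:
  assumes "\<forall>\<^sub>F v in generic P1. P v"
  shows "\<forall>\<^sub>F t in cofinite. P (vector [1, t])"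
proof -
  obtain d q where q: "real_form d q" "\<exists>v\<in>P1. q v \<noteq> 0" "\<forall>v\<in>P1. q v \<noteq> 0 \<longrightarrow> P v"
    using assms unfolding P1.eventually_generic by blast
  have "\<forall>\<^sub>F v in generic P1. v $ 1 \<noteq> 0"
    by (rule P1.generic_form[OF real_form_coord]) (auto simp: P1_def intro: exI[of _ 1])
  moreover have "\<forall>\<^sub>F v in generic P1. q v \<noteq> 0" by (rule P1.generic_form[OF q(1,2)])
  ultimately have "\<forall>\<^sub>F v in generic P1. v $ 1 \<noteq> 0 \<and> q v \<noteq> 0" by (rule eventually_conj)
  then obtain v where v: "v $ 1 \<noteq> 0" "q v \<noteq> 0" using P1.generic_ex by blast
  then have "v = (v $ 1) *s vector [1, v $ 2 / v $ 1]" by (simp add: vec_eq_2)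
  then have nz: "q (vector [1, v $ 2 / v $ 1]) \<noteq> 0"
    using v real_form_homogeneous[OF q(1)] by (metis mult_zero_right)
  have "\<forall>i. polyfun (\<lambda>t. (vector [1, t] :: complex ^ 2) $ i)" unfolding forall_2 by auto
  then have "\<forall>\<^sub>F t in cofinite. q (vector [1, t]) \<noteq> 0"
    using polyfun_nonzero[of "\<lambda>t. q (vector [1, t])", OF _ nz]
      real_form_polyfun[OF q(1), of "\<lambda>t. vector [1, t]"] by blast
  then show ?thesis by eventually_elim (use q in \<open>auto simp: P1_def\<close>)
qed

lemma cofinite_real: "\<forall>\<^sub>F z :: complex in cofinite. P z \<Longrightarrow> \<forall>\<^sub>F s :: real in cofinite. P (of_real s)"
proof -
  assume "\<forall>\<^sub>F z :: complex in cofinite. P z"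
  then have "finite (of_real -` {z. \<not> P z} :: real set)"
    unfolding eventually_cofinite by (rule finite_vimageI) (simp add: inj_on_def)
  then show ?thesis unfolding eventually_cofinite by (simp add: vimage_def)
qed

lemma cofinite_real_ex: "\<forall>\<^sub>F s :: real in cofinite. P s \<Longrightarrow> \<exists>s. P s"
  unfolding eventually_cofinite using infinite_UNIV_char_0[where 'a=real] by (metis UNIV_eq_I mem_Collect_eq)

lemma poly_eq_on_reals:
  fixes P Q :: "complex poly"
  assumes "\<And>t :: real. poly P (of_real t) = poly Q (of_real t)"
  shows "P = Q"
proof -
  have "range complex_of_real \<subseteq> {z. poly (P - Q) z = 0}" using assms by auto
  moreover have "infinite (range complex_of_real)"
    using infinite_UNIV_char_0[where 'a=real] by (simp add: finite_image_iff inj_on_def)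
  ultimately have "P - Q = 0" using poly_roots_finite finite_subset by blast
  then show ?thesis by simp
qed

text \<open>
  The complex equation splits into its real and imaginary parts, which are solved by \<open>(Re a, \<dots>)\<close> and
  \<open>(Im a, \<dots>)\<close>.  The determinant of the solution \<open>Re + s Im\<close> is a polynomial in \<open>s\<close> that does not
  vanish at \<open>s = i\<close>, so it does not vanish at some real \<open>s\<close>.
\<close>

lemma real_moebius:
  fixes N D :: "complex poly"
  assumes real: "\<And>t :: real. poly N (of_real t) \<in> \<real>" "\<And>t :: real. poly D (of_real t) \<in> \<real>"
    and abcd: "a * d \<noteq> b * c" "N * [:d, c:] = D * [:b, a:]"
  obtains a b c d :: real where "a * d \<noteq> b * c"
    "N * [:of_real d, of_real c:] = D * [:of_real b, of_real a:]"
proof -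
  have part: "N * [:of_real (f d), of_real (f c):] = D * [:of_real (f b), of_real (f a):]"
    if f: "\<And>x y. f (x + y) = f x + f y" "\<And>r x. f (of_real r * x) = r * f x" for f :: "complex \<Rightarrow> real"
  proof (rule poly_eq_on_reals)
    fix t :: real
    obtain n m where nm: "poly N (of_real t) = of_real n" "poly D (of_real t) = of_real m"
      using real by (metis Reals_cases)
    have "of_real n * (d + of_real t * c) = of_real m * (b + of_real t * a)"
      using arg_cong[OF abcd(2), of "\<lambda>p. poly p (of_real t)"] by (simp add: nm algebra_simps)
    then have "n * (f d + t * f c) = m * (f b + t * f a)" using f by metis
    then have "complex_of_real (n * (f d + t * f c)) = of_real (m * (f b + t * f a))" by (rule arg_cong)
    then show "poly (N * [:of_real (f d), of_real (f c):]) (of_real t) =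
       poly (D * [:of_real (f b), of_real (f a):]) (of_real t)" using nm by (simp add: algebra_simps)
  qed
  have Re: "N * [:of_real (Re d), of_real (Re c):] = D * [:of_real (Re b), of_real (Re a):]"
   and Im: "N * [:of_real (Im d), of_real (Im c):] = D * [:of_real (Im b), of_real (Im a):]"
    by (rule part; simp)+
  let ?l = "\<lambda>x s. of_real (Re x) + s * of_real (Im x) :: complex"
  have "polyfun (\<lambda>s. ?l a s * ?l d s - ?l b s * ?l c s)" by (intro polyfun_intros)
  moreover have "?l a \<i> * ?l d \<i> - ?l b \<i> * ?l c \<i> \<noteq> 0"
    using abcd(1) by (simp flip: complex_eq)
  ultimately have "\<forall>\<^sub>F s in cofinite. ?l a s * ?l d s - ?l b s * ?l c s \<noteq> 0"
    by (rule polyfun_nonzero)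
  then obtain s :: real where s: "?l a (of_real s) * ?l d (of_real s) - ?l b (of_real s) * ?l c (of_real s) \<noteq> 0"
    using cofinite_real_ex[OF cofinite_real] by blast
  let ?r = "\<lambda>x. Re x + s * Im x"
  have "complex_of_real (?r a * ?r d - ?r b * ?r c) \<noteq> 0" using s by simp
  then have det: "?r a * ?r d \<noteq> ?r b * ?r c" unfolding of_real_eq_0_iff by simp
  have split: "[:of_real (?r x), of_real (?r y):]
     = ([:of_real (Re x), of_real (Re y):] :: complex poly) + [:of_real s:] * [:of_real (Im x), of_real (Im y):]" for x y
    by simp
  have "N * [:of_real (?r d), of_real (?r c):] = D * [:of_real (?r b), of_real (?r a):]"
    unfolding split distrib_left mult.left_commute[of _ "[:of_real s:]"] Re Im ..
  then show ?thesis using that det by blast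
qed

lemma Aut_P1_moebius:
  assumes "\<alpha> \<in> carrier (Bir P1)" "A \<in> \<alpha>"
  shows "\<forall>\<^sub>F v in generic P1. A v $ 1 \<noteq> 0"
    and "\<exists>a b c d. a * d \<noteq> b * c \<and> (\<forall>t. A (vector [1, t]) $ 2 * (of_real d + of_real c * t)
      = A (vector [1, t]) $ 1 * (of_real b + of_real a * t))"
proof -
  let ?p = "\<lambda>t. vector [1, t] :: complex ^ 2"
  have A: "dominant P1 P1 A" "\<alpha> = rat_class P1 P1 A" using P1.Bir_rep[OF assms] .
  obtain B0 where B0: "B0 \<in> inv\<^bsub>Bir P1\<^esub> \<alpha>" "dominant P1 P1 B0" "inv\<^bsub>Bir P1\<^esub> \<alpha> = rat_class P1 P1 B0"
    using P1.Bir_obtain_rep Bir_P1.inv_closed[OF assms(1)] by blast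
  have BA: "rat_rep P1 P1 (B0 \<circ> A)" "rat_eq P1 (B0 \<circ> A) id"
  proof -
    have "B0 \<circ> A \<in> inv\<^bsub>Bir P1\<^esub> \<alpha> \<otimes>\<^bsub>Bir P1\<^esub> \<alpha>"
      using P1.Bir_mult_rep[OF Bir_P1.inv_closed[OF assms(1)] assms(1) B0(1) assms(2)] .
    then show "rat_rep P1 P1 (B0 \<circ> A)" "rat_eq P1 (B0 \<circ> A) id"
      using assms(1) P1.Bir_one_rep by auto
  qed
  obtain e where e: "form_map e A" using A dominant_rep rat_repE by metis
  obtain e' where e': "form_map e' B0" using B0 dominant_rep rat_repE by metis
  have pf: "polyfun (\<lambda>t. ?p t $ i)" for i
  proof -
    have "\<forall>i. polyfun (\<lambda>t. ?p t $ i)" unfolding forall_2 by auto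
    then show ?thesis ..
  qed
  have "polyfun (\<lambda>t. A (?p t) $ i)" for i
    by (rule real_form_polyfun[of e "\<lambda>v. A v $ i"]) (use e pf in auto)
  then obtain D N where D: "\<And>t. A (?p t) $ 1 = poly D t" and N: "\<And>t. A (?p t) $ 2 = poly N t"
    unfolding polyfun_def by metis
  have "\<forall>\<^sub>F v in generic P1. v $ 1 \<noteq> 0"
    by (rule P1.generic_form[OF real_form_coord]) (auto simp: P1_def intro: exI[of _ 1])
  then show A1: "\<forall>\<^sub>F v in generic P1. A v $ 1 \<noteq> 0"
    by (rule generic_dominant[OF integral_P1 integral_P1 A(1)])
  have good: "\<forall>\<^sub>F t in cofinite. A (?p t) $ 1 \<noteq> 0 \<and> (B0 \<circ> A) (?p t) \<noteq> 0"
    using generic_P1[OF eventually_conj[OF A1 P1.generic_rep[OF BA(1)]]] .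
  define Bad where "Bad = {t. \<not> (A (?p t) $ 1 \<noteq> 0 \<and> (B0 \<circ> A) (?p t) \<noteq> 0)}"
  have "finite Bad" using good unfolding Bad_def eventually_cofinite .
  moreover have "D \<noteq> 0" using cofinite_ex[OF good] D by auto
  moreover have "inj_on (\<lambda>u. poly N u / poly D u) (- Bad)"
  proof (rule inj_onI)
    fix t t' assume t: "t \<in> - Bad" "t' \<in> - Bad" and eq: "poly N t / poly D t = poly N t' / poly D t'"
    have nz: "poly D t \<noteq> 0" "poly D t' \<noteq> 0" "B0 (A (?p t)) \<noteq> 0" "B0 (A (?p t')) \<noteq> 0"
      using t unfolding Bad_def D by auto
    have "A (?p t) = (poly D t / poly D t') *s A (?p t')"
      using nz eq by (simp add: vec_eq_2 D N field_simps)
    then have "parallel (B0 (A (?p t))) (B0 (A (?p t')))"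
      by (simp add: form_map_homogeneous[OF e'])
    moreover have "parallel (B0 (A (?p t))) (?p t)" "parallel (B0 (A (?p t'))) (?p t')"
      using BA(2) unfolding rat_eq_parallel by (auto simp: P1_def)
    ultimately have "parallel (?p t) (?p t')" using nz parallel_trans parallel_sym by meson
    then show "t = t'" unfolding parallel_def by (metis vector_2 mult_1 mult_1_right)
  qed
  ultimately obtain a' b' c' d' where c: "a' * d' \<noteq> b' * c'" "N * [:d', c':] = D * [:b', a':]"
    using moebius_if_injective[of Bad D N] by metis
  have "?p (of_real t) $ i \<in> \<real>" for t :: real and i
  proof -
    have "\<forall>i. ?p (of_real t) $ i \<in> \<real>" unfolding forall_2 by simp
    then show ?thesis ..
  qed
  then have "A (?p (of_real t)) $ i \<in> \<real>" for t :: real and i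
    using e by (intro real_form_real[of e "\<lambda>v. A v $ i"]) auto
  then have "poly N (of_real t) \<in> \<real>" "poly D (of_real t) \<in> \<real>" for t :: real
    unfolding N[symmetric] D[symmetric] by auto
  from real_moebius[OF this c] obtain a b c d :: real where r: "a * d \<noteq> b * c"
    "N * [:of_real d, of_real c:] = D * [:of_real b, of_real a:]" by metis
  have "A (?p t) $ 2 * (of_real d + of_real c * t) = A (?p t) $ 1 * (of_real b + of_real a * t)" for t
    using arg_cong[OF r(2), of "\<lambda>p. poly p t"] unfolding D N
    by (simp add: algebra_simps)
  then show "\<exists>a b c d. a * d \<noteq> b * c \<and> (\<forall>t. A (vector [1, t]) $ 2 * (of_real d + of_real c * t)
      = A (vector [1, t]) $ 1 * (of_real b + of_real a * t))" using r(1) by blast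
qed

text \<open>
  An automorphism of \<open>\<P>\<^sup>1\<close> is a real Moebius transformation, and conversely; this turns the
  composition of rational maps in the definition of \<open>Bir(S, \<pi>)\<close> into an identity between forms.
\<close>

lemma Bir_S_proj_iff:
  assumes "g \<in> carrier (Bir S)" "F \<in> g"
  shows "g \<in> carrier Bir_S_proj \<longleftrightarrow> (\<exists>a b c d. a * d \<noteq> b * c \<and> covers a b c d F)"
proof -
  have F: "dominant S S F" "g = rat_class S S F" using S.Bir_rep[OF assms] .
  note pF = comp_proj_left[OF F]
  have eq: "rat_comp S P1 \<alpha> proj = rat_comp S P1 proj g \<longleftrightarrow>
      (\<forall>v\<in>S. A (\<pi> v) $ 1 * F v $ 4 = A (\<pi> v) $ 2 * F v $ 1)"
    if "dominant P1 P1 A" "\<alpha> = rat_class P1 P1 A" for A \<alpha>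
  proof -
    note pA = comp_proj_right[OF that]
    have "rat_comp S P1 \<alpha> proj = rat_comp S P1 proj g \<longleftrightarrow> rat_eq S (A \<circ> \<pi>) (\<pi> \<circ> F)"
      unfolding pA(1) pF(1) by (rule S.rat_class_eq[OF pA(2) pF(2)])
    then show ?thesis unfolding rat_eq_2 by (simp add: \<pi>_def)
  qed
  have carr: "g \<in> carrier Bir_S_proj \<longleftrightarrow> (\<exists>\<alpha>\<in>Aut_P1. rat_comp S P1 \<alpha> proj = rat_comp S P1 proj g)"
    unfolding Bir_S_proj_def using assms(1) by simp
  show ?thesis
  proof
    assume "g \<in> carrier Bir_S_proj"
    then obtain \<alpha> where \<alpha>: "\<alpha> \<in> Aut_P1" "rat_comp S P1 \<alpha> proj = rat_comp S P1 proj g"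
      unfolding carr by blast
    then have \<alpha>B: "\<alpha> \<in> carrier (Bir P1)" unfolding Aut_P1_def biregular_at_def by blast
    then obtain A where A: "A \<in> \<alpha>" "dominant P1 P1 A" "\<alpha> = rat_class P1 P1 A"
      by (rule P1.Bir_obtain_rep)
    obtain a b c d where r: "a * d \<noteq> b * c"
      "\<And>t. A (vector [1, t]) $ 2 * (of_real d + of_real c * t) = A (vector [1, t]) $ 1 * (of_real b + of_real a * t)"
      using Aut_P1_moebius(2)[OF \<alpha>B A(1)] by blast
    note A1 = Aut_P1_moebius(1)[OF \<alpha>B A(1)]
    obtain k where k: "form_map k F" using F dominant_rep rat_repE by metis
    obtain l where l: "form_map l A" using A dominant_rep rat_repE by metis
    have "covers d c b a F"
    proof (rule coversI_generic[OF k])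
      show "\<forall>\<^sub>F v in generic S. F v $ 1 * (of_real b * v $ 1 + of_real a * v $ 4)
         = F v $ 4 * (of_real d * v $ 1 + of_real c * v $ 4)"
        using generic_dominant[OF integral_S integral_P1 dominant_\<pi> A1] S.generic_in
          generic_coord(1)[OF S.dominant_id]
      proof eventually_elim
        case (elim v)
        let ?q = "vector [1, v $ 4 / v $ 1] :: complex ^ 2"
        have w: "v $ 1 \<noteq> 0" using elim by simp
        then have "\<pi> v = v $ 1 *s ?q" unfolding \<pi>_def by (simp add: vec_eq_2)
        then have "A (\<pi> v) = (v $ 1) ^ l *s A ?q" using form_map_homogeneous[OF l] by simp
        then have "A (\<pi> v) $ 2 * (of_real d + of_real c * (v $ 4 / v $ 1))
           = A (\<pi> v) $ 1 * (of_real b + of_real a * (v $ 4 / v $ 1))"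
          using r(2)[of "v $ 4 / v $ 1"] by (simp add: mult.assoc)
        note 0 = this
        have 1: "A (\<pi> v) $ 2 * (of_real d * v $ 1 + of_real c * v $ 4)
           = A (\<pi> v) $ 1 * (of_real b * v $ 1 + of_real a * v $ 4)"
        proof -
          have "of_real d * v $ 1 + of_real c * v $ 4 = (of_real d + of_real c * (v $ 4 / v $ 1)) * v $ 1"
            "of_real b * v $ 1 + of_real a * v $ 4 = (of_real b + of_real a * (v $ 4 / v $ 1)) * v $ 1"
            using w by (simp_all add: distrib_right)
          then show ?thesis using 0 by (metis (no_types) mult.assoc)
        qed
        have 2: "A (\<pi> v) $ 1 * F v $ 4 = A (\<pi> v) $ 2 * F v $ 1"
          using eq[OF A(2,3)] \<alpha>(2) elim by blast
        have "A (\<pi> v) $ 1 * (F v $ 1 * (of_real b * v $ 1 + of_real a * v $ 4))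
           = F v $ 1 * (A (\<pi> v) $ 2 * (of_real d * v $ 1 + of_real c * v $ 4))"
          unfolding 1 by (simp only: mult_ac)
        also have "\<dots> = (A (\<pi> v) $ 2 * F v $ 1) * (of_real d * v $ 1 + of_real c * v $ 4)"
          by (simp only: mult_ac)
        also have "\<dots> = A (\<pi> v) $ 1 * (F v $ 4 * (of_real d * v $ 1 + of_real c * v $ 4))"
          unfolding 2[symmetric] by (simp only: mult_ac)
        finally show ?case using elim by simp
      qed
    qed
    moreover have "d * a \<noteq> c * b" using r(1) by (simp add: mult.commute)
    ultimately show "\<exists>a b c d. a * d \<noteq> b * c \<and> covers a b c d F" by blast
  next
    assume "\<exists>a b c d. a * d \<noteq> b * c \<and> covers a b c d F"
    then obtain a b c d where det: "a * d \<noteq> b * c" and F': "covers a b c d F" by blast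
    let ?\<alpha> = "rat_class P1 P1 (lin2 a b c d)"
    have \<alpha>: "?\<alpha> \<in> Aut_P1" using lin2_Aut_P1[OF det] .
    then have "?\<alpha> \<in> carrier (Bir P1)" unfolding Aut_P1_def biregular_at_def by blast
    then have dom: "dominant P1 P1 (lin2 a b c d)"
      using P1.Bir_rep P1.rat_class_self rat_rep_lin2(1)[OF det] by blast
    have "rat_comp S P1 ?\<alpha> proj = rat_comp S P1 proj g"
      unfolding eq[OF dom refl] using F' by (simp add: covers_def lin2_def \<pi>_def mult.commute)
    then show "g \<in> carrier Bir_S_proj" unfolding carr using \<alpha> by blast
  qed
qed

lemma subgroup_Bir_S_proj: "subgroup (carrier Bir_S_proj) (Bir S)"
proof (rule Bir_S.subgroupI)
  show sub: "carrier Bir_S_proj \<subseteq> carrier (Bir S)" unfolding Bir_S_proj_def by auto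
  have "id \<in> \<one>\<^sub>S" using S.Bir_one_rep S.rat_rep_id by simp
  moreover have "covers 1 0 0 1 id" unfolding covers_def by simp
  ultimately have "\<one>\<^sub>S \<in> carrier Bir_S_proj"
    using Bir_S_proj_iff[OF Bir_S.one_closed] by (metis mult_1 mult_zero_left zero_neq_one)
  then show "carrier Bir_S_proj \<noteq> {}" by blast
  fix f assume f: "f \<in> carrier Bir_S_proj"
  then have fB: "f \<in> carrier (Bir S)" using sub by blast
  then obtain F where F: "F \<in> f" "dominant S S F" by (rule S.Bir_obtain_rep)
  obtain a b c d where ab: "a * d \<noteq> b * c" "covers a b c d F"
    using f Bir_S_proj_iff[OF fB F(1)] by blast
  obtain G where G: "G \<in> inv\<^sub>S f" "dominant S S G"
    using S.Bir_obtain_rep Bir_S.inv_closed[OF fB] by blast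
  have "F \<circ> G \<in> f \<cdot> inv\<^sub>S f" using S.Bir_mult_rep F G fB by blast
  then have "rat_eq S (F \<circ> G) id" using fB S.Bir_one_rep by simp
  then have "covers d (- b) (- c) a G" using covers_inverse F G ab by blast
  moreover have "d * a \<noteq> (- b) * (- c)" using ab by (simp add: mult.commute)
  ultimately show "inv\<^sub>S f \<in> carrier Bir_S_proj"
    using Bir_S_proj_iff[OF _ G(1)] fB by blast
  fix g assume g: "g \<in> carrier Bir_S_proj"
  then have gB: "g \<in> carrier (Bir S)" using sub by blast
  then obtain G where G: "G \<in> g" "dominant S S G" by (rule S.Bir_obtain_rep)
  obtain a' b' c' d' where ab': "a' * d' \<noteq> b' * c'" "covers a' b' c' d' G"
    using g Bir_S_proj_iff[OF gB G(1)] by blast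
  have "covers (a * a' + b * c') (a * b' + b * d') (c * a' + d * c') (c * b' + d * d') (F \<circ> G)"
    using covers_compose[OF G(2) F(2) ab'(2) ab(2)] .
  moreover have "(a * a' + b * c') * (c * b' + d * d') - (a * b' + b * d') * (c * a' + d * c')
      = (a * d - b * c) * (a' * d' - b' * c')"
    by (simp add: algebra_simps)
  then have "(a * a' + b * c') * (c * b' + d * d') \<noteq> (a * b' + b * d') * (c * a' + d * c')"
    using ab ab' by auto
  moreover have "F \<circ> G \<in> f \<cdot> g" using S.Bir_mult_rep F G fB gB by blast
  ultimately show "f \<cdot> g \<in> carrier Bir_S_proj"
    using Bir_S_proj_iff fB gB Bir_S.m_closed by blast
qed

lemma real_points_stable:
  assumes "rat_rep S S F" "v \<in> real_points S"
  shows "F v \<in> real_points S"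
proof -
  obtain d where d: "form_map d F" using assms rat_repE by metis
  then have "F v $ i \<in> \<real>" for i
    using assms(2) real_form_real[of d "\<lambda>v. F v $ i"] unfolding real_points_def by blast
  then show ?thesis using assms rat_rep_in unfolding real_points_def by blast
qed

lemma subgroup_Aut_SR: "subgroup (carrier Aut_SR) (Bir S)"
proof -
  have "carrier Aut_SR = biregular_at S (real_points S)" by (simp add: Aut_SR_def)
  moreover have "real_points S \<subseteq> S" unfolding real_points_def by blast
  ultimately show ?thesis using S.subgroup_biregular_at real_points_stable by metis
qed

lemma subgroup_Aut_SR_proj: "subgroup (carrier Aut_SR_proj) (Bir S)"
proof -
  have "carrier Aut_SR_proj = carrier Bir_S_proj \<inter> carrier Aut_SR" by (simp add: Aut_SR_proj_def)
  then show ?thesis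
    using Bir_S.subgroups_Inter_pair[OF subgroup_Bir_S_proj subgroup_Aut_SR] by simp
qed

section \<open>Conjugacy classes\<close>

context group
begin

lemma conj_class_subgroup:
  assumes "subgroup H G" "a \<in> H"
  shows "conj_class (G\<lparr>carrier := H\<rparr>) a = {g \<otimes> a \<otimes> inv g | g. g \<in> H}"
proof -
  have "conj_class (G\<lparr>carrier := H\<rparr>) a = {g \<otimes> a \<otimes> inv\<^bsub>G\<lparr>carrier := H\<rparr>\<^esub> g | g. g \<in> H}"
    unfolding conj_class_def orbit_def conj_action_def using assms(2) by simp
  then show ?thesis using m_inv_consistent[OF assms(1)]
    by (simp add: conj_commute cong: conj_cong)
qed

lemma conj_class_conj:
  assumes "subgroup H G" "a \<in> H" "h \<in> H"
  shows "conj_class (G\<lparr>carrier := H\<rparr>) (h \<otimes> a \<otimes> inv h) = conj_class (G\<lparr>carrier := H\<rparr>) a"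
proof -
  interpret H: subgroup H G by fact
  have a: "a \<in> carrier G" "h \<in> carrier G" using assms by auto
  have *: "h \<otimes> a \<otimes> inv h \<in> H" using assms by simp
  have 1: "g \<otimes> (h \<otimes> a \<otimes> inv h) \<otimes> inv g = (g \<otimes> h) \<otimes> a \<otimes> inv (g \<otimes> h)" if "g \<in> carrier G" for g
    using a that by (simp add: inv_mult_group m_assoc)
  have 2: "(g \<otimes> inv h) \<otimes> (h \<otimes> a \<otimes> inv h) \<otimes> inv (g \<otimes> inv h) = g \<otimes> a \<otimes> inv g" if "g \<in> carrier G" for g
    using a that 1[of "g \<otimes> inv h"] by (simp add: m_assoc)
  show ?thesis
    unfolding conj_class_subgroup[OF assms(1) *] conj_class_subgroup[OF assms(1,2)]
  proof (intro equalityI subsetI)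
    fix x assume "x \<in> {g \<otimes> (h \<otimes> a \<otimes> inv h) \<otimes> inv g |g. g \<in> H}"
    then obtain g where g: "g \<in> H" "x = g \<otimes> (h \<otimes> a \<otimes> inv h) \<otimes> inv g" by blast
    then have "g \<otimes> h \<in> H" "x = (g \<otimes> h) \<otimes> a \<otimes> inv (g \<otimes> h)" using 1[of g] assms(3) by simp_all
    then show "x \<in> {g \<otimes> a \<otimes> inv g |g. g \<in> H}" by blast
  next
    fix x assume "x \<in> {g \<otimes> a \<otimes> inv g |g. g \<in> H}"
    then obtain g where g: "g \<in> H" "x = g \<otimes> a \<otimes> inv g" by blast
    then have "g \<otimes> inv h \<in> H" "x = (g \<otimes> inv h) \<otimes> (h \<otimes> a \<otimes> inv h) \<otimes> inv (g \<otimes> inv h)"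
      using 2[of g] assms(3) by simp_all
    then show "x \<in> {g \<otimes> (h \<otimes> a \<otimes> inv h) \<otimes> inv g |g. g \<in> H}" by blast
  qed
qed

lemma induced_class_conj_class:
  assumes "subgroup H G" "subgroup K G" "K \<subseteq> H" "a \<in> K"
  shows "induced_class (G\<lparr>carrier := H\<rparr>) (conj_class (G\<lparr>carrier := K\<rparr>) a) = conj_class (G\<lparr>carrier := H\<rparr>) a"
proof -
  have "conj_class (G\<lparr>carrier := H\<rparr>) b = conj_class (G\<lparr>carrier := H\<rparr>) a"
    if b: "b \<in> conj_class (G\<lparr>carrier := K\<rparr>) a" for b
  proof -
    obtain k where "k \<in> K" "b = k \<otimes> a \<otimes> inv k"
      using b unfolding conj_class_subgroup[OF assms(2,4)] by auto
    then show ?thesis using conj_class_conj[OF assms(1), of a k] assms(3,4) by blast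
  qed
  moreover have "conj_class (G\<lparr>carrier := K\<rparr>) a \<noteq> {}"
    unfolding conj_class_subgroup[OF assms(2,4)] using assms(4) by blast
  ultimately show ?thesis unfolding induced_class_def by blast
qed

end

section \<open>The action on the base\<close>

lemma covers_unscale:
  assumes "covers (k * a) (k * b) (k * c) (k * d) F" "k \<noteq> 0"
  shows "covers a b c d F"
  unfolding covers_def
proof
  fix v assume "v \<in> S"
  then have "of_real k * (F v $ 1 * (of_real c * v $ 1 + of_real d * v $ 4))
      = of_real k * (F v $ 4 * (of_real a * v $ 1 + of_real b * v $ 4))"
    using assms(1) unfolding covers_def by (simp add: algebra_simps)
  then show "F v $ 1 * (of_real c * v $ 1 + of_real d * v $ 4)
      = F v $ 4 * (of_real a * v $ 1 + of_real b * v $ 4)"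
    using assms(2) by (metis mult_left_cancel of_real_eq_0_iff)
qed

text \<open>
  If \<open>F\<close> lies over two transformations then these agree at every point \<open>(1 : t)\<close>.
\<close>

lemma covers_scalar:
  assumes "dominant S S G" "covers 1 0 0 1 G" "covers a b c d G"
  shows "b = 0" "c = 0" "a = d"
proof -
  let ?p = "\<lambda>t. of_real c + (of_real d - of_real a) * t - of_real b * t\<^sup>2 :: complex"
  have "\<forall>\<^sub>F v in generic S. v $ 1 \<noteq> 0 \<and> of_real c * (v $ 1)\<^sup>2
     + (of_real d - of_real a) * v $ 1 * v $ 4 - of_real b * (v $ 4)\<^sup>2 = 0"
    using S.generic_in generic_coord(1)[OF assms(1)] generic_coord(1)[OF S.dominant_id]
  proof eventually_elim
    case (elim v)
    define w z w1 z1 where wz: "w = v $ 1" "z = v $ 4" "w1 = G v $ 1" "z1 = G v $ 4"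
    have 1: "w1 * z = z1 * w"
      "w1 * (of_real c * w + of_real d * z) = z1 * (of_real a * w + of_real b * z)"
      using elim assms(2,3) unfolding covers_def wz by auto
    have "w1 * (w * (of_real c * w + of_real d * z)) = w * (w1 * (of_real c * w + of_real d * z))"
      by (simp only: mult_ac)
    also have "\<dots> = (z1 * w) * (of_real a * w + of_real b * z)"
      unfolding 1(2) by (simp only: mult_ac)
    also have "\<dots> = w1 * (z * (of_real a * w + of_real b * z))"
      unfolding 1(1)[symmetric] by (simp only: mult_ac)
    finally have "w * (of_real c * w + of_real d * z) = z * (of_real a * w + of_real b * z)"
      using elim unfolding wz by simp
    moreover have "v $ 1 \<noteq> 0" using elim by simp
    ultimately show ?case unfolding wz[symmetric]
      by (simp add: algebra_simps power2_eq_square)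
  qed
  from generic_Psi[OF this] have "\<forall>\<^sub>F t in cofinite. ?p t = 0"
  proof eventually_elim
    case (elim t)
    from cofinite_ex[OF this] obtain u where u: "u \<noteq> 0" "of_real c * u\<^sup>2
     + (of_real d - of_real a) * u * (t * u) - of_real b * (t * u)\<^sup>2 = 0"
      by auto
    then have "u\<^sup>2 * ?p t = 0" by (simp add: algebra_simps power2_eq_square)
    then show ?case using u by simp
  qed
  note ev = this
  have pf: "polyfun ?p" by (intro polyfun_intros)
  have p: "?p t = 0" for t
    by (rule polyfun_zero[OF pf eventually_frequently[OF cofinite_complex_neq_bot ev]])
  have "of_real c = (0 :: complex)" using p[of 0] by simp
  then show c: "c = 0" by simp
  have "of_real (d - a - b) = (0 :: complex)" "of_real (- (d - a) - b) = (0 :: complex)"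
    using p[of 1] p[of "-1"] c by simp_all
  then have "d - a - b = 0" "- (d - a) - b = 0" unfolding of_real_eq_0_iff .
  then show "b = 0" "a = d" by auto
qed

lemma nonneg_closed_interval:
  fixes Q :: "real \<Rightarrow> real"
  assumes Q: "continuous_on UNIV Q" and nn: "\<forall>\<^sub>F t in cofinite. -1 < t \<longrightarrow> t < 1 \<longrightarrow> 0 \<le> Q t"
    and t: "-1 \<le> t" "t \<le> 1"
  shows "0 \<le> Q t"
proof (rule ccontr)
  assume "\<not> 0 \<le> Q t"
  then have "t \<in> {s. Q s < 0}" by simp
  moreover have "open {s. Q s < 0}"
    using Q by (intro open_Collect_less) auto
  ultimately obtain e where e: "e > 0" "ball t e \<subseteq> {s. Q s < 0}"
    using open_contains_ball by blast
  have "max (-1) (t - e) < min 1 (t + e)" using e t by auto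
  then have "infinite {max (-1) (t - e)<..<min 1 (t + e)}" by (rule infinite_Ioo)
  moreover have "{max (-1) (t - e)<..<min 1 (t + e)} \<subseteq> {s. \<not> (-1 < s \<longrightarrow> s < 1 \<longrightarrow> 0 \<le> Q s)}"
  proof
    fix s assume "s \<in> {max (-1) (t - e)<..<min 1 (t + e)}"
    then have "s \<in> ball t e" "-1 < s" "s < 1" by (auto simp: dist_real_def)
    then show "s \<in> {s. \<not> (-1 < s \<longrightarrow> s < 1 \<longrightarrow> 0 \<le> Q s)}" using e(2) by fastforce
  qed
  ultimately show False using nn unfolding eventually_cofinite using finite_subset by blast
qed

text \<open>
  A real point has a real image, and real points of \<open>S\<close> satisfy \<open>z\<^sup>2 \<le> w\<^sup>2\<close>.
\<close>

lemma real_covers_bound: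
  assumes F: "dominant S S F" "covers a b c d F"
    and t: "-1 \<le> t" "t \<le> 1"
  shows "(c + d * t)\<^sup>2 \<le> (a + b * t)\<^sup>2"
proof -
  have "0 \<le> (a + b * t)\<^sup>2 - (c + d * t)\<^sup>2"
  proof (rule nonneg_closed_interval[OF _ _ t])
    show "continuous_on UNIV (\<lambda>t. (a + b * t)\<^sup>2 - (c + d * t)\<^sup>2)"
      by (intro continuous_intros)
    have "generically (\<lambda>t u. F (Psi t u) $ 1 \<noteq> 0)"
      using generic_Psi generic_coord(1)[OF F(1)] .
    from generic_real_parameter[OF this]
    show "\<forall>\<^sub>F t in cofinite. -1 < t \<longrightarrow> t < 1 \<longrightarrow> 0 \<le> (a + b * t)\<^sup>2 - (c + d * t)\<^sup>2"
    proof eventually_elim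
      case (elim t)
      show ?case
      proof (intro impI)
        assume "-1 < t" "t < 1"
        then have "{u. (cmod u)\<^sup>2 = 1 - t\<^sup>2 \<and> F (Psi (of_real t) u) $ 1 \<noteq> 0} \<noteq> {}"
          using elim infinite_imp_nonempty by blast
        then obtain u where u: "(cmod u)\<^sup>2 = 1 - t\<^sup>2" "F (Psi (of_real t) u) $ 1 \<noteq> 0" by blast
        let ?v = "rpt (Re u) (Im u) t"
        obtain e where e: "form_map e F" using F dominant_rep rat_repE by metis
        have nz: "F ?v $ 1 \<noteq> 0"
          using u(2) unfolding Psi_rpt[OF u(1)] form_map_homogeneous[OF e] by simp
        have vR: "?v \<in> real_points S" using u(1) unfolding cmod_power2 by (rule rpt_real_point)
        obtain f where f: "\<And>i. F ?v $ i = of_real (f i)" "(f 1)\<^sup>2 = (f 2)\<^sup>2 + (f 3)\<^sup>2 + (f 4)\<^sup>2"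
          using real_point_coords[OF real_points_stable[OF dominant_rep[OF F(1)] vR]] by blast
        from f(2) have f14: "(f 4)\<^sup>2 \<le> (f 1)\<^sup>2" by simp
        have "complex_of_real (f 1 * (c + d * t)) = of_real (f 4 * (a + b * t))"
          using F(2) vR unfolding covers_def real_points_def by (auto simp: f(1))
        then have eq: "f 1 * (c + d * t) = f 4 * (a + b * t)" unfolding of_real_eq_iff .
        have "(f 1)\<^sup>2 * (c + d * t)\<^sup>2 = (f 4)\<^sup>2 * (a + b * t)\<^sup>2"
          using arg_cong[OF eq, of "\<lambda>x. x\<^sup>2"] by (simp add: power_mult_distrib)
        also have "\<dots> \<le> (f 1)\<^sup>2 * (a + b * t)\<^sup>2" using f14 by (intro mult_right_mono) auto
        finally have "(c + d * t)\<^sup>2 \<le> (a + b * t)\<^sup>2"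
          using nz by (simp add: f(1))
        then show "0 \<le> (a + b * t)\<^sup>2 - (c + d * t)\<^sup>2" by simp
      qed
    qed
  qed
  then show ?thesis by simp
qed

text \<open>
  Let \<open>A\<close> be the traceless matrix with rows \<open>(a, b)\<close>, \<open>(c, -a)\<close> and \<open>B = w\<^sup>2 - z\<^sup>2\<close>.  By hypothesis
  \<open>B v \<ge> 0\<close> implies \<open>B (A v) \<ge> 0\<close>; since \<open>A\<^sup>2\<close> is a scalar the converse holds as well.  So the quadratic
  polynomial \<open>Q(t) = B (A (1, t))\<close> is nonnegative on \<open>[-1, 1]\<close> and negative outside, hence vanishes at
  \<open>1\<close> and \<open>-1\<close>, which determines \<open>A\<close> up to the stated parameters.
\<close>

lemma interval_involution:
  fixes a b c :: real
  assumes det: "a * (- a) \<noteq> b * c"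
    and bound: "\<And>t. -1 \<le> t \<Longrightarrow> t \<le> 1 \<Longrightarrow> (c + (- a) * t)\<^sup>2 \<le> (a + b * t)\<^sup>2"
  shows "b = - c" "c\<^sup>2 < a\<^sup>2"
proof -
  define Q where "Q t = (a + b * t)\<^sup>2 - (c + (- a) * t)\<^sup>2" for t
  have neg: "Q t < 0" if t: "\<bar>t\<bar> > 1" for t
  proof (rule ccontr)
    assume "\<not> Q t < 0"
    then have le: "(c - a * t)\<^sup>2 \<le> (a + b * t)\<^sup>2" unfolding Q_def by simp
    define w z where wz: "w = a + b * t" "z = c - a * t"
    have "w \<noteq> 0"
    proof
      assume "w = 0"
      then have "z = 0" using le unfolding wz by simp
      then have "b * t = - a" "c = a * t" using \<open>w = 0\<close> unfolding wz by auto
      then have "b * c = a * (- a)" by (metis mult.left_commute)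
      then show False using det by simp
    qed
    define s where "s = z / w"
    have "s\<^sup>2 \<le> 1" using le \<open>w \<noteq> 0\<close> unfolding s_def wz[symmetric] by (simp add: power_divide)
    then have "-1 \<le> s" "s \<le> 1" by (auto simp: abs_square_le_1 abs_le_iff)
    then have "(c + (- a) * s)\<^sup>2 \<le> (a + b * s)\<^sup>2" by (rule bound)
    then have "w\<^sup>2 * (c + (- a) * s)\<^sup>2 \<le> w\<^sup>2 * (a + b * s)\<^sup>2" by (simp add: mult_left_mono)
    then have "(c * w - a * z)\<^sup>2 \<le> (a * w + b * z)\<^sup>2"
      unfolding s_def power_mult_distrib[symmetric] using \<open>w \<noteq> 0\<close> by (simp add: algebra_simps)
    moreover have "a * w + b * z = a\<^sup>2 + b * c" "c * w - a * z = (a\<^sup>2 + b * c) * t"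
      unfolding wz by (simp_all add: algebra_simps power2_eq_square)
    ultimately have "(a\<^sup>2 + b * c)\<^sup>2 * t\<^sup>2 \<le> (a\<^sup>2 + b * c)\<^sup>2" by (simp add: power_mult_distrib)
    moreover have "a\<^sup>2 + b * c \<noteq> 0" using det by (auto simp: power2_eq_square)
    ultimately have "t\<^sup>2 \<le> 1" by simp
    then show False using t by (simp add: abs_square_le_1)
  qed
  have cont: "(Q \<longlongrightarrow> Q x) (at x within X)" for x X
    unfolding Q_def by (intro tendsto_intros)
  have "Q 1 \<le> 0"
  proof (rule tendsto_upperbound[OF cont[of 1 "{1<..}"]])
    show "\<forall>\<^sub>F x in at_right 1. Q x \<le> 0"
      using eventually_at_right_less[of "1::real"] by eventually_elim (rule less_imp_le, rule neg, simp)
  qed simp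
  moreover have "Q (-1) \<le> 0"
  proof (rule tendsto_upperbound[OF cont[of "-1" "{..<-1}"]])
    have "\<forall>\<^sub>F x in at_left (-1::real). x \<in> {..<-1}" by (simp add: eventually_at_filter)
    then show "\<forall>\<^sub>F x in at_left (-1). Q x \<le> 0"
      by eventually_elim (rule less_imp_le, rule neg, simp)
  qed simp
  moreover have "0 \<le> Q 1" "0 \<le> Q (-1)" "0 \<le> Q 0" using bound[of 1] bound[of "-1"] bound[of 0]
    unfolding Q_def by auto
  ultimately have Q: "(a + b)\<^sup>2 = (c - a)\<^sup>2" "(a - b)\<^sup>2 = (c + a)\<^sup>2" "c\<^sup>2 \<le> a\<^sup>2"
    unfolding Q_def by auto
  have bc: "b\<^sup>2 = c\<^sup>2" "a * (b + c) = 0"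
    using Q(1,2) by (simp_all add: power2_eq_square algebra_simps)
  have "a \<noteq> 0"
  proof
    assume "a = 0"
    then have "c = 0" "b = 0" using Q(3) bc by auto
    then show False using det \<open>a = 0\<close> by simp
  qed
  then show b: "b = - c" using bc by simp
  have "a\<^sup>2 \<noteq> c\<^sup>2" using det unfolding b by (simp add: power2_eq_square)
  then show "c\<^sup>2 < a\<^sup>2" using Q by simp
qed

text \<open>
  The square of the matrix over which \<open>F\<close> lies is a scalar.  If the trace were nonzero, the matrix
  itself would be a scalar, and \<open>F\<close> would lie over the identity.
\<close>

lemma involution_covers:
  assumes \<sigma>: "\<sigma> \<in> carrier Bir_S_proj" "\<sigma> \<cdot> \<sigma> = \<one>\<^sub>S" "\<sigma> \<notin> carrier Bir_S_over_proj"
    and F: "F \<in> \<sigma>"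
  obtains a c where "c\<^sup>2 < a\<^sup>2" "covers a (- c) c (- a) F"
proof -
  have \<sigma>B: "\<sigma> \<in> carrier (Bir S)" using \<sigma>(1) subgroup.subset[OF subgroup_Bir_S_proj] by blast
  have domF: "dominant S S F" using S.Bir_rep[OF \<sigma>B F] by blast
  obtain a b c d where det: "a * d \<noteq> b * c" and bF: "covers a b c d F"
    using Bir_S_proj_iff[OF \<sigma>B F] \<sigma>(1) by blast
  have FF: "rat_eq S (F \<circ> F) id" "rat_rep S S (F \<circ> F)"
    using S.Bir_mult_rep[OF \<sigma>B \<sigma>B F F] \<sigma>(2) S.Bir_one_rep by auto
  have domFF: "dominant S S (F \<circ> F)" using domF by (rule dominant_compose) (rule domF)
  have "covers 1 0 0 1 id" unfolding covers_def by simp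
  then have I: "covers 1 0 0 1 (F \<circ> F)"
    using covers_cong[OF S.rat_rep_id FF(2)] S.rat_eq_sym[OF FF(1)] by blast
  have "covers (a * a + b * c) (a * b + b * d) (c * a + d * c) (c * b + d * d) (F \<circ> F)"
    by (rule covers_compose[OF domF domF bF bF])
  note sc = covers_scalar[OF domFF I this]
  have "d = - a"
  proof (rule ccontr)
    assume "d \<noteq> - a"
    then have ad: "a + d \<noteq> 0" by auto
    have "b * (a + d) = 0" "c * (a + d) = 0" "(a - d) * (a + d) = 0"
      using sc by (auto simp: algebra_simps)
    then have "b = 0" "c = 0" "d = a" using ad by auto
    moreover from this have "a \<noteq> 0" using det by auto
    ultimately have "covers 1 0 0 1 F" using bF covers_unscale[of a 1 0 0 1 F] by simp
    then show False using over_proj_iff[OF \<sigma>B F] \<sigma>(3) by blast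
  qed
  then have det: "a * (- a) \<noteq> b * c" and bF: "covers a b c (- a) F" using det bF by auto
  note * = interval_involution[OF det real_covers_bound[OF domF bF]]
  then show ?thesis using that bF by auto
qed

text \<open>
  A Lorentz transformation of \<open>(w, z)\<close>, multiplied by \<open>sqrt (1 - m\<^sup>2)\<close> to avoid denominators.
\<close>

definition boost :: "real \<Rightarrow> complex ^ 4 \<Rightarrow> complex ^ 4" where
  "boost m v = vector [1 * v $ 1 + of_real m * v $ 4, of_real (sqrt (1 - m\<^sup>2)) * v $ 2,
     of_real (sqrt (1 - m\<^sup>2)) * v $ 3, of_real m * v $ 1 + 1 * v $ 4]"

lemma boost_Bir:
  assumes "\<bar>m\<bar> < 1"
  shows "rat_class S S (boost m) \<in> carrier (Bir S)"
    and "inv\<^sub>S (rat_class S S (boost m)) = rat_class S S (boost (- m))"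
    and "boost m \<in> rat_class S S (boost m)" "covers 1 m m 1 (boost m)"
proof -
  have pos: "0 < 1 - m\<^sup>2" using assms by (simp add: abs_square_less_1)
  then have sq: "(of_real (sqrt (1 - m\<^sup>2)))\<^sup>2 = (1 - (of_real m)\<^sup>2 :: complex)"
    by (simp flip: of_real_power)
  then have sq': "of_real (sqrt (1 - m\<^sup>2)) * of_real (sqrt (1 - m\<^sup>2)) = (1 - of_real m * of_real m :: complex)"
    by (simp add: power2_eq_square)
  have inv: "boost (- m) (boost m v) = of_real (1 - m\<^sup>2) *s v"
           "boost m (boost (- m) v) = of_real (1 - m\<^sup>2) *s v" for v
  proof -
    have "of_real (sqrt (1 - m\<^sup>2)) * (of_real (sqrt (1 - m\<^sup>2)) * x) = (1 - of_real m * of_real m) * x"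
      for x :: complex
      by (simp only: sq' flip: mult.assoc)
    then show "boost (- m) (boost m v) = of_real (1 - m\<^sup>2) *s v"
      "boost m (boost (- m) v) = of_real (1 - m\<^sup>2) *s v"
      unfolding vec_eq_4 boost_def
      by (simp_all add: distrib_left left_diff_distrib right_diff_distrib power2_eq_square mult.assoc)
  qed
  have v0: "vector [1, 1, 0, 0] \<in> S" "(vector [1, 1, 0, 0] :: complex ^ 4) \<noteq> 0"
    unfolding S_def by (simp_all add: vec_eq_4)
  have "boost (- m) (boost m (vector [1, 1, 0, 0])) \<noteq> 0" "boost m (boost (- m) (vector [1, 1, 0, 0])) \<noteq> 0"
    unfolding inv using v0(2) pos by (auto simp: vec_eq_4 simp del: of_real_diff of_real_power)
  then have nz: "boost n (boost (- n) (vector [1, 1, 0, 0])) \<noteq> 0" if "n = m \<or> n = - m" for n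
    using that by auto
  have "boost n 0 = 0" for n unfolding boost_def by (simp add: vec_eq_4)
  then have nz1: "boost n (vector [1, 1, 0, 0]) \<noteq> 0" if "n = m \<or> n = - m" for n
    using nz[of "- n"] that by (metis minus_minus)
  have rep: "rat_rep S S (boost n)" if n: "n = m \<or> n = - m" for n
  proof (rule rat_repI[OF _ v0(1)])
    have x: "real_form 1 (\<lambda>v :: complex ^ 4. of_real x * v $ i)" for x i
      by (intro real_form_scale real_form_coord)
    have "real_form 1 (\<lambda>v :: complex ^ 4. of_real 1 * v $ i)" for i
      by (intro real_form_scale real_form_coord)
    then have y: "real_form 1 (\<lambda>v :: complex ^ 4. 1 * v $ i)" for i by simp
    show "form_map 1 (boost n)"
      unfolding boost_def using form_map_4[OF real_form_add[OF y x] x x real_form_add[OF x y]] .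
    show "boost n (vector [1, 1, 0, 0]) \<noteq> 0" using nz1 n .
    have sqn: "(of_real (sqrt (1 - n\<^sup>2)))\<^sup>2 = (1 - (of_real n)\<^sup>2 :: complex)" using sq n by auto
    show "boost n v \<in> S" if "v \<in> S" for v
    proof -
      have "(v $ 1 + of_real n * v $ 4)\<^sup>2 - (of_real n * v $ 1 + v $ 4)\<^sup>2
          = (1 - (of_real n)\<^sup>2) * ((v $ 1)\<^sup>2 - (v $ 4)\<^sup>2)"
        by (simp add: algebra_simps power2_eq_square)
      also have "(v $ 1)\<^sup>2 - (v $ 4)\<^sup>2 = (v $ 2)\<^sup>2 + (v $ 3)\<^sup>2" using that unfolding S_def by simp
      finally show ?thesis unfolding S_def boost_def
        by (simp add: power_mult_distrib sqn algebra_simps)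
    qed
  qed
  have ex: "\<exists>v\<in>S. boost m (boost (- m) v) \<noteq> 0" "\<exists>v\<in>S. boost (- m) (boost m v) \<noteq> 0"
    using nz[of m] nz[of "- m"] v0(1) by auto
  have eq: "rat_eq S (boost m \<circ> boost (- m)) id" "rat_eq S (boost (- m) \<circ> boost m) id"
    unfolding rat_eq_parallel comp_apply inv by (simp_all del: of_real_diff of_real_power)
  show "rat_class S S (boost m) \<in> carrier (Bir S)"
    "inv\<^sub>S (rat_class S S (boost m)) = rat_class S S (boost (- m))"
    using S.BirI[OF rep rep ex(1) eq(1) ex(2) eq(2)] by auto
  show "boost m \<in> rat_class S S (boost m)" using S.rat_class_self rep by blast
  show "covers 1 m m 1 (boost m)" unfolding covers_def boost_def by (simp add: mult.commute)
qed

text \<open>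
  The involution of the base with matrix rows \<open>(a, -c)\<close>, \<open>(c, -a)\<close> fixes the points with
  \<open>c t\<^sup>2 - 2 a t + c = 0\<close>, one of which lies in the open interval.  The boost moves it to \<open>0\<close>.
\<close>

lemma conj_to_flip:
  assumes \<sigma>: "\<sigma> \<in> carrier Bir_S_proj" "\<sigma> \<cdot> \<sigma> = \<one>\<^sub>S" "\<sigma> \<notin> carrier Bir_S_over_proj"
  obtains g F where "g \<in> carrier Bir_S_proj"
    "F \<in> g \<cdot> \<sigma> \<cdot> inv\<^sub>S g" "covers 1 0 0 (-1) F"
proof -
  have \<sigma>B: "\<sigma> \<in> carrier (Bir S)" using \<sigma>(1) subgroup.subset[OF subgroup_Bir_S_proj] by blast
  then obtain F where F: "F \<in> \<sigma>" "dominant S S F" by (rule S.Bir_obtain_rep)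
  obtain a c where ac: "c\<^sup>2 < a\<^sup>2" "covers a (- c) c (- a) F" using involution_covers[OF \<sigma> F(1)] .
  \<comment> \<open>the fixed point in the interval is \<open>- m\<close>; the form chosen avoids a division by \<open>k\<close>, which may be \<open>0\<close>\<close>
  define k s m where "k = c / a" and "s = sqrt (1 - k\<^sup>2)" and "m = - k / (1 + s)"
  have "a \<noteq> 0" using ac(1) by auto
  then have "k\<^sup>2 < 1" using ac(1) unfolding k_def by (simp add: power_divide)
  then have s: "0 \<le> s" "s\<^sup>2 = 1 - k\<^sup>2" unfolding s_def by auto
  have "\<bar>k\<bar> < 1" using \<open>k\<^sup>2 < 1\<close> by (simp add: abs_square_less_1)
  have "\<bar>m\<bar> \<le> \<bar>k\<bar> / 1" unfolding m_def using s(1)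
    by (simp add: abs_divide pos_divide_le_eq distrib_left)
  then have m: "\<bar>m\<bar> < 1" using \<open>\<bar>k\<bar> < 1\<close> by simp
  have mq: "m * (1 + s) = - k" unfolding m_def using s(1) by simp
  have "(1 + s)\<^sup>2 * (k * m\<^sup>2 + 2 * m + k)
      = k * (m * (1 + s))\<^sup>2 + 2 * (m * (1 + s)) * (1 + s) + k * (1 + s)\<^sup>2"
    by (simp add: algebra_simps power2_eq_square)
  also have "\<dots> = k * (k\<^sup>2 - 2 * (1 + s) + (1 + s)\<^sup>2)"
    unfolding mq by (simp add: algebra_simps power2_eq_square)
  also have "\<dots> = 0" using s(2) by (simp add: power2_eq_square algebra_simps)
  finally have km: "k * m\<^sup>2 + 2 * m + k = 0" using s(1) by simp
  have c: "c = k * a" using \<open>a \<noteq> 0\<close> unfolding k_def by simp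
  let ?B = "\<lambda>m. rat_class S S (boost m)"
  note b1 = boost_Bir[OF m]
  have "\<bar>- m\<bar> < 1" using m by simp
  note b2 = boost_Bir[OF this]
  have dom: "dominant S S (boost m)" "dominant S S (boost (- m))"
    using S.Bir_rep b1(1,3) b2(1,3) by blast+
  have g: "?B m \<in> carrier Bir_S_proj"
  proof -
    have "1 * 1 \<noteq> m * m" using m by (metis abs_square_less_1 less_irrefl mult_1 power2_eq_square)
    then show ?thesis using Bir_S_proj_iff[OF b1(1,3)] b1(4) by blast
  qed
  have rep: "boost m \<circ> F \<circ> boost (- m) \<in> ?B m \<cdot> \<sigma> \<cdot> inv\<^sub>S ?B m"
    using b1 b2 F \<sigma>B by (intro S.Bir_mult_rep Bir_S.m_closed) auto
  have "covers (1 * a + m * c) (1 * (- c) + m * (- a)) (m * a + 1 * c) (m * (- c) + 1 * (- a)) (boost m \<circ> F)"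
    using covers_compose[OF F(2) dom(1) ac(2) b1(4)] .
  from covers_compose[OF dom(2) dominant_compose[OF F(2) dom(1)] b2(4) this]
  have "covers (a * (1 + 2 * (k * m) + m\<^sup>2) * 1) (- a * (k * m\<^sup>2 + 2 * m + k))
     (a * (k * m\<^sup>2 + 2 * m + k)) (a * (1 + 2 * (k * m) + m\<^sup>2) * (-1)) (boost m \<circ> F \<circ> boost (- m))"
    unfolding c by (simp add: algebra_simps power2_eq_square)
  then have b: "covers (a * (1 + 2 * (k * m) + m\<^sup>2) * 1) (a * (1 + 2 * (k * m) + m\<^sup>2) * 0)
     (a * (1 + 2 * (k * m) + m\<^sup>2) * 0) (a * (1 + 2 * (k * m) + m\<^sup>2) * (-1)) (boost m \<circ> F \<circ> boost (- m))"
    unfolding km by simp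
  have "1 + 2 * (k * m) + m\<^sup>2 = (m + k)\<^sup>2 + (1 - k\<^sup>2)" by (simp add: power2_eq_square algebra_simps)
  also have "\<dots> > 0" using \<open>k\<^sup>2 < 1\<close> by (simp add: add_nonneg_pos)
  finally have "a * (1 + 2 * (k * m) + m\<^sup>2) \<noteq> 0" using \<open>a \<noteq> 0\<close> by simp
  from covers_unscale[OF b this] show ?thesis using that g rep by blast
qed

text \<open>
  \<open>Bir(S/\<pi>)\<close> is normal in \<open>Bir(S, \<pi>)\<close>: a conjugate of a map over the identity lies over a scalar matrix.
\<close>

lemma conj_over_proj:
  assumes g: "g \<in> carrier Bir_S_proj" and \<sigma>: "\<sigma> \<in> carrier Bir_S_proj"
    and over: "g \<cdot> \<sigma> \<cdot> inv\<^sub>S g \<in> carrier Bir_S_over_proj"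
  shows "\<sigma> \<in> carrier Bir_S_over_proj"
proof -
  have sub: "carrier Bir_S_proj \<subseteq> carrier (Bir S)" using subgroup.subset[OF subgroup_Bir_S_proj] .
  have gB: "g \<in> carrier (Bir S)" and \<sigma>B: "\<sigma> \<in> carrier (Bir S)" using g \<sigma> sub by auto
  let ?\<tau> = "g \<cdot> \<sigma> \<cdot> inv\<^sub>S g"
  have \<tau>B: "?\<tau> \<in> carrier (Bir S)" using gB \<sigma>B by simp
  obtain G where G: "G \<in> g" "dominant S S G" by (rule S.Bir_obtain_rep[OF gB])
  obtain G' where G': "G' \<in> inv\<^sub>S g" "dominant S S G'" 
    by (rule S.Bir_obtain_rep[OF Bir_S.inv_closed[OF gB]])
  obtain T where T: "T \<in> ?\<tau>" "dominant S S T" by (rule S.Bir_obtain_rep[OF \<tau>B])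
  obtain a b c d where det: "a * d \<noteq> b * c" and bG: "covers a b c d G"
    using Bir_S_proj_iff[OF gB G(1)] g by blast
  have "G \<circ> G' \<in> g \<cdot> inv\<^sub>S g" using S.Bir_mult_rep G G' gB by blast
  then have "rat_eq S (G \<circ> G') id" using gB S.Bir_one_rep by simp
  then have bG': "covers d (- b) (- c) a G'" using covers_inverse G G' bG by blast
  have bT: "covers 1 0 0 1 T" using over_proj_iff[OF \<tau>B T(1)] over by blast
  have R: "G' \<circ> T \<circ> G \<in> inv\<^sub>S g \<cdot> ?\<tau> \<cdot> g"
    using G G' T gB \<tau>B \<sigma>B by (intro S.Bir_mult_rep Bir_S.m_closed) auto
  have "inv\<^sub>S g \<cdot> ?\<tau> \<cdot> g = \<sigma>"
    using gB \<sigma>B by (simp add: Bir_S.m_assoc Bir_S.inv_solve_left')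
  then have R: "G' \<circ> T \<circ> G \<in> \<sigma>" using R by simp
  from covers_compose[OF T(2) G'(2) bT bG']
  have "covers d (- b) (- c) a (G' \<circ> T)" by simp
  from covers_compose[OF G(2) dominant_compose[OF T(2) G'(2)] bG this]
  have "covers ((a * d - b * c) * 1) ((a * d - b * c) * 0) ((a * d - b * c) * 0) ((a * d - b * c) * 1) (G' \<circ> T \<circ> G)"
    by (simp add: algebra_simps)
  then have "covers 1 0 0 1 (G' \<circ> T \<circ> G)" by (rule covers_unscale) (use det in auto)
  then show ?thesis using over_proj_iff[OF \<sigma>B R] by blast
qed

section \<open>The action on the fibres\<close>

text \<open>
  In the coordinates \<open>(t, u)\<close> the map is \<open>(s t, (a(t) u + b(t)) / (c(t) u + d(t)))\<close>.
\<close>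

definition acts ::
  "complex \<Rightarrow> complex poly \<Rightarrow> complex poly \<Rightarrow> complex poly \<Rightarrow> complex poly \<Rightarrow> (complex ^ 4 \<Rightarrow> complex ^ 4) \<Rightarrow> bool"
  where
  "acts s a b c d F \<longleftrightarrow> (\<forall>t u. F (Psi t u) $ 4 = s * t * F (Psi t u) $ 1 \<and>
     Xc (F (Psi t u)) * (poly c t * u + poly d t) = F (Psi t u) $ 1 * (poly a t * u + poly b t))"

lemma poly_eq_fun: "(\<And>t :: complex. poly p t = poly q t) \<Longrightarrow> p = q"
  using poly_eq_poly_eq_iff by blast

lemma biv_eq:
  assumes "biv f" "biv g" "generically (\<lambda>t u. f t u = g t u)"
  shows "f t u = g t u"
proof -
  have "f t u - g t u = 0"
    by (rule biv_zero[of "\<lambda>t u. f t u - g t u"])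
      (use assms in \<open>auto intro: biv_intros elim!: generically_mono\<close>)
  then show ?thesis by simp
qed

lemma biv_linear: "biv (\<lambda>t u. poly p t * u + poly q t)"
  by (intro biv_intros polyfun_intros)

lemma generically_coord:
  assumes "dominant S S F"
  shows "generically (\<lambda>t u. u \<noteq> 0 \<and> F (Psi t u) $ 1 \<noteq> 0 \<and> Xc (F (Psi t u)) \<noteq> 0)"
proof -
  have "\<forall>\<^sub>F v in generic S. v $ 1 \<noteq> 0 \<and> F v $ 1 \<noteq> 0 \<and> Xc (F v) \<noteq> 0"
    using generic_coord(1)[OF S.dominant_id] generic_coord(1,2)[OF assms] by eventually_elim simp
  from generic_Psi[OF this] show ?thesis by simp
qed

text \<open>
  The image of \<open>(t, u)\<close> under \<open>F\<close> has first coordinate \<open>s t\<close>, so the matrix of \<open>G\<close> enters the product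
  with \<open>s t\<close> in place of \<open>t\<close>.
\<close>

lemma acts_compose:
  assumes F: "dominant S S F" "acts s a b c d F"
    and G: "form_map e G" "acts s' a' b' c' d' G"
  shows "acts (s' * s)
    (pcompose a' [:0, s:] * a + pcompose b' [:0, s:] * c) (pcompose a' [:0, s:] * b + pcompose b' [:0, s:] * d)
    (pcompose c' [:0, s:] * a + pcompose d' [:0, s:] * c) (pcompose c' [:0, s:] * b + pcompose d' [:0, s:] * d)
    (G \<circ> F)" (is "acts _ ?a ?b ?c ?d _")
proof -
  obtain e' where e': "form_map e' F" using F dominant_rep rat_repE by metis
  have GF: "form_map (e * e') (G \<circ> F)" using form_map_comp[OF G(1) e'] .
  note biv_GF = biv_form_map[OF GF]
  have gen: "generically (\<lambda>t u. (G \<circ> F) (Psi t u) $ 4 = s' * s * t * (G \<circ> F) (Psi t u) $ 1 \<and>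
      Xc ((G \<circ> F) (Psi t u)) * (poly ?c t * u + poly ?d t) = (G \<circ> F) (Psi t u) $ 1 * (poly ?a t * u + poly ?b t))"
    using generically_coord[OF F(1)]
  proof (rule generically_mono)
    fix t u assume nz: "u \<noteq> 0 \<and> F (Psi t u) $ 1 \<noteq> 0 \<and> Xc (F (Psi t u)) \<noteq> 0"
    define v where "v = F (Psi t u)"
    define U where "U = Xc v / v $ 1"
    have v: "v $ 4 = s * t * v $ 1"
      "Xc v * (poly c t * u + poly d t) = v $ 1 * (poly a t * u + poly b t)"
      using F(2) unfolding acts_def v_def by auto
    have vS: "v \<in> S" "v $ 1 \<noteq> 0" "Xc v \<noteq> 0"
      using nz F(1) dominant_rep rat_rep_in Psi_in_S unfolding v_def by blast+
    have "v $ 4 / v $ 1 = s * t" using v vS by simp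
    then obtain k where k: "v = k *s Psi (s * t) U" using S_eq_Psi[OF vS] unfolding U_def by metis
    have Gv: "G v = k ^ e *s G (Psi (s * t) U)" unfolding k form_map_homogeneous[OF G(1)] ..
    have 1: "G v $ 4 = s' * s * t * G v $ 1"
      using G(2) unfolding acts_def Gv by simp
    let ?A = "poly a' (s * t)" and ?B = "poly b' (s * t)" and ?C = "poly c' (s * t)" and ?D = "poly d' (s * t)"
    have 2: "Xc (G v) * (?C * U + ?D) = G v $ 1 * (?A * U + ?B)"
      using G(2) unfolding acts_def Gv by (simp add: mult.assoc)
    have Uv: "U * v $ 1 = Xc v" using vS unfolding U_def by simp
    have lin: "v $ 1 * (p * (poly a t * u + poly b t) + q * (poly c t * u + poly d t))
       = v $ 1 * (p * U + q) * (poly c t * u + poly d t)" for p q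
    proof -
      have "v $ 1 * (p * (poly a t * u + poly b t) + q * (poly c t * u + poly d t))
         = p * (v $ 1 * (poly a t * u + poly b t)) + v $ 1 * q * (poly c t * u + poly d t)"
        by (simp add: algebra_simps)
      also have "\<dots> = (p * (U * v $ 1) + v $ 1 * q) * (poly c t * u + poly d t)"
        unfolding v(2)[symmetric] Uv by (simp only: distrib_right mult.assoc)
      finally show ?thesis by (simp add: algebra_simps)
    qed
    have "v $ 1 * (Xc (G v) * (?C * (poly a t * u + poly b t) + ?D * (poly c t * u + poly d t)))
       = Xc (G v) * (v $ 1 * (?C * (poly a t * u + poly b t) + ?D * (poly c t * u + poly d t)))"
      by (simp only: mult_ac)
    also have "\<dots> = (Xc (G v) * (?C * U + ?D)) * (v $ 1 * (poly c t * u + poly d t))"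
      unfolding lin by (simp only: mult_ac)
    also have "\<dots> = G v $ 1 * (v $ 1 * (?A * (poly a t * u + poly b t) + ?B * (poly c t * u + poly d t)))"
      unfolding 2 lin by (simp only: mult_ac)
    finally have "v $ 1 * (Xc (G v) * (?C * (poly a t * u + poly b t) + ?D * (poly c t * u + poly d t)))
       = v $ 1 * (G v $ 1 * (?A * (poly a t * u + poly b t) + ?B * (poly c t * u + poly d t)))"
      by (simp only: mult_ac)
    then have "Xc (G v) * (?C * (poly a t * u + poly b t) + ?D * (poly c t * u + poly d t))
       = G v $ 1 * (?A * (poly a t * u + poly b t) + ?B * (poly c t * u + poly d t))"
      using vS(2) by (metis mult_left_cancel)
    then show "(G \<circ> F) (Psi t u) $ 4 = s' * s * t * (G \<circ> F) (Psi t u) $ 1 \<and>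
      Xc ((G \<circ> F) (Psi t u)) * (poly ?c t * u + poly ?d t) = (G \<circ> F) (Psi t u) $ 1 * (poly ?a t * u + poly ?b t)"
      using 1 unfolding v_def by (simp add: poly_pcompose algebra_simps)
  qed
  show ?thesis unfolding acts_def
  proof (intro allI conjI)
    fix t u
    show "(G \<circ> F) (Psi t u) $ 4 = s' * s * t * (G \<circ> F) (Psi t u) $ 1"
      by (rule biv_eq[where f = "\<lambda>t u. (G \<circ> F) (Psi t u) $ 4"])
       (intro biv_GF, intro biv_intros biv_GF polyfun_intros, rule generically_mono[OF gen], blast)
    show "Xc ((G \<circ> F) (Psi t u)) * (poly ?c t * u + poly ?d t) = (G \<circ> F) (Psi t u) $ 1 * (poly ?a t * u + poly ?b t)"
      by (rule biv_eq[where f = "\<lambda>t u. Xc ((G \<circ> F) (Psi t u)) * (poly ?c t * u + poly ?d t)"])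
       (rule biv_intros(3), rule biv_GF, rule biv_linear, rule biv_intros(3), rule biv_GF, rule biv_linear,
         rule generically_mono[OF gen], blast)
  qed
qed

lemma acts_identity:
  assumes H: "dominant S S H" "rat_eq S H id" "acts s a b c d H"
  shows "b = 0" "c = 0" "a = d"
proof -
  have gen: "generically (\<lambda>t u. u * (poly c t * u + poly d t) = poly a t * u + poly b t)"
    using generically_coord[OF H(1)]
  proof (rule generically_mono)
    fix t u assume nz: "u \<noteq> 0 \<and> H (Psi t u) $ 1 \<noteq> 0 \<and> Xc (H (Psi t u)) \<noteq> 0"
    have "parallel (H (Psi t u)) (Psi t u)" using H(2) unfolding rat_eq_parallel by simp
    then have "Xc (H (Psi t u)) * u = u\<^sup>2 * H (Psi t u) $ 1" using parallel_coords(2) by fastforce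
    then have X: "Xc (H (Psi t u)) = u * H (Psi t u) $ 1" using nz by (simp add: power2_eq_square)
    have "H (Psi t u) $ 1 * (u * (poly c t * u + poly d t)) = H (Psi t u) $ 1 * (poly a t * u + poly b t)"
    proof -
      have "Xc (H (Psi t u)) * (poly c t * u + poly d t) = H (Psi t u) $ 1 * (poly a t * u + poly b t)"
        using H(3) unfolding acts_def by blast
      then show ?thesis unfolding X by (simp only: mult_ac)
    qed
    then show "u * (poly c t * u + poly d t) = poly a t * u + poly b t" using nz by (metis mult_left_cancel)
  qed
  have all: "u * (poly c t * u + poly d t) = poly a t * u + poly b t" for t u
    by (rule biv_eq[where f = "\<lambda>t u. u * (poly c t * u + poly d t)"])
      (rule biv_intros(3), rule biv_intros(5), rule polyfun_ident, rule biv_linear, rule biv_linear, rule gen)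
  have b: "poly b t = 0" for t using all[of 0 t] by simp
  have 1: "poly c t + poly d t = poly a t" "poly c t - poly d t = - poly a t" for t
    using all[of 1 t] all[of "-1" t] b[of t] by simp_all
  have c: "poly c t = 0" for t
  proof -
    have "2 * poly c t = (poly c t + poly d t) + (poly c t - poly d t)" by simp
    then show ?thesis unfolding 1 by simp
  qed
  show "b = 0" "c = 0" "a = d" using b c 1(1) by (auto intro!: poly_eq_fun)
qed

text \<open>
  A Moebius transformation is determined by its values at \<open>x - 1\<close>, \<open>x + 1\<close> and their mean \<open>x\<close>, and its
  matrix is polynomial in numerators and denominators of these values: the columns of the matrix
  are found from the requirement that \<open>(x - 1, 1)\<close> and \<open>(x + 1, 1)\<close> go to multiples of
  \<open>(N (x - 1), D (x - 1))\<close> and \<open>(N (x + 1), D (x + 1))\<close> whose sum is a multiple of \<open>(N x, D x)\<close>.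
\<close>

lemma moebius_interpolation:
  fixes A B C E x :: complex and N D :: "complex \<Rightarrow> complex"
  assumes det: "A * E \<noteq> B * C"
    and m: "\<And>u. N u * (C * u + E) = D u * (A * u + B)"
    and D: "D (x - 1) \<noteq> 0" "D (x + 1) \<noteq> 0" "D x \<noteq> 0"
    and \<alpha>: "\<alpha> = N x * D (x + 1) - N (x + 1) * D x"
    and \<beta>: "\<beta> = N (x - 1) * D x - N x * D (x - 1)"
  defines "a \<equiv> \<beta> * N (x + 1) - \<alpha> * N (x - 1)"
    and "c \<equiv> \<beta> * D (x + 1) - \<alpha> * D (x - 1)"
    and "b \<equiv> (x + 1) * (\<alpha> * N (x - 1)) - (x - 1) * (\<beta> * N (x + 1))"
    and "d \<equiv> (x + 1) * (\<alpha> * D (x - 1)) - (x - 1) * (\<beta> * D (x + 1))"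
  shows "a * d \<noteq> b * c" and "N u * (c * u + d) = D u * (a * u + b)"
proof -
  define \<mu> where "\<mu> u = (C * u + E) / D u" for u
  define \<delta> where "\<delta> = N (x - 1) * D (x + 1) - N (x + 1) * D (x - 1)"
  have l: "C * u + E = \<mu> u * D u" "A * u + B = \<mu> u * N u" if "D u \<noteq> 0" for u
  proof -
    show 1: "C * u + E = \<mu> u * D u" using that unfolding \<mu>_def by simp
    have "D u * (A * u + B) = D u * (\<mu> u * N u)" using m[of u] unfolding 1 by (simp only: mult_ac)
    then show "A * u + B = \<mu> u * N u" using that by simp
  qed
  have nz: "\<mu> u \<noteq> 0" if "D u \<noteq> 0" for u
  proof
    assume "\<mu> u = 0"
    then have "C * u + E = 0" "A * u + B = 0" using l[OF that] by auto
    then have "E = - C * u" "B = - A * u" by (simp_all add: eq_neg_iff_add_eq_0 add.commute)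
    then show False using det by simp
  qed
  \<comment> \<open>the three factors by which the given matrix differs from the given values\<close>
  define p q r where "p = \<mu> (x - 1)" and "q = \<mu> (x + 1)" and "r = \<mu> x"
  define n1 n2 n3 d1 d2 d3 where nd: "n1 = N (x - 1)" "n2 = N (x + 1)" "n3 = N x"
    "d1 = D (x - 1)" "d2 = D (x + 1)" "d3 = D x"
  have \<alpha>n: "\<alpha> = n3 * d2 - n2 * d3" and \<beta>n: "\<beta> = n1 * d3 - n3 * d1" and \<delta>n: "\<delta> = n1 * d2 - n2 * d1"
    unfolding \<alpha> \<beta> \<delta>_def nd by simp_all
  have an: "a = \<beta> * n2 - \<alpha> * n1" and cn: "c = \<beta> * d2 - \<alpha> * d1"
    and bn: "b = (x + 1) * (\<alpha> * n1) - (x - 1) * (\<beta> * n2)"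
    and dn: "d = (x + 1) * (\<alpha> * d1) - (x - 1) * (\<beta> * d2)"
    unfolding a_def b_def c_def d_def nd by simp_all
  have e1: "C * (x - 1) + E = p * d1" "A * (x - 1) + B = p * n1"
    using l[OF D(1)] unfolding p_def nd by auto
  have e2: "C * (x + 1) + E = q * d2" "A * (x + 1) + B = q * n2"
    using l[OF D(2)] unfolding q_def nd by auto
  have e3: "C * x + E = r * d3" "A * x + B = r * n3"
    using l[OF D(3)] unfolding r_def nd by auto
  have s: "2 * r * d3 = p * d1 + q * d2" "2 * r * n3 = p * n1 + q * n2"
    unfolding e1[symmetric] e2[symmetric] mult.assoc e3[symmetric] by (simp_all add: algebra_simps)
  have AC: "2 * A = q * n2 - p * n1" "2 * C = q * d2 - p * d1"
    unfolding e1[symmetric] e2[symmetric] by (simp_all add: algebra_simps)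
  have BE: "2 * B = (x + 1) * (p * n1) - (x - 1) * (q * n2)" "2 * E = (x + 1) * (p * d1) - (x - 1) * (q * d2)"
    unfolding e1[symmetric] e2[symmetric] by (simp_all add: algebra_simps)
  have "2 * r * \<alpha> = (2 * r * n3) * d2 - n2 * (2 * r * d3)" unfolding \<alpha>n by (simp add: algebra_simps)
  also have "\<dots> = p * \<delta>" unfolding s \<delta>n by (simp add: algebra_simps)
  finally have \<alpha>': "2 * r * \<alpha> = p * \<delta>" .
  have "2 * r * \<beta> = n1 * (2 * r * d3) - (2 * r * n3) * d1" unfolding \<beta>n by (simp add: algebra_simps)
  also have "\<dots> = q * \<delta>" unfolding s \<delta>n by (simp add: algebra_simps)
  finally have \<beta>': "2 * r * \<beta> = q * \<delta>" .
  have "2 * r * a = (2 * r * \<beta>) * n2 - (2 * r * \<alpha>) * n1" unfolding an by (simp add: algebra_simps)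
  also have "\<dots> = \<delta> * (2 * A)" unfolding \<alpha>' \<beta>' AC by (simp add: algebra_simps)
  finally have a: "r * a = \<delta> * A" by simp
  have "2 * r * c = (2 * r * \<beta>) * d2 - (2 * r * \<alpha>) * d1" unfolding cn by (simp add: algebra_simps)
  also have "\<dots> = \<delta> * (2 * C)" unfolding \<alpha>' \<beta>' AC by (simp add: algebra_simps)
  finally have c: "r * c = \<delta> * C" by simp
  have "2 * r * b = (x + 1) * ((2 * r * \<alpha>) * n1) - (x - 1) * ((2 * r * \<beta>) * n2)"
    unfolding bn by (simp add: algebra_simps)
  also have "\<dots> = \<delta> * (2 * B)" unfolding \<alpha>' \<beta>' BE by (simp add: algebra_simps)
  finally have b: "r * b = \<delta> * B" by simp
  have "2 * r * d = (x + 1) * ((2 * r * \<alpha>) * d1) - (x - 1) * ((2 * r * \<beta>) * d2)"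
    unfolding dn by (simp add: algebra_simps)
  also have "\<dots> = \<delta> * (2 * E)" unfolding \<alpha>' \<beta>' BE by (simp add: algebra_simps)
  finally have d: "r * d = \<delta> * E" by simp
  have r: "r \<noteq> 0" using nz[OF D(3)] unfolding r_def .
  have "p * q * \<delta> = (p * n1) * (q * d2) - (q * n2) * (p * d1)" unfolding \<delta>n by (simp add: algebra_simps)
  also have "\<dots> = 2 * (B * C - A * E)" unfolding e1[symmetric] e2[symmetric] by (simp add: algebra_simps)
  finally have "\<delta> \<noteq> 0" using det by auto
  have "r * r * (a * d - b * c) = (r * a) * (r * d) - (r * b) * (r * c)" by (simp add: algebra_simps)
  also have "\<dots> = \<delta> * \<delta> * (A * E - B * C)" unfolding a b c d by (simp add: algebra_simps)
  finally show "a * d \<noteq> b * c" using r \<open>\<delta> \<noteq> 0\<close> det by auto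
  have "r * (N u * (c * u + d)) = N u * ((r * c) * u + r * d)" by (simp add: algebra_simps)
  also have "\<dots> = \<delta> * (N u * (C * u + E))" unfolding c d by (simp add: algebra_simps)
  also have "\<dots> = D u * ((r * a) * u + r * b)" unfolding m a b by (simp add: algebra_simps)
  also have "\<dots> = r * (D u * (a * u + b))" by (simp add: algebra_simps)
  finally show "N u * (c * u + d) = D u * (a * u + b)" using r by (metis mult_left_cancel)
qed

text \<open>
  For fixed generic \<open>t\<close> the map \<open>u \<mapsto> X / w\<close> between fibres is injective, since a birational map has an
  inverse; so it is a Moebius transformation.  Interpolation at three constant values of \<open>u\<close> produces
  a matrix that depends polynomially on \<open>t\<close>.
\<close>

lemma acts_exists:
  assumes \<tau>: "\<tau> \<in> carrier (Bir S)" "F \<in> \<tau>"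
    and base: "\<And>t u. F (Psi t u) $ 4 = s * t * F (Psi t u) $ 1"
  obtains a b c d where "acts s a b c d F" "a * d \<noteq> b * c"
proof -
  have F: "dominant S S F" using S.Bir_rep[OF \<tau>] by blast
  obtain G where G: "G \<in> inv\<^sub>S \<tau>" "dominant S S G"
    by (rule S.Bir_obtain_rep[OF Bir_S.inv_closed[OF \<tau>(1)]])
  have "G \<circ> F \<in> inv\<^sub>S \<tau> \<cdot> \<tau>" using S.Bir_mult_rep G \<tau> by blast
  then have GF: "rat_rep S S (G \<circ> F)" "rat_eq S (G \<circ> F) id" using \<tau>(1) S.Bir_one_rep by auto
  obtain e where e: "form_map e F" using F dominant_rep rat_repE by metis
  obtain e' where e': "form_map e' G" using G dominant_rep rat_repE by metis
  define N where "N t u = Xc (F (Psi t u))" for t u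
  define D where "D t u = F (Psi t u) $ 1" for t u
  have bN: "biv N" and bD: "biv D" unfolding N_def D_def using biv_form_map[OF e] by auto
  have good: "generically (\<lambda>t u. u \<noteq> 0 \<and> D t u \<noteq> 0 \<and> N t u \<noteq> 0 \<and> G (F (Psi t u)) \<noteq> 0)"
    using generically_conj[OF generically_coord[OF F] generic_Psi[OF S.generic_rep[OF GF(1)]]]
    by (rule generically_mono) (auto simp: N_def D_def)
  have moeb: "\<forall>\<^sub>F t in cofinite. \<exists>A B C E. A * E \<noteq> B * C \<and> (\<forall>u. N t u * (C * u + E) = D t u * (A * u + B))"
    using good
  proof eventually_elim
    case (elim t)
    obtain NP where NP: "\<And>u. N t u = poly NP u" using bN unfolding biv_def polyfun_def by metis
    obtain DP where DP: "\<And>u. D t u = poly DP u" using bD unfolding biv_def polyfun_def by metis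
    define Bad where "Bad = {u. \<not> (u \<noteq> 0 \<and> D t u \<noteq> 0 \<and> N t u \<noteq> 0 \<and> G (F (Psi t u)) \<noteq> 0)}"
    have "finite Bad" using elim unfolding Bad_def eventually_cofinite .
    moreover have "DP \<noteq> 0" using cofinite_ex[OF elim] DP by auto
    moreover have "inj_on (\<lambda>u. poly NP u / poly DP u) (- Bad)"
    proof (rule inj_onI)
      fix u u' assume u: "u \<in> - Bad" "u' \<in> - Bad" and eq: "poly NP u / poly DP u = poly NP u' / poly DP u'"
      have nz: "u \<noteq> 0" "D t u \<noteq> 0" "G (F (Psi t u)) \<noteq> 0" "u' \<noteq> 0" "D t u' \<noteq> 0" "N t u' \<noteq> 0" "G (F (Psi t u')) \<noteq> 0"
        using u unfolding Bad_def by auto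
      have inS: "F (Psi t u) \<in> S" for u using F dominant_rep rat_rep_in Psi_in_S by blast
      have "N t u * D t u' = N t u' * D t u" using eq nz unfolding NP[symmetric] DP[symmetric]
        by (simp add: field_simps)
      then have "parallel (F (Psi t u)) (F (Psi t u'))"
        by (intro S_parallelI inS) (use nz base in \<open>simp_all add: N_def D_def\<close>)
      moreover have "F (Psi t u) \<noteq> 0" "F (Psi t u') \<noteq> 0" using nz unfolding D_def by auto
      ultimately obtain k where "F (Psi t u) = k *s F (Psi t u')" using parallel_multiple by metis
      then have "parallel (G (F (Psi t u))) (G (F (Psi t u')))" by (simp add: form_map_homogeneous[OF e'])
      moreover have "parallel (G (F (Psi t u))) (Psi t u)" for u
        using GF(2) unfolding rat_eq_parallel by simp
      ultimately have "parallel (Psi t u) (Psi t u')" using nz parallel_trans parallel_sym by meson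
      from parallel_coords(2)[OF this] have "u * (u * u') = u' * (u * u')"
        by (simp add: power2_eq_square algebra_simps)
      then show "u = u'" using nz by simp
    qed
    ultimately obtain A B C E where M: "A * E \<noteq> B * C" "NP * [:E, C:] = DP * [:B, A:]"
      using moebius_if_injective[of Bad DP NP] by metis
    have "N t u * (C * u + E) = D t u * (A * u + B)" for u
      using arg_cong[OF M(2), of "\<lambda>p. poly p u"] unfolding NP DP by (simp add: algebra_simps)
    then show ?case using M(1) by blast
  qed
  obtain t0 u0 where t0: "D t0 u0 \<noteq> 0" using generically_ex[OF good] by blast
  have D0: "polyfun (D t0)" using bD unfolding biv_def by blast
  have "\<forall>\<^sub>F x in cofinite. D t0 (x + k) \<noteq> 0" for k
    by (rule polyfun_nonzero[of _ "u0 - k"]) (use t0 polyfun_compose[OF D0 polyfun_add[OF polyfun_ident polyfun_const]] in auto)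
  from this[of "-1"] this[of 1] this[of 0]
  have "\<forall>\<^sub>F x in cofinite. D t0 (x - 1) \<noteq> 0 \<and> D t0 (x + 1) \<noteq> 0 \<and> D t0 x \<noteq> 0"
    by eventually_elim simp
  then obtain x where x: "D t0 (x - 1) \<noteq> 0" "D t0 (x + 1) \<noteq> 0" "D t0 x \<noteq> 0" using cofinite_ex by blast
  have Du: "polyfun (\<lambda>t. D t u)" and Nu: "polyfun (\<lambda>t. N t u)" for u
    using bN bD unfolding biv_def by auto
  have xt: "\<forall>\<^sub>F t in cofinite. D t (x - 1) \<noteq> 0" "\<forall>\<^sub>F t in cofinite. D t (x + 1) \<noteq> 0"
    "\<forall>\<^sub>F t in cofinite. D t x \<noteq> 0"
    using x by (auto intro: polyfun_nonzero[OF Du])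
  obtain n1 where n1: "\<And>t. N t (x - 1) = poly n1 t" using Nu unfolding polyfun_def by metis
  obtain n2 where n2: "\<And>t. N t (x + 1) = poly n2 t" using Nu unfolding polyfun_def by metis
  obtain n3 where n3: "\<And>t. N t x = poly n3 t" using Nu unfolding polyfun_def by metis
  obtain d1 where d1: "\<And>t. D t (x - 1) = poly d1 t" using Du unfolding polyfun_def by metis
  obtain d2 where d2: "\<And>t. D t (x + 1) = poly d2 t" using Du unfolding polyfun_def by metis
  obtain d3 where d3: "\<And>t. D t x = poly d3 t" using Du unfolding polyfun_def by metis
  define \<alpha> \<beta> where "\<alpha> = n3 * d2 - n2 * d3" and "\<beta> = n1 * d3 - n3 * d1"
  define a b c d where "a = \<beta> * n2 - \<alpha> * n1" and "b = [:x + 1:] * (\<alpha> * n1) - [:x - 1:] * (\<beta> * n2)"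
    and "c = \<beta> * d2 - \<alpha> * d1" and "d = [:x + 1:] * (\<alpha> * d1) - [:x - 1:] * (\<beta> * d2)"
  have gen: "\<forall>\<^sub>F t in cofinite. poly a t * poly d t \<noteq> poly b t * poly c t \<and>
     (\<forall>u. N t u * (poly c t * u + poly d t) = D t u * (poly a t * u + poly b t))"
    using moeb xt
  proof eventually_elim
    case (elim t)
    then obtain A B C E where M: "A * E \<noteq> B * C" "\<And>u. N t u * (C * u + E) = D t u * (A * u + B)" by blast
    note int = moebius_interpolation[OF M elim(2-4) refl refl, unfolded n1 n2 n3 d1 d2 d3]
    show ?case
      using int(1) int(2)[of _] unfolding a_def b_def c_def d_def \<alpha>_def \<beta>_def by simp
  qed
  have "acts s a b c d F" unfolding acts_def
  proof (intro allI conjI)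
    fix t u
    show "F (Psi t u) $ 4 = s * t * F (Psi t u) $ 1" by (rule base)
    have "N t u * (poly c t * u + poly d t) = D t u * (poly a t * u + poly b t)"
    proof (rule biv_eq[where f = "\<lambda>t u. N t u * (poly c t * u + poly d t)"])
      show "generically (\<lambda>t u. N t u * (poly c t * u + poly d t) = D t u * (poly a t * u + poly b t))"
        using gen by eventually_elim simp
    qed (rule biv_intros(3), (rule bN bD | rule biv_linear)+)+
    then show "Xc (F (Psi t u)) * (poly c t * u + poly d t) = F (Psi t u) $ 1 * (poly a t * u + poly b t)"
      unfolding N_def D_def .
  qed
  moreover have "a * d \<noteq> b * c"
    using cofinite_ex[OF gen] by (metis poly_mult)
  ultimately show ?thesis using that by blast
qed

section \<open>An invariant section\<close>

text \<open>
  The roots of an even polynomial come in pairs \<open>r\<close>, \<open>-r\<close>, and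
  \<open>(t - r) (t + r) = (i (t - r)) (i (-t - r))\<close>.
\<close>

lemma even_poly_factor:
  fixes L :: "complex poly"
  assumes "pcompose L [:0, -1:] = L"
  shows "\<exists>\<nu>. L = \<nu> * pcompose \<nu> [:0, -1:]"
  using assms
proof (induction "degree L" arbitrary: L rule: less_induct)
  case less
  have even: "poly L (- t) = poly L t" for t
    using arg_cong[OF less.prems, of "\<lambda>p. poly p t"] by (simp add: poly_pcompose)
  show ?case
  proof (cases "degree L = 0")
    case True
    then obtain k where "L = [:k:]" by (rule degree_eq_zeroE)
    then show ?thesis by (intro exI[of _ "[:csqrt k:]"]) (simp add: pcompose_const, metis power2_csqrt power2_eq_square)
  next
    case False
    then obtain r where r: "poly L r = 0"
      using fundamental_theorem_of_algebra[of L] constant_degree[of L] by auto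
    then obtain q where q: "L = [:- r, 1:] * q" unfolding poly_eq_0_iff_dvd by (rule dvdE)
    have q_eq: "(t - r) * poly q t = (- t - r) * poly q (- t)" for t
      using even[of t] unfolding q by (simp add: algebra_simps)
    have "poly q (- r) = 0"
    proof (cases "r = 0")
      case True
      have "\<forall>\<^sub>F t in cofinite. poly q t + poly q (- t) = 0"
      proof -
        have "finite {t :: complex. \<not> t \<noteq> 0}" by simp
        then have "\<forall>\<^sub>F t :: complex in cofinite. t \<noteq> 0" unfolding eventually_cofinite .
        then show ?thesis
        proof eventually_elim
          case (elim t)
          have "t * (poly q t + poly q (- t)) = 0" using q_eq[of t] True by (simp add: algebra_simps)
          then show ?case using elim by simp
        qed
      qed
      moreover have "polyfun (\<lambda>t. poly q t + poly q (- t))"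
        by (rule polyfun_add[OF polyfun_poly polyfun_compose[OF polyfun_poly polyfun_minus[OF polyfun_ident]]])
      ultimately have "poly q 0 + poly q (- 0) = 0"
        by (intro polyfun_zero[of "\<lambda>t. poly q t + poly q (- t)"] eventually_frequently
          cofinite_complex_neq_bot)
      then show ?thesis using True by simp
    next
      case False
      then show ?thesis using q_eq[of r] by simp
    qed
    then obtain q' where q': "q = [:r, 1:] * q'" unfolding poly_eq_0_iff_dvd by (auto elim: dvdE)
    have L: "L = [:- r, 1:] * [:r, 1:] * q'" unfolding q q' by (simp only: mult.assoc)
    have "L \<noteq> 0" using False by auto
    then have "q' \<noteq> 0" unfolding L by auto
    have l: "pcompose [:- r, 1:] [:0, -1:] = - [:r, 1:]" "pcompose [:r, 1:] [:0, -1:] = - [:- r, 1:]"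
      by (simp_all add: pcompose_pCons)
    have "[:- r, 1:] * [:r, 1:] * pcompose q' [:0, -1:] = [:- r, 1:] * [:r, 1:] * q'"
      using less.prems unfolding L pcompose_mult l by (simp only: mult_ac minus_mult_minus)
    then have "pcompose q' [:0, -1:] = q'"
      by (metis mult_left_cancel mult_eq_0_iff \<open>L \<noteq> 0\<close> L)
    moreover have "degree q' < degree L"
      using \<open>q' \<noteq> 0\<close> unfolding L by (simp add: degree_mult_eq del: mult_pCons_left mult_pCons_right)
    ultimately obtain \<nu> where \<nu>: "q' = \<nu> * pcompose \<nu> [:0, -1:]" using less.hyps by blast
    have "L = ([:\<i>:] * [:- r, 1:] * \<nu>) * pcompose ([:\<i>:] * [:- r, 1:] * \<nu>) [:0, -1:]"
    proof -
      have ring: "(k * x * m) * (k * (- y) * m') = - (k * k) * (x * y * (m * m'))"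
        for k x y m m' :: "complex poly"
        by (simp add: algebra_simps)
      have "([:\<i>:] * [:- r, 1:] * \<nu>) * pcompose ([:\<i>:] * [:- r, 1:] * \<nu>) [:0, -1:]
         = - ([:\<i>:] * [:\<i>:]) * ([:- r, 1:] * [:r, 1:] * (\<nu> * pcompose \<nu> [:0, -1:]))"
        unfolding pcompose_mult l pcompose_const by (rule ring)
      also have "\<dots> = L" unfolding \<nu>[symmetric] L[symmetric] by simp
      finally show ?thesis ..
    qed
    then show ?thesis by blast
  qed
qed

lemma pcompose_flip_flip: "pcompose (pcompose p [:0, -1:]) [:0, -1:] = (p :: complex poly)"
  by (rule poly_eq_fun) (simp add: poly_pcompose)

text \<open>
  Hilbert's Theorem 90.  The hypotheses say \<open>M(-t) M(t) = \<lambda>(t)\<close> for the matrix \<open>M\<close> with rows \<open>(a, b)\<close>,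
  \<open>(c, d)\<close>.  Comparing traces, \<open>\<lambda>\<close> is even, so \<open>\<lambda>(t) = \<nu>(t) \<nu>(-t)\<close>.  For any vector \<open>e\<close> the vector
  \<open>v(t) = \<nu>(-t) e + M(-t) e\<close> satisfies \<open>M(t) v(t) = \<nu>(-t) v(-t)\<close>; here \<open>e = (1, 0)\<close>.
\<close>

lemma invariant_section:
  fixes a b c d :: "complex poly"
  defines "neg \<equiv> \<lambda>p. pcompose p [:0, -1:]"
  assumes 1: "neg a * a + neg b * c = L" "neg a * b + neg b * d = 0"
    "neg c * a + neg d * c = 0" "neg c * b + neg d * d = L"
  obtains v1 v2 where "v1 \<noteq> 0 \<or> v2 \<noteq> 0" "(a * v1 + b * v2) * neg v2 = (c * v1 + d * v2) * neg v1"
proof -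
  have neg: "neg (neg p) = p" "neg (p * q) = neg p * neg q" "neg (p + q) = neg p + neg q" for p q
    unfolding neg_def by (simp_all add: pcompose_flip_flip pcompose_mult pcompose_add)
  have 2: "neg L = a * neg a + b * neg c" "c * neg a + d * neg c = 0" "neg L = c * neg b + d * neg d"
    using arg_cong[OF 1(1), of neg] arg_cong[OF 1(3), of neg] arg_cong[OF 1(4), of neg]
    unfolding neg by (simp_all add: neg_def)
  have "2 * neg L = (a * neg a + b * neg c) + (c * neg b + d * neg d)"
    unfolding 2(1)[symmetric] 2(3)[symmetric] by simp
  also have "\<dots> = (neg a * a + neg b * c) + (neg c * b + neg d * d)" by (simp add: algebra_simps)
  also have "\<dots> = 2 * L" unfolding 1 by simp
  finally have "neg L = L" by simp
  then obtain \<nu> where \<nu>: "L = \<nu> * neg \<nu>" using even_poly_factor[of L] unfolding neg_def by blast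
  show ?thesis
  proof (cases "c = 0")
    case True
    \<comment> \<open>then the section \<open>u = \<infinity>\<close> is already invariant\<close>
    show ?thesis by (rule that[of 1 0]) (simp_all add: True neg_def)
  next
    case False
    have "neg (neg c) \<noteq> 0" unfolding neg using False .
    then have "neg c \<noteq> 0" by (auto simp: neg_def)
    moreover have "a * (neg \<nu> + neg a) + b * neg c = neg \<nu> * (\<nu> + a)"
    proof -
      have "a * (neg \<nu> + neg a) + b * neg c = a * neg \<nu> + neg L" unfolding 2 by (simp add: algebra_simps)
      also have "neg L = \<nu> * neg \<nu>" using \<open>neg L = L\<close> \<nu> by simp
      finally show ?thesis by (simp add: algebra_simps)
    qed
    moreover have "c * (neg \<nu> + neg a) + d * neg c = neg \<nu> * c"
    proof -
      have "c * (neg \<nu> + neg a) + d * neg c = c * neg \<nu> + (c * neg a + d * neg c)" by (simp add: algebra_simps)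
      then show ?thesis unfolding 2 by (simp add: mult.commute)
    qed
    ultimately show ?thesis
      by (intro that[of "neg \<nu> + neg a" "neg c"]) (simp_all add: neg mult_ac)
  qed
qed

section \<open>Rotations of the fibres\<close>

abbreviation cpoly :: "real poly \<Rightarrow> complex poly" where "cpoly \<equiv> map_poly of_real"

lemma poly_cpoly [simp]: "poly (cpoly p) (of_real t) = of_real (poly p t)"
  by (induction p) (simp_all add: map_poly_pCons)

definition RE :: "complex poly \<Rightarrow> real poly" where "RE = map_poly Re"
definition IM :: "complex poly \<Rightarrow> real poly" where "IM = map_poly Im"

lemma poly_RE_IM:
  "poly p (of_real t) = of_real (poly (RE p) t) + \<i> * of_real (poly (IM p) t)"
  unfolding RE_def IM_def
  by (induction p) (auto simp: map_poly_pCons algebra_simps complex_eq_iff)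

lemma RE_IM: "p = cpoly (RE p) + [:\<i>:] * cpoly (IM p)"
  by (rule poly_eq_on_reals) (subst poly_RE_IM, simp)

lemma cpoly_0_iff: "cpoly p = 0 \<longleftrightarrow> p = 0"
  by (rule map_poly_eq_0_iff) auto

text \<open>
  The form \<open>w\<^sup>n p(z / w)\<close>.
\<close>

definition homog :: "nat \<Rightarrow> real poly \<Rightarrow> complex ^ 4 \<Rightarrow> complex" where
  "homog n p v = (\<Sum>k\<le>n. of_real (coeff p k) * (v $ 1 ^ (n - k) * v $ 4 ^ k))"

lemma real_form_homog: "real_form n (homog n p)"
proof -
  have "real_form n (\<lambda>v :: complex ^ 4. of_real (coeff p k) * (v $ 1 ^ (n - k) * v $ 4 ^ k))" if "k \<le> n" for k
  proof -
    have "real_form ((n - k) * 1 + k * 1) (\<lambda>v :: complex ^ 4. v $ 1 ^ (n - k) * v $ 4 ^ k)"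
      by (intro real_form_mult real_form_power real_form_coord)
    then show ?thesis using that by (intro real_form_scale) simp
  qed
  then show ?thesis unfolding homog_def[abs_def] by (intro real_form_sum) auto
qed

lemma homog_eq:
  assumes "degree p \<le> n" "v $ 4 = t * v $ 1"
  shows "homog n p v = (v $ 1) ^ n * poly (cpoly p) t"
proof -
  have "poly (cpoly p) t = (\<Sum>k\<le>n. of_real (coeff p k) * t ^ k)"
    unfolding poly_altdef
    by (rule sum.mono_neutral_cong_left)
      (use assms(1) in \<open>auto simp: coeff_map_poly coeff_eq_0 degree_map_poly\<close>)
  moreover have "homog n p v = (\<Sum>k\<le>n. (v $ 1) ^ n * (of_real (coeff p k) * t ^ k))"
    unfolding homog_def
  proof (rule sum.cong)
    fix k assume "k \<in> {..n}"
    then have "v $ 1 ^ n = v $ 1 ^ (n - k) * v $ 1 ^ k" by (simp flip: power_add)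
    then show "of_real (coeff p k) * (v $ 1 ^ (n - k) * v $ 4 ^ k) = v $ 1 ^ n * (of_real (coeff p k) * t ^ k)"
      unfolding assms(2) by (simp add: power_mult_distrib)
  qed simp
  ultimately show ?thesis by (simp add: sum_distrib_left)
qed

text \<open>
  The circle over \<open>t\<close> is turned by the angle whose cosine and sine are \<open>P / N\<close> and \<open>Q / N\<close>; these may
  depend on the point of the circle.  The sign \<open>s\<close> tells whether \<open>t\<close> is kept or reversed.
\<close>

definition twist ::
  "(complex ^ 4 \<Rightarrow> complex) \<Rightarrow> (complex ^ 4 \<Rightarrow> complex) \<Rightarrow> (complex ^ 4 \<Rightarrow> complex) \<Rightarrow> real
    \<Rightarrow> complex ^ 4 \<Rightarrow> complex ^ 4" where
  "twist N P Q s v = vector [N v * v $ 1, P v * v $ 2 - Q v * v $ 3, Q v * v $ 2 + P v * v $ 3,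
     of_real s * (N v * v $ 4)]"

lemma twist_simps [simp]:
  "twist N P Q s v $ 1 = N v * v $ 1" "twist N P Q s v $ 4 = of_real s * (N v * v $ 4)"
  "Xc (twist N P Q s v) = (P v + \<i> * Q v) * Xc v" "Yc (twist N P Q s v) = (P v - \<i> * Q v) * Yc v"
  unfolding twist_def Xc_def Yc_def by (simp_all add: algebra_simps)

lemma form_map_twist:
  assumes "real_form k N" "real_form k P" "real_form k Q"
  shows "form_map (k + 1) (twist N P Q s)"
  unfolding twist_def
  by (rule form_map_4)
    (intro real_form_mult real_form_add real_form_diff real_form_scale real_form_coord assms)+

lemma twist_in_S:
  assumes "v \<in> S" "(P v)\<^sup>2 + (Q v)\<^sup>2 = (N v)\<^sup>2" "s\<^sup>2 = 1"
  shows "twist N P Q s v \<in> S"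
proof -
  have "(of_real s)\<^sup>2 = (1 :: complex)" using assms(3) by (simp flip: of_real_power)
  have "Xc (twist N P Q s v) * Yc (twist N P Q s v) = ((P v)\<^sup>2 + (Q v)\<^sup>2) * (Xc v * Yc v)"
    by (simp add: algebra_simps power2_eq_square)
  also have "\<dots> = (N v)\<^sup>2 * ((v $ 1)\<^sup>2 - (v $ 4)\<^sup>2)" using assms(1,2) unfolding S_iff by simp
  also have "\<dots> = (twist N P Q s v $ 1)\<^sup>2 - (twist N P Q s v $ 4)\<^sup>2"
    using \<open>(of_real s)\<^sup>2 = 1\<close> by (simp add: power_mult_distrib algebra_simps)
  finally show ?thesis unfolding S_iff .
qed

section \<open>The involution attached to a section\<close>

text \<open>
  The section is \<open>u = i A / (B + i C)\<close>.  That its numerator is purely imaginary is a normalisation which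
  makes \<open>\<phi>\<close> an involution.
\<close>

locale section_involution =
  fixes A B C :: "real poly"
  assumes nonzero: "A \<noteq> 0 \<or> B \<noteq> 0 \<or> C \<noteq> 0"
begin

definition n where "n = max (degree A) (max (degree B) (degree C))"

text \<open>
  Real and imaginary part of the linear form \<open>E\<close> below.
\<close>

definition ea where "ea v = homog n C v * v $ 3 - homog n B v * v $ 2"
definition eb where "eb v = homog n A v * v $ 1 - homog n B v * v $ 3 - homog n C v * v $ 2"

definition \<phi> where
  "\<phi> = twist (\<lambda>v. (ea v)\<^sup>2 + (eb v)\<^sup>2) (\<lambda>v. (ea v)\<^sup>2 - (eb v)\<^sup>2) (\<lambda>v. - (2 * (ea v * eb v))) 1"

text \<open>
  \<open>E\<close> vanishes on the section and \<open>E'\<close> is its complex conjugate; in these terms \<open>\<phi>\<close> is \<open>X \<mapsto> X E' / E\<close>.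
\<close>

definition E where "E v = \<i> * homog n A v * v $ 1 - (homog n B v + \<i> * homog n C v) * Xc v"
definition E' where "E' v = - \<i> * homog n A v * v $ 1 - (homog n B v - \<i> * homog n C v) * Yc v"

lemma E_eq: "E v = ea v + \<i> * eb v" "E' v = ea v - \<i> * eb v"
  unfolding E_def E'_def ea_def eb_def Xc_def Yc_def by (simp_all add: algebra_simps)

lemma EE: "(ea v)\<^sup>2 + (eb v)\<^sup>2 = E v * E' v"
  unfolding E_eq by (simp add: algebra_simps power2_eq_square)

lemma \<phi>_simps [simp]:
  "\<phi> v $ 1 = E v * E' v * v $ 1" "\<phi> v $ 4 = E v * E' v * v $ 4"
  "Xc (\<phi> v) = (E' v)\<^sup>2 * Xc v" "Yc (\<phi> v) = (E v)\<^sup>2 * Yc v"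
  unfolding \<phi>_def by (simp_all add: EE) (simp_all add: E_eq algebra_simps power2_eq_square)

lemma \<phi>_in_S: "v \<in> S \<Longrightarrow> \<phi> v \<in> S"
  unfolding \<phi>_def by (rule twist_in_S) (auto simp: algebra_simps power2_eq_square)

lemma form_e: "real_form (n + 1) ea" "real_form (n + 1) eb"
  unfolding ea_def[abs_def] eb_def[abs_def]
  by (intro real_form_diff real_form_mult real_form_homog real_form_coord)+

lemma form_map_\<phi>: "form_map (2 * (n + 1) + 1) \<phi>"
  unfolding \<phi>_def
proof (rule form_map_twist)
  have "real_form ((n + 1) + (n + 1)) (\<lambda>v. ea v * eb v)"
    by (rule real_form_mult[OF form_e])
  then have "real_form (2 * (n + 1)) (\<lambda>v. 2 * (ea v * eb v))"
    using real_form_numeral by (metis mult_2)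
  then show "real_form (2 * (n + 1)) (\<lambda>v. - (2 * (ea v * eb v)))" by (rule real_form_minus)
qed (intro real_form_add real_form_diff real_form_power form_e)+

definition \<Delta> where
  "\<Delta> v = - (homog n A v)\<^sup>2 * (v $ 1)\<^sup>2 + ((homog n B v)\<^sup>2 + (homog n C v)\<^sup>2) * (Xc v * Yc v)"

lemma homog_\<phi>: "homog n p (\<phi> v) = (E v * E' v) ^ n * homog n p v"
proof -
  have "homog n p (\<phi> v) = homog n p ((E v * E' v) *s v)" unfolding homog_def by simp
  then show ?thesis using real_form_homogeneous[OF real_form_homog] by simp
qed

text \<open>
  Up to the common factor of the homogeneous coordinates, \<open>\<phi>\<close> replaces \<open>E\<close> by \<open>\<Delta> / E\<close> and \<open>E'\<close> by
  \<open>\<Delta> / E'\<close>, so it inverts the factor \<open>E' / E\<close>: this is why \<open>\<phi>\<close> is an involution.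
\<close>

lemma E_\<phi>: "E (\<phi> v) = (E v * E' v) ^ n * (E' v * \<Delta> v)" "E' (\<phi> v) = (E v * E' v) ^ n * (E v * \<Delta> v)"
proof -
  define a b c where abc: "a = homog n A v" "b = homog n B v" "c = homog n C v"
  define w X Y where wXY: "w = v $ 1" "X = Xc v" "Y = Yc v"
  have "\<i> * a * (E v * w) - (b + \<i> * c) * (E' v * X) = \<Delta> v"
    "- \<i> * a * (E' v * w) - (b - \<i> * c) * (E v * Y) = \<Delta> v"
    unfolding E_def E'_def \<Delta>_def abc[symmetric] wXY[symmetric]
    by (simp_all add: algebra_simps power2_eq_square)
  note 1 = this
  have "E (\<phi> v) = (E v * E' v) ^ n * (E' v * (\<i> * a * (E v * w) - (b + \<i> * c) * (E' v * X)))"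
    unfolding E_def[of "\<phi> v"] homog_\<phi> \<phi>_simps abc wXY by (simp add: algebra_simps power2_eq_square)
  then show "E (\<phi> v) = (E v * E' v) ^ n * (E' v * \<Delta> v)" unfolding 1 .
  have "E' (\<phi> v) = (E v * E' v) ^ n * (E v * (- \<i> * a * (E' v * w) - (b - \<i> * c) * (E v * Y)))"
    unfolding E'_def[of "\<phi> v"] homog_\<phi> \<phi>_simps abc wXY by (simp add: algebra_simps power2_eq_square)
  then show "E' (\<phi> v) = (E v * E' v) ^ n * (E v * \<Delta> v)" unfolding 1 .
qed

lemma \<phi>_\<phi>: "\<phi> (\<phi> v) = (((E v * E' v) ^ n)\<^sup>2 * (E v * E' v)\<^sup>2 * (\<Delta> v)\<^sup>2) *s v"
  unfolding vec_eq_XY \<phi>_simps E_\<phi>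
  by (simp add: power2_eq_square mult_ac)

lemma poly_nonzero_point:
  obtains t :: real where "t > 1" "poly A t \<noteq> 0 \<or> poly B t \<noteq> 0 \<or> poly C t \<noteq> 0"
proof -
  obtain P where P: "P \<noteq> 0" "P \<in> {A, B, C}" using nonzero by auto
  have "infinite {1<..<(2::real)}" by (rule infinite_Ioo) simp
  moreover have "finite {t. poly P t = 0}" using P poly_roots_finite by blast
  ultimately obtain t where "t \<in> {1<..<2}" "poly P t \<noteq> 0"
    by (metis (mono_tags, lifting) finite_subset mem_Collect_eq subsetI)
  then show ?thesis using that[of t] P(2) by auto
qed

text \<open>
  There are no real points over a real \<open>t > 1\<close>; accordingly \<open>\<Delta>\<close>, as a quadratic form in \<open>A\<close>, \<open>B\<close>, \<open>C\<close>, is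
  definite there, and \<open>\<phi>\<close> cannot degenerate.
\<close>

lemma det_pos:
  assumes "t > 1" "poly A t \<noteq> 0 \<or> poly B t \<noteq> 0 \<or> poly C t \<noteq> 0"
  shows "(poly A t)\<^sup>2 + (t\<^sup>2 - 1) * ((poly B t)\<^sup>2 + (poly C t)\<^sup>2) > 0"
proof -
  have t: "t\<^sup>2 - 1 > 0" using assms(1) by simp
  show ?thesis
  proof (cases "poly A t = 0")
    case True
    then have "(poly B t)\<^sup>2 + (poly C t)\<^sup>2 > 0" using assms(2) by (metis sum_power2_gt_zero_iff)
    then show ?thesis using t True by simp
  next
    case False
    then have "(poly A t)\<^sup>2 > 0" by simp
    moreover have "(t\<^sup>2 - 1) * ((poly B t)\<^sup>2 + (poly C t)\<^sup>2) \<ge> 0" using t by simp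
    ultimately show ?thesis by linarith
  qed
qed

lemma degrees: "degree A \<le> n" "degree B \<le> n" "degree C \<le> n"
  unfolding n_def by auto

lemma homog_Psi: "degree p \<le> n \<Longrightarrow> homog n p (Psi t u) = u ^ n * poly (cpoly p) t"
  by (subst homog_eq[of _ _ _ t]) auto

lemma E_Psi:
  "E (Psi t u) = u ^ n * u * (\<i> * poly (cpoly A) t - (poly (cpoly B) t + \<i> * poly (cpoly C) t) * u)"
  "E' (Psi t u) = u ^ n * (- \<i> * poly (cpoly A) t * u - (poly (cpoly B) t - \<i> * poly (cpoly C) t) * (1 - t\<^sup>2))"
  unfolding E_def E'_def using degrees by (simp_all add: homog_Psi algebra_simps power2_eq_square)

lemma \<phi>_nonzero: "\<exists>v\<in>S. \<phi> (\<phi> v) \<noteq> 0"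
proof -
  obtain t where t: "t > 1" "poly A t \<noteq> 0 \<or> poly B t \<noteq> 0 \<or> poly C t \<noteq> 0" by (rule poly_nonzero_point)
  define a b c where abc: "a = complex_of_real (poly A t)" "b = complex_of_real (poly B t)"
    "c = complex_of_real (poly C t)"
  have t2: "1 - (of_real t)\<^sup>2 \<noteq> (0 :: complex)"
  proof -
    have "1 - t\<^sup>2 \<noteq> 0" using t(1) by (simp add: power2_eq_1_iff)
    then have "complex_of_real (1 - t\<^sup>2) \<noteq> 0" unfolding of_real_eq_0_iff .
    then show ?thesis by simp
  qed
  have bc: "b + \<i> * c = 0 \<Longrightarrow> b = 0 \<and> c = 0" "b - \<i> * c = 0 \<Longrightarrow> b = 0 \<and> c = 0"
    unfolding abc by (auto simp: complex_eq_iff)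
  define p where "p = [:\<i> * a, - (b + \<i> * c):]"
  define q where "q = [:- (b - \<i> * c) * (1 - (of_real t)\<^sup>2), - \<i> * a:]"
  have "p \<noteq> 0" "q \<noteq> 0" using t(2) bc t2 unfolding p_def q_def abc by (auto simp: complex_eq_iff)
  then have "finite {u. poly (p * q) u = 0}" by (intro poly_roots_finite) simp
  then have "\<forall>\<^sub>F u in cofinite. poly (p * q) u \<noteq> 0" unfolding eventually_cofinite by simp
  moreover have "\<forall>\<^sub>F u :: complex in cofinite. u \<noteq> 0" unfolding eventually_cofinite by simp
  ultimately have "\<forall>\<^sub>F u in cofinite. poly (p * q) u \<noteq> 0 \<and> u \<noteq> 0" by (rule eventually_conj)
  then obtain u where u: "poly p u \<noteq> 0" "poly q u \<noteq> 0" "u \<noteq> 0" using cofinite_ex by fastforce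
  let ?v = "Psi (of_real t) u"
  have E: "E ?v = u ^ n * u * poly p u" "E' ?v = u ^ n * poly q u"
    unfolding E_Psi p_def q_def abc by (simp_all add: algebra_simps)
  have "\<Delta> ?v = - ((u ^ n)\<^sup>2 * u\<^sup>2 * of_real ((poly A t)\<^sup>2 + (t\<^sup>2 - 1) * ((poly B t)\<^sup>2 + (poly C t)\<^sup>2)))"
    unfolding \<Delta>_def using degrees by (simp add: homog_Psi power_mult_distrib algebra_simps)
  then have "\<Delta> ?v \<noteq> 0" using u(3) det_pos[OF t] by (simp del: of_real_add of_real_mult of_real_diff of_real_power)
  then have "\<phi> (\<phi> ?v) $ 1 \<noteq> 0" unfolding \<phi>_\<phi> E using u by simp
  then have "\<phi> (\<phi> ?v) \<noteq> 0" by (metis zero_index)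
  then show ?thesis using Psi_in_S by blast
qed

lemma rat_rep_\<phi>: "rat_rep S S \<phi>"
proof -
  obtain v where v: "v \<in> S" "\<phi> (\<phi> v) \<noteq> 0" using \<phi>_nonzero by blast
  then show ?thesis using rat_repI[OF form_map_\<phi> \<phi>_in_S[OF v(1)] v(2) \<phi>_in_S] by blast
qed

lemma \<phi>_Bir:
  "rat_class S S \<phi> \<in> carrier Bir_S_proj" "inv\<^sub>S (rat_class S S \<phi>) = rat_class S S \<phi>"
  "dominant S S \<phi>" "\<phi> \<in> rat_class S S \<phi>"
proof -
  have eq: "rat_eq S (\<phi> \<circ> \<phi>) id" unfolding rat_eq_parallel comp_apply \<phi>_\<phi> by simp
  note B = S.BirI[OF rat_rep_\<phi> rat_rep_\<phi> \<phi>_nonzero eq \<phi>_nonzero eq]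
  show "inv\<^sub>S (rat_class S S \<phi>) = rat_class S S \<phi>" by (rule B)
  show self: "\<phi> \<in> rat_class S S \<phi>" by (rule S.rat_class_self[OF rat_rep_\<phi>])
  show "dominant S S \<phi>" by (rule S.Bir_rep[OF B(1) self])
  have "covers 1 0 0 1 \<phi>" unfolding covers_def by simp
  moreover have "1 * 1 \<noteq> (0 :: real) * 0" by simp
  ultimately show "rat_class S S \<phi> \<in> carrier Bir_S_proj" using Bir_S_proj_iff[OF B(1) self] by blast
qed

text \<open>
  The matrix of \<open>\<phi>\<close> on the fibres, read off from \<open>u E' / E\<close> and \<open>Y / w = (1 - t\<^sup>2) / u\<close>.
\<close>

definition Ma where "Ma = [:- \<i>:] * cpoly A"
definition Mb where "Mb = - ((cpoly B - [:\<i>:] * cpoly C) * [:1, 0, -1:])"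
definition Mc where "Mc = - (cpoly B + [:\<i>:] * cpoly C)"
definition Md where "Md = [:\<i>:] * cpoly A"

lemma acts_\<phi>: "acts 1 Ma Mb Mc Md \<phi>"
  unfolding acts_def
proof (intro allI conjI)
  fix t u :: complex
  show "\<phi> (Psi t u) $ 4 = 1 * t * \<phi> (Psi t u) $ 1" by simp
  define a b c where abc: "a = poly (cpoly A) t" "b = poly (cpoly B) t" "c = poly (cpoly C) t"
  have P: "poly Ma t = - \<i> * a" "poly Mb t = - (b - \<i> * c) * (1 - t\<^sup>2)" "poly Mc t = - (b + \<i> * c)"
    "poly Md t = \<i> * a"
    unfolding Ma_def Mb_def Mc_def Md_def abc by (simp_all add: power2_eq_square algebra_simps)
  have "Xc (\<phi> (Psi t u)) * (poly Mc t * u + poly Md t) = (E' (Psi t u))\<^sup>2 * u\<^sup>2 * (\<i> * a - (b + \<i> * c) * u)"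
    unfolding P by (simp add: algebra_simps)
  also have "\<dots> = E (Psi t u) * E' (Psi t u) * u * (- \<i> * a * u - (b - \<i> * c) * (1 - t\<^sup>2))"
    unfolding E_Psi abc[symmetric] by (simp add: power2_eq_square mult_ac)
  also have "- \<i> * a * u - (b - \<i> * c) * (1 - t\<^sup>2) = - \<i> * a * u + - (b - \<i> * c) * (1 - t\<^sup>2)"
    by (simp only: diff_conv_add_uminus minus_mult_left)
  also have "E (Psi t u) * E' (Psi t u) * u * \<dots> = \<phi> (Psi t u) $ 1 * (poly Ma t * u + poly Mb t)"
    unfolding P \<phi>_simps Psi_simps ..
  finally show "Xc (\<phi> (Psi t u)) * (poly Mc t * u + poly Md t) = \<phi> (Psi t u) $ 1 * (poly Ma t * u + poly Mb t)" .
qed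

lemma det_\<phi>: "Ma * Md \<noteq> Mb * Mc"
proof
  assume eq: "Ma * Md = Mb * Mc"
  obtain t where t: "t > 1" "poly A t \<noteq> 0 \<or> poly B t \<noteq> 0 \<or> poly C t \<noteq> 0" by (rule poly_nonzero_point)
  have "complex_of_real ((poly A t)\<^sup>2 + (t\<^sup>2 - 1) * ((poly B t)\<^sup>2 + (poly C t)\<^sup>2)) = poly (Ma * Md - Mb * Mc) (of_real t)"
    unfolding Ma_def Mb_def Mc_def Md_def by (simp add: algebra_simps power2_eq_square)
  also have "\<dots> = 0" unfolding eq by simp
  finally show False using det_pos[OF t] unfolding of_real_eq_0_iff by simp
qed

end

section \<open>Reality conditions\<close>

text \<open>
  On the circle \<open>cnj u = r / u\<close>, so the equation becomes quadratic in \<open>u\<close>.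
\<close>

lemma infinite_circle_linear:
  assumes "infinite {u. (cmod u)\<^sup>2 = r \<and> Re (\<zeta> * u) = k}" "r > 0"
  shows "\<zeta> = 0"
proof (rule ccontr)
  assume z: "\<zeta> \<noteq> 0"
  have "{u. (cmod u)\<^sup>2 = r \<and> Re (\<zeta> * u) = k} \<subseteq> {u. poly [:cnj \<zeta> * of_real r, - of_real (2 * k), \<zeta>:] u = 0}"
  proof
    fix u assume u: "u \<in> {u. (cmod u)\<^sup>2 = r \<and> Re (\<zeta> * u) = k}"
    then have 1: "u * cnj u = of_real r" by (simp add: complex_norm_square[symmetric])
    have k: "Re (\<zeta> * u) = k" using u by blast
    have "\<zeta> * u + cnj (\<zeta> * u) = of_real (2 * k)" unfolding k[symmetric] by (rule complex_add_cnj)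
    then have "\<zeta> * u + cnj \<zeta> * cnj u = of_real (2 * k)" by (simp only: complex_cnj_mult)
    then have "u * (\<zeta> * u + cnj \<zeta> * cnj u) = u * of_real (2 * k)" by simp
    then have "\<zeta> * u\<^sup>2 + cnj \<zeta> * of_real r = u * of_real (2 * k)"
      unfolding 1[symmetric] by (simp add: algebra_simps power2_eq_square)
    then show "u \<in> {u. poly [:cnj \<zeta> * of_real r, - of_real (2 * k), \<zeta>:] u = 0}"
      by (simp add: algebra_simps power2_eq_square)
  qed
  moreover have "finite {u. poly [:cnj \<zeta> * of_real r, - of_real (2 * k), \<zeta>:] u = 0}"
    using z by (intro poly_roots_finite) auto
  ultimately show False using assms(1) finite_subset by blast
qed

text \<open>
  On the circle the expansion of \<open>|a u + b|\<^sup>2\<close> is constant up to the term \<open>2 Re (a cnj(b) u)\<close>.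
\<close>

lemma circle_preserved:
  assumes inf: "infinite {u. (cmod u)\<^sup>2 = r \<and> (cmod (a * u + b))\<^sup>2 = (cmod d)\<^sup>2 * r}" and r: "r > 0"
    and a: "a \<noteq> 0"
  shows "b = 0" "(cmod a)\<^sup>2 = (cmod d)\<^sup>2"
proof -
  let ?U = "{u. (cmod u)\<^sup>2 = r \<and> (cmod (a * u + b))\<^sup>2 = (cmod d)\<^sup>2 * r}"
  have sq: "(cmod (a * u + b))\<^sup>2 = (cmod a)\<^sup>2 * (cmod u)\<^sup>2 + (cmod b)\<^sup>2 + 2 * Re (a * cnj b * u)" for u
    unfolding cmod_power2 by (simp add: algebra_simps power2_eq_square)
  have "?U \<subseteq> {u. (cmod u)\<^sup>2 = r \<and> Re (a * cnj b * u) = ((cmod d)\<^sup>2 * r - (cmod a)\<^sup>2 * r - (cmod b)\<^sup>2) / 2}"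
    unfolding sq by auto
  then have "infinite {u. (cmod u)\<^sup>2 = r \<and> Re (a * cnj b * u) = ((cmod d)\<^sup>2 * r - (cmod a)\<^sup>2 * r - (cmod b)\<^sup>2) / 2}"
    using inf finite_subset by blast
  then have "a * cnj b = 0" using r by (rule infinite_circle_linear)
  then show "b = 0" using a by simp
  obtain u where "u \<in> ?U" using infinite_imp_nonempty[OF inf] by blast
  then show "(cmod a)\<^sup>2 = (cmod d)\<^sup>2" using r \<open>b = 0\<close> by (auto simp: norm_mult power_mult_distrib)
qed

text \<open>
  A real point over \<open>t\<close> goes to a real point over \<open>-t\<close>, and both circles have radius \<open>sqrt (1 - t\<^sup>2)\<close>.
  A transformation \<open>u \<mapsto> (a u + b) / d\<close> that preserves this circle is a rotation.
\<close>

lemma acts_real: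
  assumes F: "dominant S S F" "acts (-1) a b 0 d F" and nz: "a \<noteq> 0" "d \<noteq> 0"
  shows "b = 0" and "infinite {t :: real. (cmod (poly a (of_real t)))\<^sup>2 = (cmod (poly d (of_real t)))\<^sup>2}"
proof -
  obtain e where e: "form_map e F" using F dominant_rep rat_repE by metis
  have key: "poly b (of_real t) = 0 \<and> (cmod (poly a (of_real t)))\<^sup>2 = (cmod (poly d (of_real t)))\<^sup>2"
    if t: "-1 < t" "t < 1" and inf: "infinite {u. (cmod u)\<^sup>2 = 1 - t\<^sup>2 \<and> F (Psi (of_real t) u) $ 1 \<noteq> 0}"
      and a: "poly a (of_real t) \<noteq> 0" for t :: real
  proof -
    let ?a = "poly a (of_real t)" and ?b = "poly b (of_real t)" and ?d = "poly d (of_real t)"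
    have "(cmod (?a * u + ?b))\<^sup>2 = (cmod ?d)\<^sup>2 * (1 - t\<^sup>2)"
      if u: "(cmod u)\<^sup>2 = 1 - t\<^sup>2" "F (Psi (of_real t) u) $ 1 \<noteq> 0" for u
    proof -
      let ?v = "rpt (Re u) (Im u) t"
      have u0: "u \<noteq> 0" using u(1) t by (auto simp: power2_eq_1_iff abs_square_eq_1)
      have FP: "F (Psi (of_real t) u) = u ^ e *s F ?v"
        unfolding Psi_rpt[OF u(1)] form_map_homogeneous[OF e] ..
      have vR: "?v \<in> real_points S" using u(1) unfolding cmod_power2 by (rule rpt_real_point)
      obtain f where f: "\<And>i. F ?v $ i = of_real (f i)" and f2: "(f 1)\<^sup>2 = (f 2)\<^sup>2 + (f 3)\<^sup>2 + (f 4)\<^sup>2"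
        using real_point_coords[OF real_points_stable[OF dominant_rep[OF F(1)] vR]] by blast
      have A: "F (Psi (of_real t) u) $ 4 = - of_real t * F (Psi (of_real t) u) $ 1"
        "Xc (F (Psi (of_real t) u)) * ?d = F (Psi (of_real t) u) $ 1 * (?a * u + ?b)"
        using F(2) unfolding acts_def by auto
      have "u ^ e * complex_of_real (f 4) = u ^ e * of_real (- t * f 1)"
        using A(1) unfolding FP by (simp add: f algebra_simps)
      then have "complex_of_real (f 4) = of_real (- t * f 1)"
        using power_not_zero[OF u0] by (metis mult_left_cancel)
      then have f4: "f 4 = - t * f 1" unfolding of_real_eq_iff .
      have f1: "f 1 \<noteq> 0" using u(2) unfolding FP by (simp add: f)
      have X: "Xc (F ?v) * ?d = of_real (f 1) * (?a * u + ?b)"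
        using A(2) u0 unfolding FP by (simp add: f mult.assoc)
      from f2 have XX: "(cmod (Xc (F ?v)))\<^sup>2 = (f 1)\<^sup>2 * (1 - t\<^sup>2)"
        unfolding cmod_power2 Xc_def f4 by (simp add: f algebra_simps power2_eq_square)
      have "(f 1)\<^sup>2 * (cmod (?a * u + ?b))\<^sup>2 = (cmod (of_real (f 1) * (?a * u + ?b)))\<^sup>2"
        by (simp add: norm_mult power_mult_distrib)
      also have "\<dots> = (f 1)\<^sup>2 * ((cmod ?d)\<^sup>2 * (1 - t\<^sup>2))"
        unfolding X[symmetric] by (simp add: norm_mult power_mult_distrib XX)
      finally show ?thesis using f1 by simp
    qed
    then have "{u. (cmod u)\<^sup>2 = 1 - t\<^sup>2 \<and> F (Psi (of_real t) u) $ 1 \<noteq> 0}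
       \<subseteq> {u. (cmod u)\<^sup>2 = 1 - t\<^sup>2 \<and> (cmod (?a * u + ?b))\<^sup>2 = (cmod ?d)\<^sup>2 * (1 - t\<^sup>2)}" by blast
    then have "infinite {u. (cmod u)\<^sup>2 = 1 - t\<^sup>2 \<and> (cmod (?a * u + ?b))\<^sup>2 = (cmod ?d)\<^sup>2 * (1 - t\<^sup>2)}"
      using inf finite_subset by blast
    moreover have "1 - t\<^sup>2 > 0" using t by (simp add: abs_square_less_1)
    ultimately show ?thesis using circle_preserved a by blast
  qed
  have "generically (\<lambda>t u. F (Psi t u) $ 1 \<noteq> 0)"
    using generic_Psi generic_coord(1)[OF F(1)] .
  note 1 = generic_real_parameter[OF this]
  have "\<forall>\<^sub>F t in cofinite. poly a t \<noteq> 0"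
    unfolding eventually_cofinite using nz poly_roots_finite by simp
  note 2 = cofinite_real[OF this]
  have "\<forall>\<^sub>F t in cofinite. -1 < t \<longrightarrow> t < 1 \<longrightarrow>
     poly b (of_real t) = 0 \<and> (cmod (poly a (of_real t)))\<^sup>2 = (cmod (poly d (of_real t)))\<^sup>2"
    using 1 2 by eventually_elim (use key in blast)
  then have fin: "finite {t :: real. \<not> (-1 < t \<longrightarrow> t < 1 \<longrightarrow>
     poly b (of_real t) = 0 \<and> (cmod (poly a (of_real t)))\<^sup>2 = (cmod (poly d (of_real t)))\<^sup>2)}"
    unfolding eventually_cofinite .
  define T where "T = {t :: real. poly b (of_real t) = 0 \<and> (cmod (poly a (of_real t)))\<^sup>2 = (cmod (poly d (of_real t)))\<^sup>2}"
  have T: "infinite T"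
  proof
    assume "finite T"
    then have "finite (T \<union> {t :: real. \<not> (-1 < t \<longrightarrow> t < 1 \<longrightarrow>
     poly b (of_real t) = 0 \<and> (cmod (poly a (of_real t)))\<^sup>2 = (cmod (poly d (of_real t)))\<^sup>2)})" using fin by simp
    moreover have "{-1<..<1::real} \<subseteq> T \<union> {t :: real. \<not> (-1 < t \<longrightarrow> t < 1 \<longrightarrow>
     poly b (of_real t) = 0 \<and> (cmod (poly a (of_real t)))\<^sup>2 = (cmod (poly d (of_real t)))\<^sup>2)}"
      unfolding T_def by auto
    ultimately have "finite {-1<..<1::real}" using finite_subset by blast
    then show False using infinite_Ioo[of "-1" "1::real"] by simp
  qed
  then show "infinite {t :: real. (cmod (poly a (of_real t)))\<^sup>2 = (cmod (poly d (of_real t)))\<^sup>2}"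
    by (rule infinite_super[rotated]) (auto simp: T_def)
  have "infinite (complex_of_real ` T)" using T by (simp add: finite_image_iff inj_on_def)
  moreover have "complex_of_real ` T \<subseteq> {z. poly b z = 0}" unfolding T_def by auto
  ultimately show "b = 0" using poly_roots_finite finite_subset by blast
qed

text \<open>
  At a real zero of \<open>D\<close> the squares of \<open>R1\<close> and \<open>R2\<close> add up to zero, so all three polynomials have a
  common factor, which can be removed.
\<close>

lemma reduce_unit_fraction:
  fixes D R1 R2 :: "real poly"
  assumes "D \<noteq> 0" "R1\<^sup>2 + R2\<^sup>2 = D\<^sup>2"
  shows "\<exists>h D' r1 r2. h \<noteq> 0 \<and> D = h * D' \<and> R1 = h * r1 \<and> R2 = h * r2 \<and> r1\<^sup>2 + r2\<^sup>2 = D'\<^sup>2 \<and>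
    (\<forall>t. poly D' t \<noteq> 0)"
  using assms
proof (induction "degree D" arbitrary: D R1 R2 rule: less_induct)
  case less
  show ?case
  proof (cases "\<exists>t. poly D t = 0")
    case False
    show ?thesis
      by (intro exI[of _ 1] exI[of _ D] exI[of _ R1] exI[of _ R2]) (use False less.prems in auto)
  next
    case True
    then obtain t where t: "poly D t = 0" by blast
    have "(poly R1 t)\<^sup>2 + (poly R2 t)\<^sup>2 = 0"
      using arg_cong[OF less.prems(2), of "\<lambda>p. poly p t"] t by simp
    then have "poly R1 t = 0" "poly R2 t = 0" by (simp_all add: sum_power2_eq_zero_iff)
    then obtain D1 S1 S2 where q: "D = [:- t, 1:] * D1" "R1 = [:- t, 1:] * S1" "R2 = [:- t, 1:] * S2"
      using t unfolding poly_eq_0_iff_dvd by (auto elim!: dvdE)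
    have "D1 \<noteq> 0" using less.prems(1) q by auto
    have "[:- t, 1:]\<^sup>2 * (S1\<^sup>2 + S2\<^sup>2) = [:- t, 1:]\<^sup>2 * D1\<^sup>2"
      using less.prems(2) unfolding q by (simp only: power_mult_distrib distrib_left)
    moreover have "[:- t, 1:]\<^sup>2 \<noteq> 0" by simp
    ultimately have "S1\<^sup>2 + S2\<^sup>2 = D1\<^sup>2" by (metis mult_left_cancel)
    moreover have "degree D1 < degree D" using \<open>D1 \<noteq> 0\<close> unfolding q by (simp add: degree_mult_eq del: mult_pCons_left)
    ultimately obtain h D' r1 r2 where h: "h \<noteq> 0" "D1 = h * D'" "S1 = h * r1" "S2 = h * r2"
      "r1\<^sup>2 + r2\<^sup>2 = D'\<^sup>2" "\<forall>t. poly D' t \<noteq> 0"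
      using less.hyps[of D1 S1 S2] \<open>D1 \<noteq> 0\<close> by blast
    show ?thesis
    proof (rule exI[of _ "[:- t, 1:] * h"], rule exI[of _ D'], rule exI[of _ r1], rule exI[of _ r2], intro conjI)
      show "[:- t, 1:] * h \<noteq> 0" using h(1) by (metis mult_eq_0_iff pCons_eq_0_iff zero_neq_one)
    qed (use h q in \<open>simp_all only: mult.assoc\<close>, simp)
  qed
qed

section \<open>Regularity of rotations\<close>

lemma norm_nonzero:
  assumes "p \<noteq> 0"
  shows "(RE p)\<^sup>2 + (IM p)\<^sup>2 \<noteq> 0"
proof
  assume 0: "(RE p)\<^sup>2 + (IM p)\<^sup>2 = 0"
  have "p = 0"
  proof (rule poly_eq_on_reals)
    fix t :: real
    have "(poly (RE p) t)\<^sup>2 + (poly (IM p) t)\<^sup>2 = 0"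
      using arg_cong[OF 0, of "\<lambda>p. poly p t"] by simp
    then show "poly p (of_real t) = poly 0 (of_real t)"
      by (simp add: poly_RE_IM[of p] sum_power2_eq_zero_iff)
  qed
  then show False using assms by simp
qed

text \<open>
  Write \<open>a / d\<close> as \<open>(R1 + i R2) / |d|\<^sup>2\<close> and cancel real zeros of the denominator.
\<close>

lemma unit_fraction:
  assumes nz: "d \<noteq> 0"
    and unit: "infinite {t :: real. (cmod (poly a (of_real t)))\<^sup>2 = (cmod (poly d (of_real t)))\<^sup>2}"
  obtains r1 r2 D where "r1\<^sup>2 + r2\<^sup>2 = D\<^sup>2" "\<forall>t. poly D t \<noteq> 0"
    "d * (cpoly r1 + [:\<i>:] * cpoly r2) = a * cpoly D"
proof -
  define x y p q where "x = RE a" and "y = IM a" and "p = RE d" and "q = IM d"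
  have D0: "p\<^sup>2 + q\<^sup>2 \<noteq> 0" unfolding p_def q_def using nz by (rule norm_nonzero)
  have cm: "(cmod (poly f (of_real t)))\<^sup>2 = poly ((RE f)\<^sup>2 + (IM f)\<^sup>2) t" for f t
    unfolding poly_RE_IM cmod_power2 by simp
  have "{t :: real. (cmod (poly a (of_real t)))\<^sup>2 = (cmod (poly d (of_real t)))\<^sup>2}
     = {t. poly ((x\<^sup>2 + y\<^sup>2) - (p\<^sup>2 + q\<^sup>2)) t = 0}"
    unfolding cm x_def y_def p_def q_def by simp
  then have "(x\<^sup>2 + y\<^sup>2) - (p\<^sup>2 + q\<^sup>2) = 0" using unit poly_roots_finite by metis
  then have xy: "x\<^sup>2 + y\<^sup>2 = p\<^sup>2 + q\<^sup>2" by simp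
  have "(x * p + y * q)\<^sup>2 + (y * p - x * q)\<^sup>2 = (x\<^sup>2 + y\<^sup>2) * (p\<^sup>2 + q\<^sup>2)"
    by (simp add: algebra_simps power2_eq_square)
  then have "(x * p + y * q)\<^sup>2 + (y * p - x * q)\<^sup>2 = (p\<^sup>2 + q\<^sup>2)\<^sup>2"
    unfolding xy by (simp add: power2_eq_square)
  from reduce_unit_fraction[OF D0 this] obtain h D r1 r2 where h: "h \<noteq> 0" "p\<^sup>2 + q\<^sup>2 = h * D"
    "x * p + y * q = h * r1" "y * p - x * q = h * r2" "r1\<^sup>2 + r2\<^sup>2 = D\<^sup>2" "\<forall>t. poly D t \<noteq> 0"
    by blast
  have "cpoly h * (d * (cpoly r1 + [:\<i>:] * cpoly r2)) = cpoly h * (a * cpoly D)"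
  proof (rule poly_eq_on_reals)
    fix t :: real
    have e: "poly p t ^ 2 + poly q t ^ 2 = poly h t * poly D t"
      "poly x t * poly p t + poly y t * poly q t = poly h t * poly r1 t"
      "poly y t * poly p t - poly x t * poly q t = poly h t * poly r2 t"
      using arg_cong[OF h(2), of "\<lambda>p. poly p t"] arg_cong[OF h(3), of "\<lambda>p. poly p t"]
        arg_cong[OF h(4), of "\<lambda>p. poly p t"] by simp_all
    define k x' y' p' q' where "k = poly h t" and "x' = poly x t" and "y' = poly y t"
      and "p' = poly p t" and "q' = poly q t"
    note e = e[folded k_def x'_def y'_def p'_def q'_def]
    have "p' * (k * poly r1 t) - q' * (k * poly r2 t) = x' * (k * poly D t)"
      "q' * (k * poly r1 t) + p' * (k * poly r2 t) = y' * (k * poly D t)"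
      unfolding e[symmetric] by (simp_all add: algebra_simps power2_eq_square)
    then have "complex_of_real k * ((of_real p' + \<i> * of_real q') * (of_real (poly r1 t) + \<i> * of_real (poly r2 t)))
       = of_real k * ((of_real x' + \<i> * of_real y') * of_real (poly D t))"
      by (simp add: complex_eq_iff algebra_simps)
    then show "poly (cpoly h * (d * (cpoly r1 + [:\<i>:] * cpoly r2))) (of_real t)
       = poly (cpoly h * (a * cpoly D)) (of_real t)"
      unfolding k_def x'_def y'_def p'_def q'_def x_def y_def p_def q_def
      by (simp add: poly_RE_IM[of a] poly_RE_IM[of d])
  qed
  moreover have "cpoly h \<noteq> 0" using h(1) cpoly_0_iff by blast
  ultimately have "d * (cpoly r1 + [:\<i>:] * cpoly r2) = a * cpoly D" by (metis mult_left_cancel)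
  then show ?thesis using that h by blast
qed

text \<open>
  The rotation by \<open>\<rho> = a / d\<close> is represented by the tuple \<open>H\<close> of real forms built from a
  representation of \<open>\<rho>\<close> whose denominator \<open>D\<close> has no real zero.  A nonzero real point has \<open>w \<noteq> 0\<close>, hence
  \<open>H\<close> is nonzero there; the inverse is the map itself.
\<close>

lemma rotation_regular:
  assumes \<tau>: "\<tau> \<in> carrier (Bir S)" "\<tau> \<cdot> \<tau> = \<one>\<^sub>S" "F \<in> \<tau>"
    and acts: "acts (-1) a 0 0 d F" and nz: "d \<noteq> 0"
    and unit: "infinite {t :: real. (cmod (poly a (of_real t)))\<^sup>2 = (cmod (poly d (of_real t)))\<^sup>2}"
  shows "\<tau> \<in> carrier Aut_SR"
proof -
  have F: "dominant S S F" "\<tau> = rat_class S S F" using S.Bir_rep[OF \<tau>(1,3)] .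
  obtain e where e: "form_map e F" using F dominant_rep rat_repE by metis
  obtain r1 r2 D where r: "r1\<^sup>2 + r2\<^sup>2 = D\<^sup>2" "\<forall>t. poly D t \<noteq> 0"
    "d * (cpoly r1 + [:\<i>:] * cpoly r2) = a * cpoly D"
    by (rule unit_fraction[OF nz unit])
  define m where "m = max (degree D) (max (degree r1) (degree r2))"
  have deg: "degree D \<le> m" "degree r1 \<le> m" "degree r2 \<le> m" unfolding m_def by auto
  define H where "H = twist (homog m D) (homog m r1) (homog m r2) (- 1)"
  have hP: "homog m p (Psi t u) = u ^ m * poly (cpoly p) t" if "degree p \<le> m" for p t u
    using homog_eq[OF that, of "Psi t u" t] by simp
  have fH: "form_map (m + 1) H" unfolding H_def by (intro form_map_twist real_form_homog)
  have cr: "(cpoly r1)\<^sup>2 + (cpoly r2)\<^sup>2 = (cpoly D)\<^sup>2"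
  proof (rule poly_eq_on_reals)
    fix t :: real
    have "complex_of_real (poly (r1\<^sup>2 + r2\<^sup>2) t) = of_real (poly (D\<^sup>2) t)" unfolding r ..
    then show "poly ((cpoly r1)\<^sup>2 + (cpoly r2)\<^sup>2) (of_real t) = poly ((cpoly D)\<^sup>2) (of_real t)" by simp
  qed
  have sq: "(homog m r1 v)\<^sup>2 + (homog m r2 v)\<^sup>2 = (homog m D v)\<^sup>2" if "v \<in> S" for v
  proof -
    have "(homog m r1 v)\<^sup>2 + (homog m r2 v)\<^sup>2 - (homog m D v)\<^sup>2 = 0"
    proof (rule S_form_zero[OF _ _ that])
      show "real_form (2 * m) (\<lambda>v. (homog m r1 v)\<^sup>2 + (homog m r2 v)\<^sup>2 - (homog m D v)\<^sup>2)"
        by (intro real_form_diff real_form_add real_form_power real_form_homog)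
      have "(homog m r1 (Psi t u))\<^sup>2 + (homog m r2 (Psi t u))\<^sup>2 - (homog m D (Psi t u))\<^sup>2
          = (u ^ m)\<^sup>2 * poly ((cpoly r1)\<^sup>2 + (cpoly r2)\<^sup>2 - (cpoly D)\<^sup>2) t" for t u
        using deg by (simp add: hP algebra_simps power2_eq_square)
      then show "generically (\<lambda>t u. (homog m r1 (Psi t u))\<^sup>2 + (homog m r2 (Psi t u))\<^sup>2 - (homog m D (Psi t u))\<^sup>2 = 0)"
        unfolding cr by simp
    qed
    then show ?thesis by simp
  qed
  have HS: "H v \<in> S" if "v \<in> S" for v
    unfolding H_def by (rule twist_in_S) (use that sq[OF that] in simp_all)
  have Hnz: "H v \<noteq> 0" if v: "v \<in> real_points S" "v \<noteq> 0" for v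
  proof -
    obtain x where x: "\<And>i. v $ i = of_real (x i)" and eq: "(x 1)\<^sup>2 = (x 2)\<^sup>2 + (x 3)\<^sup>2 + (x 4)\<^sup>2"
      using real_point_coords[OF v(1)] by blast
    have "x 1 \<noteq> 0"
    proof
      assume "x 1 = 0"
      then have "(x 2)\<^sup>2 + (x 3)\<^sup>2 + (x 4)\<^sup>2 = 0" using eq by simp
      then have "(x 2)\<^sup>2 = 0" "(x 3)\<^sup>2 = 0" "(x 4)\<^sup>2 = 0"
        using zero_le_power2[of "x 2"] zero_le_power2[of "x 3"] zero_le_power2[of "x 4"] by linarith+
      then have "v = 0" using \<open>x 1 = 0\<close> by (simp add: vec_eq_4 x)
      then show False using v by simp
    qed
    then have "v $ 4 = of_real (x 4 / x 1) * v $ 1" by (simp add: x)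
    then have "homog m D v = (v $ 1) ^ m * of_real (poly D (x 4 / x 1))"
      using homog_eq[OF deg(1)] by (metis poly_cpoly)
    then have "H v $ 1 \<noteq> 0" unfolding H_def using \<open>x 1 \<noteq> 0\<close> r(2) by (simp add: x)
    then show ?thesis by (metis zero_index)
  qed
  have repH: "rat_rep S S H"
  proof (rule rat_repI[OF fH])
    have "vector [1, 1, 0, 0] \<in> real_points S" unfolding real_points_def S_def by (auto simp: forall_4)
    then show "vector [1, 1, 0, 0] \<in> S" "H (vector [1, 1, 0, 0]) \<noteq> 0"
      using Hnz[of "vector [1, 1, 0, 0]"] unfolding real_points_def by (auto simp: vec_eq_4)
  qed (rule HS)
  have "rat_eq S H F"
  proof (rule S_rat_eqI[OF fH e])
    have 1: "generically (\<lambda>t u. poly d t \<noteq> 0 \<and> poly (cpoly D) t \<noteq> 0)"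
    proof -
      have "D \<noteq> 0" using r(2) by auto
      then have "cpoly D \<noteq> 0" using cpoly_0_iff by blast
      then have "\<forall>\<^sub>F t in cofinite. poly d t \<noteq> 0 \<and> poly (cpoly D) t \<noteq> 0"
        using nz poly_roots_finite by (intro eventually_conj) (simp_all add: eventually_cofinite)
      then show ?thesis by eventually_elim simp
    qed
    show "generically (\<lambda>t u. parallel (H (Psi t u)) (F (Psi t u)))"
      using generically_conj[OF generically_coord[OF F(1)] 1]
    proof (rule generically_mono)
      fix t u
      assume as: "(u \<noteq> 0 \<and> F (Psi t u) $ 1 \<noteq> 0 \<and> Xc (F (Psi t u)) \<noteq> 0) \<and> poly d t \<noteq> 0 \<and> poly (cpoly D) t \<noteq> 0"
      have A: "F (Psi t u) $ 4 = - t * F (Psi t u) $ 1" "Xc (F (Psi t u)) * poly d t = F (Psi t u) $ 1 * (poly a t * u)"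
        using acts unfolding acts_def by auto
      have R: "poly d t * (poly (cpoly r1) t + \<i> * poly (cpoly r2) t) = poly a t * poly (cpoly D) t"
        using arg_cong[OF r(3), of "\<lambda>p. poly p t"] by simp
      have H1: "H (Psi t u) $ 1 = u ^ m * poly (cpoly D) t * u"
        and H4: "H (Psi t u) $ 4 = - t * H (Psi t u) $ 1"
        and HX: "Xc (H (Psi t u)) = u ^ m * (poly (cpoly r1) t + \<i> * poly (cpoly r2) t) * u\<^sup>2"
        unfolding H_def using deg by (simp_all add: hP algebra_simps)
      show "parallel (H (Psi t u)) (F (Psi t u))"
      proof (rule S_parallelI)
        show "H (Psi t u) \<in> S" by (rule HS) simp
        show "F (Psi t u) \<in> S" using F(1) dominant_rep rat_rep_in Psi_in_S by blast
        show "H (Psi t u) $ 1 \<noteq> 0" using as unfolding H1 by simp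
        show "F (Psi t u) $ 1 \<noteq> 0" "Xc (F (Psi t u)) \<noteq> 0" using as by auto
        show "H (Psi t u) $ 4 * F (Psi t u) $ 1 = F (Psi t u) $ 4 * H (Psi t u) $ 1"
          unfolding H4 A(1) by simp
        have "poly d t * (Xc (H (Psi t u)) * F (Psi t u) $ 1)
          = u ^ m * u\<^sup>2 * F (Psi t u) $ 1 * (poly d t * (poly (cpoly r1) t + \<i> * poly (cpoly r2) t))"
          unfolding HX by (simp only: mult_ac)
        also have "\<dots> = u ^ m * u * poly (cpoly D) t * (F (Psi t u) $ 1 * (poly a t * u))"
          unfolding R by (simp only: mult_ac power2_eq_square)
        also have "\<dots> = poly d t * (Xc (F (Psi t u)) * H (Psi t u) $ 1)"
          unfolding A(2)[symmetric] H1 by (simp only: mult_ac)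
        finally show "Xc (H (Psi t u)) * F (Psi t u) $ 1 = Xc (F (Psi t u)) * H (Psi t u) $ 1"
          using as by (metis mult_left_cancel)
      qed
    qed
  qed
  then have "H \<in> \<tau>" unfolding F(2) rat_class_def using repH S.rat_eq_sym by blast
  then have def: "defined_at \<tau> v" if "v \<in> real_points S" "v \<noteq> 0" for v
    unfolding defined_at_def using Hnz that by blast
  have "inv\<^sub>S \<tau> = \<tau>" using Bir_S.inv_equality[OF \<tau>(2,1,1)] .
  then show ?thesis unfolding Aut_SR_def biregular_at_def using \<tau>(1) def by simp
qed

section \<open>The conjugating map\<close>

text \<open>
  Multiplying the coordinates of the section by \<open>i cnj(v1)\<close> makes the first one purely imaginary; the
  invariance is not affected by the factor.
\<close>

lemma normalized_section:
  fixes a b c d v1 v2 :: "complex poly"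
  defines "neg \<equiv> \<lambda>p. pcompose p [:0, -1:]"
  assumes nz: "v1 \<noteq> 0 \<or> v2 \<noteq> 0"
    and rel: "(a * v1 + b * v2) * neg v2 = (c * v1 + d * v2) * neg v1"
  obtains A B C where "A \<noteq> 0 \<or> B \<noteq> 0 \<or> C \<noteq> 0"
    "(a * ([:\<i>:] * cpoly A) + b * (cpoly B + [:\<i>:] * cpoly C)) * neg (cpoly B + [:\<i>:] * cpoly C)
      = (c * ([:\<i>:] * cpoly A) + d * (cpoly B + [:\<i>:] * cpoly C)) * neg ([:\<i>:] * cpoly A)"
proof (cases "v1 = 0")
  case True
  then have v2: "v2 \<noteq> 0" using nz by simp
  have "neg (neg v2) = v2" unfolding neg_def by (rule pcompose_flip_flip)
  then have "neg v2 \<noteq> 0" using v2 by (auto simp: neg_def)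
  moreover have "b * v2 * neg v2 = 0" using rel True by (simp add: neg_def)
  ultimately have "b = 0" using v2 by simp
  then show ?thesis by (intro that[of 0 1 0]) (simp_all add: neg_def)
next
  case False
  define k where "k = [:\<i>:] * (cpoly (RE v1) - [:\<i>:] * cpoly (IM v1))"
  define A where "A = (RE v1)\<^sup>2 + (IM v1)\<^sup>2"
  have kA: "[:\<i>:] * cpoly A = k * v1"
    by (rule poly_eq_on_reals) (simp add: k_def A_def poly_RE_IM[of v1] algebra_simps power2_eq_square)
  have kB: "cpoly (RE (k * v2)) + [:\<i>:] * cpoly (IM (k * v2)) = k * v2"
    by (rule RE_IM[symmetric])
  have neg: "neg (k * p) = neg k * neg p" for p unfolding neg_def by (rule pcompose_mult)
  have "(a * (k * v1) + b * (k * v2)) * neg (k * v2) = k * neg k * ((a * v1 + b * v2) * neg v2)"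
    unfolding neg by (simp add: algebra_simps)
  also have "\<dots> = (c * (k * v1) + d * (k * v2)) * neg (k * v1)"
    unfolding rel neg by (simp add: algebra_simps)
  finally show ?thesis
    using norm_nonzero[OF False] by (intro that[of A "RE (k * v2)" "IM (k * v2)"]) (auto simp: A_def[symmetric] kA kB simp del: mult_pCons_left)
qed

text \<open>
  The matrix of \<open>\<phi> \<tau> \<phi>\<close> is the product of those of \<open>\<phi>\<close>, \<open>\<tau>\<close>, \<open>\<phi>\<close>, the last taken at \<open>-t\<close>.  Its entry \<open>c2\<close>
  vanishes because \<open>\<tau>\<close> preserves the section, and the reality conditions take care of \<open>b2\<close>.
\<close>

lemma flip_conjugate_regular:
  assumes \<tau>: "\<tau> \<in> carrier (Bir S)" "\<tau> \<cdot> \<tau> = \<one>\<^sub>S" "F \<in> \<tau>" and base: "covers 1 0 0 (-1) F"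
  obtains g where "g \<in> carrier Bir_S_proj" "g \<cdot> \<tau> \<cdot> inv\<^sub>S g \<in> carrier Aut_SR"
proof -
  have F: "dominant S S F" "\<tau> = rat_class S S F" using S.Bir_rep[OF \<tau>(1,3)] .
  obtain e where e: "form_map e F" using F dominant_rep rat_repE by metis
  have flip: "F (Psi t u) $ 4 = (-1) * t * F (Psi t u) $ 1" for t u
  proof (rule biv_eq[where f = "\<lambda>t u. F (Psi t u) $ 4"])
    show "biv (\<lambda>t u. F (Psi t u) $ 4)" by (rule biv_form_map(1)[OF e])
    show "biv (\<lambda>t u. (-1) * t * F (Psi t u) $ 1)"
      by (intro biv_intros biv_form_map(1)[OF e] polyfun_intros)
    show "generically (\<lambda>t u. F (Psi t u) $ 4 = (-1) * t * F (Psi t u) $ 1)"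
      using generically_coord[OF F(1)]
    proof (rule generically_mono)
      fix t u assume u: "u \<noteq> 0 \<and> F (Psi t u) $ 1 \<noteq> 0 \<and> Xc (F (Psi t u)) \<noteq> 0"
      have "F (Psi t u) $ 1 * (- (t * u)) = F (Psi t u) $ 4 * u"
        using base unfolding covers_def by (auto dest: bspec[OF _ Psi_in_S[of t u]])
      then have "u * F (Psi t u) $ 4 = u * ((-1) * t * F (Psi t u) $ 1)" by (simp add: algebra_simps)
      then show "F (Psi t u) $ 4 = (-1) * t * F (Psi t u) $ 1" using u by (metis mult_left_cancel)
    qed
  qed
  obtain a b c d where M: "acts (-1) a b c d F" "a * d \<noteq> b * c"
    by (rule acts_exists[OF \<tau>(1,3) flip])
  have FF: "rat_eq S (F \<circ> F) id"
    using S.Bir_mult_rep[OF \<tau>(1,1,3,3)] \<tau>(2) S.Bir_one_rep by simp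
  note sq = acts_identity[OF dominant_compose[OF F(1,1)] FF acts_compose[OF F(1) M(1) e M(1)]]
  obtain v1 v2 where v: "v1 \<noteq> 0 \<or> v2 \<noteq> 0"
    "(a * v1 + b * v2) * pcompose v2 [:0, -1:] = (c * v1 + d * v2) * pcompose v1 [:0, -1:]"
    by (rule invariant_section[OF refl sq(1) sq(2) sq(3)[symmetric]])
  obtain A B C where ABC: "A \<noteq> 0 \<or> B \<noteq> 0 \<or> C \<noteq> 0"
    "(a * ([:\<i>:] * cpoly A) + b * (cpoly B + [:\<i>:] * cpoly C)) * pcompose (cpoly B + [:\<i>:] * cpoly C) [:0, -1:]
      = (c * ([:\<i>:] * cpoly A) + d * (cpoly B + [:\<i>:] * cpoly C)) * pcompose ([:\<i>:] * cpoly A) [:0, -1:]"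
    by (rule normalized_section[OF v])
  interpret P: section_involution A B C by unfold_locales (rule ABC(1))
  let ?g = "rat_class S S P.\<phi>"
  let ?\<tau> = "?g \<cdot> \<tau> \<cdot> inv\<^sub>S ?g"
  have gB: "?g \<in> carrier (Bir S)" using P.\<phi>_Bir(1) subgroup.subset[OF subgroup_Bir_S_proj] by blast
  have \<tau>'B: "?\<tau> \<in> carrier (Bir S)" using gB \<tau>(1) by simp
  have "?\<tau> \<cdot> ?\<tau> = ?g \<cdot> (\<tau> \<cdot> \<tau>) \<cdot> inv\<^sub>S ?g"
    using gB \<tau>(1) by (simp add: Bir_S.m_assoc Bir_S.inv_solve_left')
  then have \<tau>'2: "?\<tau> \<cdot> ?\<tau> = \<one>\<^sub>S" using gB unfolding \<tau>(2) by simp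
  let ?F = "P.\<phi> \<circ> (F \<circ> P.\<phi>)"
  have "P.\<phi> \<circ> F \<circ> P.\<phi> \<in> ?\<tau>"
    using P.\<phi>_Bir gB \<tau> by (intro S.Bir_mult_rep Bir_S.m_closed) auto
  then have F\<tau>': "?F \<in> ?\<tau>" by (simp add: comp_assoc)
  have domF': "dominant S S ?F" using S.Bir_rep[OF \<tau>'B F\<tau>'] by blast
  let ?n = "\<lambda>p. pcompose p [:0, -1:]"
  define a1 b1 c1 d1 where "a1 = a * P.Ma + b * P.Mc" and "b1 = a * P.Mb + b * P.Md"
    and "c1 = c * P.Ma + d * P.Mc" and "d1 = c * P.Mb + d * P.Md"
  have "acts ((-1) * 1) a1 b1 c1 d1 (F \<circ> P.\<phi>)"
    using acts_compose[OF P.\<phi>_Bir(3) P.acts_\<phi> e M(1)]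
    unfolding a1_def b1_def c1_def d1_def by (simp add: pcompose_idR)
  then have acts1: "acts (-1) a1 b1 c1 d1 (F \<circ> P.\<phi>)" by simp
  define a2 b2 c2 d2 where "a2 = ?n P.Ma * a1 + ?n P.Mb * c1" and "b2 = ?n P.Ma * b1 + ?n P.Mb * d1"
    and "c2 = ?n P.Mc * a1 + ?n P.Md * c1" and "d2 = ?n P.Mc * b1 + ?n P.Md * d1"
  have "acts (1 * -1) a2 b2 c2 d2 ?F"
    using acts_compose[OF dominant_compose[OF P.\<phi>_Bir(3) F(1)] acts1 P.form_map_\<phi> P.acts_\<phi>]
    unfolding a2_def b2_def c2_def d2_def .
  then have acts2: "acts (-1) a2 b2 c2 d2 ?F" by simp
  define w1 w2 where "w1 = [:\<i>:] * cpoly A" and "w2 = cpoly B + [:\<i>:] * cpoly C"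
  have Mw: "P.Ma = - w1" "P.Mc = - w2" "P.Md = w1"
    unfolding P.Ma_def P.Mc_def P.Md_def w1_def w2_def by simp_all
  have "c2 = (a * w1 + b * w2) * ?n w2 - (c * w1 + d * w2) * ?n w1"
    unfolding c2_def a1_def c1_def Mw by (simp add: pcompose_uminus algebra_simps)
  also have "\<dots> = 0" using ABC(2) unfolding w1_def w2_def by simp
  finally have c2: "c2 = 0" .
  have "a2 * d2 - b2 * c2 = (?n P.Ma * ?n P.Md - ?n P.Mb * ?n P.Mc) * (a1 * d1 - b1 * c1)"
    unfolding a2_def b2_def c2_def d2_def by (simp add: algebra_simps)
  also have "a1 * d1 - b1 * c1 = (a * d - b * c) * (P.Ma * P.Md - P.Mb * P.Mc)"
    unfolding a1_def b1_def c1_def d1_def by (simp add: algebra_simps)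
  also have "?n P.Ma * ?n P.Md - ?n P.Mb * ?n P.Mc = ?n (P.Ma * P.Md - P.Mb * P.Mc)"
    by (simp add: pcompose_mult pcompose_diff)
  finally have det: "a2 * d2 - b2 * c2
      = ?n (P.Ma * P.Md - P.Mb * P.Mc) * ((a * d - b * c) * (P.Ma * P.Md - P.Mb * P.Mc))" .
  have "P.Ma * P.Md - P.Mb * P.Mc \<noteq> 0" using P.det_\<phi> by simp
  moreover from this have "?n (P.Ma * P.Md - P.Mb * P.Mc) \<noteq> 0"
    by (metis pcompose_flip_flip pcompose_0)
  ultimately have nz: "a2 \<noteq> 0" "d2 \<noteq> 0" using det M(2) c2 by auto
  have acts3: "acts (-1) a2 b2 0 d2 ?F" using acts2 unfolding c2 .
  note real = acts_real[OF domF' acts3 nz]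
  have "acts (-1) a2 0 0 d2 ?F" using acts3 unfolding real(1) .
  then have "?\<tau> \<in> carrier Aut_SR" by (rule rotation_regular[OF \<tau>'B \<tau>'2 F\<tau>' _ nz(2) real(2)])
  then show ?thesis using that P.\<phi>_Bir(1) by blast
qed

lemma involution_conjugate_regular:
  assumes \<sigma>: "\<sigma> \<in> carrier Bir_S_proj" "\<sigma> \<cdot> \<sigma> = \<one>\<^sub>S" "\<sigma> \<notin> carrier Bir_S_over_proj"
  obtains g where "g \<in> carrier Bir_S_proj" "g \<cdot> \<sigma> \<cdot> inv\<^sub>S g \<in> carrier Aut_SR_proj"
proof -
  have sub: "carrier Bir_S_proj \<subseteq> carrier (Bir S)" using subgroup.subset[OF subgroup_Bir_S_proj] .
  have \<sigma>B: "\<sigma> \<in> carrier (Bir S)" using \<sigma> sub by blast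
  obtain h F where h: "h \<in> carrier Bir_S_proj"
    and F: "F \<in> h \<cdot> \<sigma> \<cdot> inv\<^sub>S h" "covers 1 0 0 (-1) F"
    using conj_to_flip[OF \<sigma>] .
  let ?\<tau> = "h \<cdot> \<sigma> \<cdot> inv\<^sub>S h"
  have hB: "h \<in> carrier (Bir S)" using h sub by blast
  have "?\<tau> \<cdot> ?\<tau> = h \<cdot> (\<sigma> \<cdot> \<sigma>) \<cdot> inv\<^sub>S h"
    using hB \<sigma>B by (simp add: Bir_S.m_assoc Bir_S.inv_solve_left')
  then have "?\<tau> \<cdot> ?\<tau> = \<one>\<^sub>S" using hB unfolding \<sigma>(2) by simp
  moreover have "?\<tau> \<in> carrier (Bir S)" using hB \<sigma>B by simp
  ultimately obtain g where g: "g \<in> carrier Bir_S_proj"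
    "g \<cdot> ?\<tau> \<cdot> inv\<^sub>S g \<in> carrier Aut_SR"
    using flip_conjugate_regular F by metis
  have gB: "g \<in> carrier (Bir S)" using g sub by blast
  have gh: "g \<cdot> h \<in> carrier Bir_S_proj" using g h subgroup.m_closed[OF subgroup_Bir_S_proj] by blast
  have eq: "g \<cdot> ?\<tau> \<cdot> inv\<^sub>S g
     = (g \<cdot> h) \<cdot> \<sigma> \<cdot> inv\<^sub>S (g \<cdot> h)"
    using gB hB \<sigma>B by (simp add: Bir_S.m_assoc Bir_S.inv_mult_group)
  have "(g \<cdot> h) \<cdot> \<sigma> \<cdot> inv\<^sub>S (g \<cdot> h) \<in> carrier Bir_S_proj"
    by (rule subgroup.m_closed[OF subgroup_Bir_S_proj subgroup.m_closed[OF subgroup_Bir_S_proj gh \<sigma>(1)]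
        subgroup.m_inv_closed[OF subgroup_Bir_S_proj gh]])
  then show ?thesis using that[OF gh] g(2) unfolding eq by (simp add: Aut_SR_proj_def)
qed

theorem corollary5p42:
  shows "(\<forall>\<sigma> \<in> involutions Aut_SR_proj - carrier Aut_SR_over_proj.
            induced_class Bir_S_proj (conj_class Aut_SR_proj \<sigma>) = conj_class Bir_S_proj \<sigma>)
       \<and> induced_class Bir_S_proj `
           conj_classes Aut_SR_proj (involutions Aut_SR_proj - carrier Aut_SR_over_proj)
         = conj_classes Bir_S_proj (involutions Bir_S_proj - carrier Bir_S_over_proj)"
proof -
  let ?H = "carrier Bir_S_proj" and ?K = "carrier Aut_SR_proj"
  let ?J = "involutions Aut_SR_proj - carrier Aut_SR_over_proj"
  let ?I = "involutions Bir_S_proj - carrier Bir_S_over_proj"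
  have H: "Bir_S_proj = (Bir S)\<lparr>carrier := ?H\<rparr>" unfolding Bir_S_proj_def by simp
  have K: "Aut_SR_proj = (Bir S)\<lparr>carrier := ?K\<rparr>" unfolding Aut_SR_proj_def by simp
  have KH: "?K \<subseteq> ?H" unfolding Aut_SR_proj_def by simp
  have invH: "involutions Bir_S_proj = {a \<in> ?H. a \<noteq> \<one>\<^sub>S \<and> a \<cdot> a = \<one>\<^sub>S}"
    unfolding involutions_def Bir_S_proj_def by simp
  have invK: "involutions Aut_SR_proj = {a \<in> ?K. a \<noteq> \<one>\<^sub>S \<and> a \<cdot> a = \<one>\<^sub>S}"
    unfolding involutions_def Aut_SR_proj_def by simp
  have over: "carrier Aut_SR_over_proj = carrier Bir_S_over_proj \<inter> carrier Aut_SR"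
    unfolding Aut_SR_over_proj_def by simp
  have KA: "?K = ?H \<inter> carrier Aut_SR" unfolding Aut_SR_proj_def by simp
  have JI: "?J = ?I \<inter> ?K" unfolding invH invK over using KA by blast
  have ind: "induced_class Bir_S_proj (conj_class Aut_SR_proj \<sigma>) = conj_class Bir_S_proj \<sigma>" if "\<sigma> \<in> ?J" for \<sigma>
  proof -
    have "\<sigma> \<in> ?K" using that unfolding JI by blast
    from Bir_S.induced_class_conj_class[OF subgroup_Bir_S_proj subgroup_Aut_SR_proj KH this]
    show ?thesis using H K by simp
  qed
  have "induced_class Bir_S_proj ` conj_classes Aut_SR_proj ?J = conj_class Bir_S_proj ` ?J"
    unfolding conj_classes_def orbits_def conj_class_def[symmetric] using ind by auto
  also have "\<dots> = conj_class Bir_S_proj ` ?I"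
  proof
    show "conj_class Bir_S_proj ` ?J \<subseteq> conj_class Bir_S_proj ` ?I" unfolding JI by blast
    show "conj_class Bir_S_proj ` ?I \<subseteq> conj_class Bir_S_proj ` ?J"
    proof
      fix C assume "C \<in> conj_class Bir_S_proj ` ?I"
      then obtain \<sigma> where \<sigma>: "\<sigma> \<in> ?I" "C = conj_class Bir_S_proj \<sigma>" by blast
      then have \<sigma>': "\<sigma> \<in> ?H" "\<sigma> \<noteq> \<one>\<^sub>S" "\<sigma> \<cdot> \<sigma> = \<one>\<^sub>S" "\<sigma> \<notin> carrier Bir_S_over_proj"
        unfolding invH by auto
      obtain g where g: "g \<in> ?H" "g \<cdot> \<sigma> \<cdot> inv\<^sub>S g \<in> ?K"
        using involution_conjugate_regular[OF \<sigma>'(1,3,4)] .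
      let ?\<tau> = "g \<cdot> \<sigma> \<cdot> inv\<^sub>S g"
      have B: "g \<in> carrier (Bir S)" "\<sigma> \<in> carrier (Bir S)"
        using g \<sigma>' subgroup.subset[OF subgroup_Bir_S_proj] by auto
      have "?\<tau> \<cdot> ?\<tau> = g \<cdot> (\<sigma> \<cdot> \<sigma>) \<cdot> inv\<^sub>S g"
        using B by (simp add: Bir_S.m_assoc Bir_S.inv_solve_left')
      then have 2: "?\<tau> \<cdot> ?\<tau> = \<one>\<^sub>S" using B unfolding \<sigma>'(3) by simp
      have over: "?\<tau> \<notin> carrier Bir_S_over_proj" using conj_over_proj[OF g(1) \<sigma>'(1)] \<sigma>'(4) by blast
      have "\<one>\<^sub>S \<in> carrier Bir_S_over_proj"
      proof -
        have "id \<in> \<one>\<^sub>S" using S.Bir_one_rep S.rat_rep_id by simp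
        moreover have "covers 1 0 0 1 id" unfolding covers_def by simp
        ultimately show ?thesis using over_proj_iff[OF Bir_S.one_closed] by blast
      qed
      then have "?\<tau> \<noteq> \<one>\<^sub>S" using over by auto
      then have "?\<tau> \<in> ?J" unfolding JI invH using 2 over g(2) KH by blast
      moreover have "conj_class Bir_S_proj ?\<tau> = C"
        unfolding \<sigma>(2) using Bir_S.conj_class_conj[OF subgroup_Bir_S_proj \<sigma>'(1) g(1)] H by simp
      ultimately show "C \<in> conj_class Bir_S_proj ` ?J" by blast
    qed
  qed
  also have "\<dots> = conj_classes Bir_S_proj ?I"
    unfolding conj_classes_def orbits_def conj_class_def[symmetric] by blast
  finally show ?thesis using ind by blast
qed

end
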